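(* Let $m\ge2$ be an integer. For each $i\in[1,m-1]$ there is an algebra homomorphism $\sigma_i:\overline{\mathbb G}_m^+\to\overline{\mathbb G}_m^+$ such that: (a) the homomorphisms $\sigma_i$ satisfy the braid group relations, i.e. $\sigma_i\sigma_{i+1}\sigma_i=\sigma_{i+1}\sigma_i\sigma_{i+1}$ for $1\le i\le m-2$ and $\sigma_i\sigma_j=\sigma_j\sigma_i$ for $|i-j|>1$; (b) $\sigma_i\circ\mathrm{sh}_m=\mathrm{sh}_m\circ\sigma_i$ for each $i\in[1,m-1]$; (c) for each $i\in[1,m-1]$ and any $x\in\mathbb G_m^+$ there is a positive integer $N$ such that $$\sigma_i\circ p(x)=p\circ\tilde\sigma_i^{(m,N')}(x)\qquad\text{for all }N'\ge N\text{ with }m\mid N',$$ where $p:\mathbb G_m^+\twoheadrightarrow\overline{\mathbb G}_m^+$ is the canonical projection and $\tilde\sigma_i^{(m,N')}$ is Fraser's braid group action (here $x$ is regarded as an element of $\mathbb C[\widetilde{\mathrm{Gr}}^\diamondsuit(m,N')]$, and $\tilde\sigma_i^{(m,N')}(x)$ is again an element of $\mathbb C[\widetilde{\mathrm{Gr}}^\diamondsuit(m,N')]$, regarded as an element of $\mathbb G_m^+$).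
   Context: $\mathcal C(m)$ is the set of strictly increasing $m$-tuples of integers and $\mathcal F(m)=\{(i,i+1,\dots,i+m-1): i\in\mathbb Z\}$. For $\mathbf i\in\mathcal C(m)$ let $\mathrm P_{\mathbf i}$ be an indeterminate; $\mathrm P$ of a permuted tuple is $\mathrm P_{\mathbf i}$ times the sign of the permutation, and $\mathrm P=0$ if an index repeats. $\mathbb G_m$ is the quotient of $\mathbb C[\mathrm P_{\mathbf i},\mathrm P_{\mathbf j}^{-1}:\mathbf i\in\mathcal C(m),\mathbf j\in\mathcal F(m)]$ by the ideal generated by the Plücker relations $\sum_{t=1}^{m+1}(-1)^t\mathrm P_{i_1,\dots,i_{m-1},j_t}\mathrm P_{j_1,\dots,\widehat{j_t},\dots,j_{m+1}}$ for $(i_1,\dots,i_{m-1})\in\mathcal C(m-1)$, $(j_1,\dots,j_{m+1})\in\mathcal C(m+1)$. $\overline{\mathbb G}_m$ is the quotient of $\mathbb G_m$ by the ideal generated by all $\mathrm P_{\mathbf j}-1$, $\mathbf j\in\mathcal F(m)$. $\mathrm{sh}_t$ ($t\in\mathbb Z$) is the automorphism $\mathrm P_{\mathbf i}\mapsto\mathrm P_{\mathbf i+t}$ of $\mathbb G_m$ and of $\overline{\mathbb G}_m$ (adding $t$ to all entries); for $t\geq 0$ it restricts to an endomorphism of $\overline{\mathbb G}_m^+$. $\mathbb G_m^+$ (resp. $\mathbb G_m^{N}$) is the subalgebra of $\mathbb G_m$ generated by the $\mathrm P_{\mathbf i}$, $\mathbf i\in\mathcal C(m)$, with all entries in $[1,\infty)$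 (resp. $[1,N]$) together with the inverses $\mathrm P_{\mathbf j}^{-1}$ of those with $\mathbf j\in\mathcal F(m)$; $\overline{\mathbb G}_m^+$ is the image of $\mathbb G_m^+$ in $\overline{\mathbb G}_m$. Let $m\mid N$ and $V=\mathbb C^m$. $\widetilde{\mathrm{Gr}}(m,N)$ is the affine cone over the Grassmannian of $m$-dimensional subspaces of $\mathbb C^N$, with Plücker coordinates $\Delta_{\mathbf i}$; $\widetilde{\mathrm{Gr}}^\circ(m,N)$ is the open subset where all cyclically consecutive Plücker coordinates (indices mod $N$) are nonzero. It is identified with $\mathrm{SL}(V)\backslash(V^N)^\circ$, where $(V^N)^\circ$ is the set of $N$-tuples $(v_1,\dots,v_N)$ in which any cyclically consecutive $m$ vectors are linearly independent, with $\Delta_{\mathbf i}(v)=\det(v_{i_1},\dots,v_{i_m})$. $\mathbb C[\widetilde{\mathrm{Gr}}^\diamondsuit(m,N)]\subset\mathbb C[\widetilde{\mathrm{Gr}}^\circ(m,N)]$ is the localization of $\mathbb C[\widetilde{\mathrm{Gr}}(m,N)]$ at the $\Delta_{\mathbf j}$, $\mathbf j\in\mathcal F(m)$, $\mathbf j\subset[1,N]$; it is identified with $\mathbb G_m^N$ via $\Delta_{\mathbf i}\leftrightarrow\mathrm P_{\mathbf i}$. Fraser's action: for $i\in[1,m-1]$, $\tilde\sigma_i^{(m,N)}$ is the pullback on $\mathbb C[\widetilde{\mathrm{Gr}}^\circ(m,N)]$ of the map $\kappa_i$ on $\mathrm{SL}(V)\backslash(V^N)^\circ$ which, for every $0\le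 t<N/m$ simultaneously, replaces the pair of vectors in positions $(tm+i,tm+i+1)$ by $(v_{tm+i+1},w_t)$, where $w_t$ is uniquely determined by $v_{tm+i}\wedge v_{tm+i+1}=v_{tm+i+1}\wedge w_t$ and $w_t\in\mathrm{span}\{v_{tm+i+2},\dots,v_{tm+i+m}\}$ (indices mod $N$); explicitly $w_t=\frac{\det(v_{tm+i},v_{tm+i+2},\dots,v_{tm+i+m})}{\det(v_{tm+i+1},v_{tm+i+2},\dots,v_{tm+i+m})}v_{tm+i+1}-v_{tm+i}$. *)

theory Defs
  imports
    "HOL-Library.Poly_Mapping"
    "HOL-Library.FuncSet"
    "HOL-Combinatorics.Permutations"
    "HOL-Algebra.QuotRing"
    "HOL-Algebra.Generated_Rings"
    "HOL-Algebra.Module"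
    "Jordan_Normal_Form.Determinant"
begin

section \<open>Complex algebras\<close>

text \<open>Algebras over the complex numbers are records of the library type
  \<^typ>\<open>(complex, 'a) module\<close>: a ring together with a scalar multiplication.\<close>

definition alg_hom :: "(complex, 'a) module \<Rightarrow> (complex, 'b) module \<Rightarrow> ('a \<Rightarrow> 'b) set" where
  "alg_hom A B = {h \<in> Ring.ring_hom A B.
     \<forall>c. \<forall>x \<in> carrier A. h (c \<odot>\<^bsub>A\<^esub> x) = c \<odot>\<^bsub>B\<^esub> h x}"

definition alg_iso :: "(complex, 'a) module \<Rightarrow> (complex, 'b) module \<Rightarrow> ('a \<Rightarrow> 'b) set" where
  "alg_iso A B = {h \<in> alg_hom A B. bij_betw h (carrier A) (carrier B)}"

text \<open>The quotient ring \<open>A Quot I\<close> of the library carries no scalar multiplication; here it is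
  added, in the style of \<^const>\<open>rcoset_mult\<close>: \<open>c \<odot> (I + x) = I + c \<odot> x\<close>.\<close>

definition quot_alg :: "(complex, 'a) module \<Rightarrow> 'a set \<Rightarrow> (complex, 'a set) module" where
  "quot_alg A I =
    \<lparr>carrier = carrier (A Quot I), monoid.mult = monoid.mult (A Quot I),
     monoid.one = monoid.one (A Quot I),
     ring.zero = ring.zero (A Quot I), ring.add = ring.add (A Quot I),
     module.smult = (\<lambda>c X. \<Union>x\<in>X. I +>\<^bsub>A\<^esub> (c \<odot>\<^bsub>A\<^esub> x))\<rparr>"

text \<open>The subalgebra generated by a set is the subring generated by it together with the
  scalar multiples of the unit.\<close>

definition gen_subalg :: "(complex, 'a) module \<Rightarrow> 'a set \<Rightarrow> (complex, 'a) module" where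
  "gen_subalg A S =
     A\<lparr>carrier := generate_ring A (S \<union> {c \<odot>\<^bsub>A\<^esub> \<one>\<^bsub>A\<^esub> | c. True})\<rparr>"


section \<open>The algebras \<open>G m\<close> and \<open>Gbar m\<close>\<close>

definition tuples :: "nat \<Rightarrow> int list set" where
  "tuples m = {xs. length xs = m \<and> sorted_wrt (<) xs}"

definition consec :: "nat \<Rightarrow> int list set" where
  "consec m = {[a..a + int m - 1] | a. True}"

text \<open>A Laurent polynomial is a finitely supported map from Laurent monomials to the complex
  numbers, a Laurent monomial a finitely supported map from variables to integer exponents.  The
  multiplication of \<open>\<Rightarrow>\<^sub>0\<close> is the convolution product.\<close>

type_synonym laurent = "(int list \<Rightarrow>\<^sub>0 int) \<Rightarrow>\<^sub>0 complex"

definition Lvar :: "int list \<Rightarrow> laurent" where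
  "Lvar xs = Poly_Mapping.single (Poly_Mapping.single xs 1) 1"

definition Lvar_inv :: "int list \<Rightarrow> laurent" where
  "Lvar_inv xs = Poly_Mapping.single (Poly_Mapping.single xs (- 1)) 1"

text \<open>The ring of polynomials in the variables indexed by \<open>tuples m\<close>, with those indexed by
  \<open>consec m\<close> inverted: negative exponents occur only at the latter.\<close>

definition laurent_alg :: "nat \<Rightarrow> (complex, laurent) module" where
  "laurent_alg m =
    \<lparr>carrier = {f. \<forall>\<mu> \<in> Poly_Mapping.keys f. Poly_Mapping.keys \<mu> \<subseteq> tuples m \<and>
        (\<forall>xs \<in> Poly_Mapping.keys \<mu> - consec m. Poly_Mapping.lookup \<mu> xs \<ge> 0)},
     monoid.mult = (*), monoid.one = 1, ring.zero = 0, ring.add = (+),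
     module.smult = (\<lambda>c f. Poly_Mapping.single 0 c * f)\<rparr>"

definition psym :: "int list \<Rightarrow> laurent" where
  "psym xs =
    (if distinct xs
     then of_int (sign (THE \<pi>. \<pi> permutes {..<length xs} \<and> permute_list \<pi> (sort xs) = xs))
            * Lvar (sort xs)
     else 0)"

definition plucker_rels :: "nat \<Rightarrow> laurent set" where
  "plucker_rels m =
    {\<Sum>t = 1..m + 1. (- 1) ^ t * psym (ks @ [js ! (t - 1)]) * psym (take (t - 1) js @ drop t js)
     | ks js. ks \<in> tuples (m - 1) \<and> js \<in> tuples (m + 1)}"

definition plucker_ideal :: "nat \<Rightarrow> laurent set" where
  "plucker_ideal m = genideal (laurent_alg m) (plucker_rels m)"

definition G :: "nat \<Rightarrow> (complex, laurent set) module" where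
  "G m = quot_alg (laurent_alg m) (plucker_ideal m)"

definition Gvar :: "nat \<Rightarrow> int list \<Rightarrow> laurent set" where
  "Gvar m xs = plucker_ideal m +>\<^bsub>laurent_alg m\<^esub> Lvar xs"

definition Gvar_inv :: "nat \<Rightarrow> int list \<Rightarrow> laurent set" where
  "Gvar_inv m xs = plucker_ideal m +>\<^bsub>laurent_alg m\<^esub> Lvar_inv xs"

definition bar_ideal :: "nat \<Rightarrow> laurent set set" where
  "bar_ideal m = genideal (G m) {Gvar m xs \<ominus>\<^bsub>G m\<^esub> \<one>\<^bsub>G m\<^esub> | xs. xs \<in> consec m}"

definition Gbar :: "nat \<Rightarrow> (complex, laurent set set) module" where
  "Gbar m = quot_alg (G m) (bar_ideal m)"

definition bar_proj :: "nat \<Rightarrow> laurent set \<Rightarrow> laurent set set" where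
  "bar_proj m x = bar_ideal m +>\<^bsub>G m\<^esub> x"

definition G_on :: "nat \<Rightarrow> int set \<Rightarrow> (complex, laurent set) module" where
  "G_on m J = gen_subalg (G m)
     ({Gvar m xs | xs. xs \<in> tuples m \<and> set xs \<subseteq> J} \<union>
      {Gvar_inv m xs | xs. xs \<in> consec m \<and> set xs \<subseteq> J})"

definition Gplus :: "nat \<Rightarrow> (complex, laurent set) module" where
  "Gplus m = G_on m {1..}"

definition Gfin :: "nat \<Rightarrow> nat \<Rightarrow> (complex, laurent set) module" where
  "Gfin m N = G_on m {1..int N}"

definition Gbar_plus :: "nat \<Rightarrow> (complex, laurent set set) module" where
  "Gbar_plus m = (Gbar m)\<lparr>carrier := bar_proj m ` carrier (Gplus m)\<rparr>"

definition sh :: "nat \<Rightarrow> int \<Rightarrow> laurent set set \<Rightarrow> laurent set set" where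
  "sh m t = (THE \<phi>. \<phi> \<in> alg_iso (Gbar m) (Gbar m) \<and> \<phi> \<in> extensional (carrier (Gbar m)) \<and>
     (\<forall>xs \<in> tuples m. \<phi> (bar_proj m (Gvar m xs)) = bar_proj m (Gvar m (map (\<lambda>k. k + t) xs))))"


section \<open>Vector configurations and the coordinate rings of Grassmannians\<close>

definition cyc :: "nat \<Rightarrow> int \<Rightarrow> int" where
  "cyc N k = (k - 1) mod int N + 1"

definition Delta :: "nat \<Rightarrow> int list \<Rightarrow> (int \<Rightarrow> complex vec) \<Rightarrow> complex" where
  "Delta m xs v = det (mat_of_cols m (map v xs))"

definition config :: "nat \<Rightarrow> nat \<Rightarrow> (int \<Rightarrow> complex vec) set" where
  "config m N = {v \<in> {1..int N} \<rightarrow>\<^sub>E carrier_vec m.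
     \<forall>a. Delta m (map (cyc N) [a..a + int m - 1]) v \<noteq> 0}"

definition fun_alg :: "'a set \<Rightarrow> (complex, 'a \<Rightarrow> complex) module" where
  "fun_alg X =
    \<lparr>carrier = X \<rightarrow>\<^sub>E UNIV,
     monoid.mult = (\<lambda>f g. \<lambda>x\<in>X. f x * g x), monoid.one = (\<lambda>x\<in>X. 1),
     ring.zero = (\<lambda>x\<in>X. 0), ring.add = (\<lambda>f g. \<lambda>x\<in>X. f x + g x),
     module.smult = (\<lambda>c f. \<lambda>x\<in>X. c * f x)\<rparr>"

text \<open>Regular functions on the open part of the affine cone are realized as functions on the set
  of configurations.  They are invariant under the special linear group, because their generators,
  the Pluecker coordinates and the inverses of some of them, are; so these are functions on the
  quotient by that group.\<close>

definition coord_circ :: "nat \<Rightarrow> nat \<Rightarrow> (complex, (int \<Rightarrow> complex vec) \<Rightarrow> complex) module" where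
  "coord_circ m N = gen_subalg (fun_alg (config m N))
     ({\<lambda>v\<in>config m N. Delta m xs v | xs. xs \<in> tuples m \<and> set xs \<subseteq> {1..int N}} \<union>
      {\<lambda>v\<in>config m N. inverse (Delta m (map (cyc N) xs) v) | xs. xs \<in> consec m})"

definition coord_diamond :: "nat \<Rightarrow> nat \<Rightarrow> (complex, (int \<Rightarrow> complex vec) \<Rightarrow> complex) module" where
  "coord_diamond m N = gen_subalg (fun_alg (config m N))
     ({\<lambda>v\<in>config m N. Delta m xs v | xs. xs \<in> tuples m \<and> set xs \<subseteq> {1..int N}} \<union>
      {\<lambda>v\<in>config m N. inverse (Delta m xs v) | xs. xs \<in> consec m \<and> set xs \<subseteq> {1..int N}})"

text \<open>The values on the variables determine the isomorphism: it is linear, and the inverses of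
  the variables go to the inverses of the images.\<close>

definition to_coord :: "nat \<Rightarrow> nat \<Rightarrow> laurent set \<Rightarrow> (int \<Rightarrow> complex vec) \<Rightarrow> complex" where
  "to_coord m N = (THE \<phi>. \<phi> \<in> alg_iso (Gfin m N) (coord_diamond m N) \<and>
     \<phi> \<in> extensional (carrier (Gfin m N)) \<and>
     (\<forall>xs \<in> tuples m. set xs \<subseteq> {1..int N} \<longrightarrow>
        \<phi> (Gvar m xs) = (\<lambda>v\<in>config m N. Delta m xs v)))"

definition from_coord :: "nat \<Rightarrow> nat \<Rightarrow> ((int \<Rightarrow> complex vec) \<Rightarrow> complex) \<Rightarrow> laurent set" where
  "from_coord m N = inv_into (carrier (Gfin m N)) (to_coord m N)"


section \<open>Fraser's action\<close>

text \<open>The vector \<open>w\<close> with \<open>v a \<and> v (a + 1) = v (a + 1) \<and> w\<close> that lies in the span of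
  \<open>v (a + 2), \<dots>, v (a + m)\<close>.\<close>

definition fraser_vec :: "nat \<Rightarrow> nat \<Rightarrow> (int \<Rightarrow> complex vec) \<Rightarrow> int \<Rightarrow> complex vec" where
  "fraser_vec m N v a =
     (Delta m (map (cyc N) (a # [a + 2..a + int m])) v /
      Delta m (map (cyc N) ((a + 1) # [a + 2..a + int m])) v) \<cdot>\<^sub>v v (cyc N (a + 1)) - v (cyc N a)"

text \<open>\<open>int m dvd k - int i\<close> says that \<open>k\<close> is the first position \<open>t m + i\<close> of a pair, and
  \<open>int m dvd k - int i - 1\<close> that it is the second position \<open>t m + i + 1\<close>.\<close>

definition kappa :: "nat \<Rightarrow> nat \<Rightarrow> nat \<Rightarrow> (int \<Rightarrow> complex vec) \<Rightarrow> int \<Rightarrow> complex vec" where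
  "kappa m N i v = (\<lambda>k\<in>{1..int N}.
     if int m dvd k - int i then v (k + 1)
     else if int m dvd k - int i - 1 then fraser_vec m N v (k - 1)
     else v k)"

definition fraser :: "nat \<Rightarrow> nat \<Rightarrow> nat \<Rightarrow> ((int \<Rightarrow> complex vec) \<Rightarrow> complex)
    \<Rightarrow> (int \<Rightarrow> complex vec) \<Rightarrow> complex" where
  "fraser m N i = (\<lambda>f \<in> carrier (coord_circ m N). \<lambda>v \<in> config m N. f (kappa m N i v))"

end

theory Submission
  imports Defs "HOL-Analysis.Continuum_Not_Denumerable"
begin

text \<open>An element of \<open>G m\<close> is determined by its values on the sequences of vectors, indexed by the
  integers, in which any \<open>m\<close> consecutive vectors are independent.  Indeed, up to a unit, the Pluecker
  relations rewrite it as a Laurent polynomial in the coordinates with at most one index outside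
  \<open>[1, m]\<close>, and these take arbitrary nonzero values.  So Fraser's map, written without reduction of
  the indices modulo \<open>N\<close>, acts on \<open>G m\<close> by precomposition.  It sends functions of the first \<open>n\<close> vectors
  to functions of the first \<open>n + m + 1\<close> vectors, and on \<open>N\<close>-periodic sequences it is the map \<open>kappa\<close>;
  this gives (c).  The braid and commutation relations hold already for the vectors, before passing to
  the quotient \<open>Gbar m\<close>: three adjacent positions, modulo the span of the positions that do not move,
  are governed by \<open>3 \<times> 3\<close> determinants.\<close>

section \<open>Determinants of lists of columns\<close>

text \<open>The algebra \<open>G m\<close> is given by generators and relations, Fraser's map by
  formulas on vectors. To pass from one to the other, the quadratic relations have to generate the
  whole ideal of functions that vanish on configurations. The obstacle is that the points realising
  arbitrary chart coordinates may violate the independence conditions, of which there are infinitely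
  many because the index set is all of the integers. They are therefore approached along a line that
  meets the bad locus in a countable set. The same device compares two different sets of open
  conditions: those on consecutive windows of integers, and those on cyclic windows modulo N, which
  cross the seam between N and 1. The map on N vectors differs from the one on the half-line only
  through wrap-around; as each index looks ahead by at most m + 1 positions, it stays clear of the
  seam for large N. Finally, \<open>sh\<close> and \<open>to_coord\<close> are definite
  descriptions, so each of them calls for existence and uniqueness of a homomorphism with given
  values on the variables.\<close>

abbreviation cdet :: "nat \<Rightarrow> complex vec list \<Rightarrow> complex" where
  "cdet m cs \<equiv> det (mat_of_cols m cs)"

lemma mat_of_cols_drop_nth:
  assumes "length cs = Suc m" "j < Suc m"
  shows "mat_of_cols m (take j cs @ drop (Suc j) cs)
    = mat m m (\<lambda>(r, c). cs ! (if c < j then c else Suc c) $ r)"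
  using assms by (intro eq_matI) (auto simp: mat_of_cols_index nth_append min_def)

lemma cdet_expand_col:
  assumes "length as + length bs + 1 = m"
  obtains C where "\<And>x. cdet m (as @ x # bs) = (\<Sum>i<m. x $ i * C i)"
proof -
  \<comment> \<open>A cofactor along a column does not see that column, so the zero vector stands in
    for x and C depends on the other columns only.\<close>
  define C where "C i = cofactor (mat_of_cols m (as @ 0\<^sub>v m # bs)) i (length as)" for i
  have "cdet m (as @ x # bs) = (\<Sum>i<m. x $ i * C i)" for x
  proof -
    let ?M = "mat_of_cols m (as @ x # bs)"
    have M: "?M \<in> carrier_mat m m"
      using assms by (metis add.assoc add.right_neutral add_Suc_right length_Cons length_append mat_of_cols_carrier(1) One_nat_def)
    have "cdet m (as @ x # bs) = (\<Sum>i<m. ?M $$ (i, length as) * cofactor ?M i (length as))"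
      using assms by (intro laplace_expansion_column[OF M]) auto
    also have "\<dots> = (\<Sum>i<m. x $ i * C i)"
    proof (rule sum.cong[OF refl])
      fix i assume "i \<in> {..<m}"
      then have i: "i < m" by simp
      have "mat_delete ?M i (length as) = mat_delete (mat_of_cols m (as @ 0\<^sub>v m # bs)) i (length as)"
        unfolding mat_delete_def
        by (intro eq_matI) (auto simp: mat_of_cols_def nth_append nth_Cons' )
      then show "?M $$ (i, length as) * cofactor ?M i (length as) = x $ i * C i"
        using i assms by (simp add: C_def cofactor_def mat_of_cols_index nth_append)
    qed
    finally show ?thesis .
  qed
  then show ?thesis by (rule that)
qed

lemma cdet_add:
  assumes "length as + length bs + 1 = m" "x \<in> carrier_vec m" "y \<in> carrier_vec m"
  shows "cdet m (as @ (x + y) # bs) = cdet m (as @ x # bs) + cdet m (as @ y # bs)"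
proof -
  obtain C where "\<And>x. cdet m (as @ x # bs) = (\<Sum>i<m. x $ i * C i)"
    using cdet_expand_col[OF assms(1)] by blast
  then show ?thesis using assms by (simp add: algebra_simps sum.distrib)
qed

lemma cdet_smult:
  assumes "length as + length bs + 1 = m" "x \<in> carrier_vec m"
  shows "cdet m (as @ (c \<cdot>\<^sub>v x) # bs) = c * cdet m (as @ x # bs)"
proof -
  obtain C where "\<And>x. cdet m (as @ x # bs) = (\<Sum>i<m. x $ i * C i)"
    using cdet_expand_col[OF assms(1)] by blast
  then show ?thesis using assms by (simp add: algebra_simps sum_distrib_left)
qed

lemma cdet_lincomb:
  assumes "length as + length bs + 1 = m" "x \<in> carrier_vec m" "y \<in> carrier_vec m"
  shows "cdet m (as @ (c \<cdot>\<^sub>v x - y) # bs) = c * cdet m (as @ x # bs) - cdet m (as @ y # bs)"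
proof -
  have "c \<cdot>\<^sub>v x - y = c \<cdot>\<^sub>v x + (- 1) \<cdot>\<^sub>v y"
    using assms by auto
  then show ?thesis using assms by (simp add: cdet_add cdet_smult)
qed

lemma cdet_identical:
  assumes "length cs = m" "\<not> distinct cs"
  shows "cdet m cs = 0"
proof -
  from assms(2) obtain i j where ij: "i < length cs" "j < length cs" "i \<noteq> j" "cs ! i = cs ! j"
    by (auto simp: distinct_conv_nth)
  show ?thesis
    by (rule det_identical_columns[of _ m i j]) (use ij assms in \<open>auto simp: col_def mat_of_cols_index intro!: eq_vecI\<close>)
qed

lemma cdet_permute:
  assumes "length cs = m" "\<pi> permutes {..<m}"
  shows "cdet m (permute_list \<pi> cs) = of_int (sign \<pi>) * cdet m cs"
proof -
  have pi: "\<pi> permutes {0..<m}" using assms by (simp add: lessThan_atLeast0)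
  have M: "mat_of_cols m ds \<in> carrier_mat m m" if "length ds = m" for ds :: "complex vec list"
    using that by auto
  have "cdet m (permute_list \<pi> cs) = det ((mat_of_cols m (permute_list \<pi> cs))\<^sup>T)"
    by (rule det_transpose[symmetric, of _ m]) (use assms in \<open>auto\<close>)
  also have "(mat_of_cols m (permute_list \<pi> cs))\<^sup>T = mat m m (\<lambda>(i,j). (mat_of_cols m cs)\<^sup>T $$ (\<pi> i, j))"
    using assms permutes_in_image[OF assms(2)]
    by (intro eq_matI) (auto simp: mat_of_cols_index permute_list_nth)
  also have "det \<dots> = of_int (sign \<pi>) * det ((mat_of_cols m cs)\<^sup>T)"
    by (rule det_permute_rows[OF _ pi]) (use assms in auto)
  also have "det ((mat_of_cols m cs)\<^sup>T) = cdet m cs"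
    by (rule det_transpose[of _ m]) (use assms in auto)
  finally show ?thesis .
qed

text \<open>Polarization: the determinant with x + y in both places vanishes, and so do two of its
  four terms.\<close>

lemma cdet_swap:
  assumes "length as + length bs + 2 = m" "x \<in> carrier_vec m" "y \<in> carrier_vec m"
  shows "cdet m (as @ x # y # bs) = - cdet m (as @ y # x # bs)"
proof -
  have add2: "cdet m (as @ u # (x + y) # bs) = cdet m (as @ u # x # bs) + cdet m (as @ u # y # bs)" for u
    using cdet_add[of "as @ [u]" bs m x y] assms by simp
  have id: "cdet m (as @ u # u # bs) = 0" for u
    by (rule cdet_identical) (use assms in auto)
  have "0 = cdet m (as @ (x + y) # (x + y) # bs)" by (simp add: id)
  also have "\<dots> = cdet m (as @ x # (x + y) # bs) + cdet m (as @ y # (x + y) # bs)"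
    by (rule cdet_add) (use assms in auto)
  also have "\<dots> = cdet m (as @ x # y # bs) + cdet m (as @ y # x # bs)"
    by (simp add: add2 id)
  finally show ?thesis by (simp add: eq_neg_iff_add_eq_0)
qed

lemma cdet_move:
  assumes "length as + length ts + length bs + 1 = m"
    "x \<in> carrier_vec m" "set ts \<subseteq> carrier_vec m"
  shows "cdet m (as @ ts @ x # bs) = (- 1) ^ length ts * cdet m (as @ x # ts @ bs)"
  using assms
proof (induction ts arbitrary: as)
  case (Cons t ts)
  have "cdet m (as @ (t # ts) @ x # bs) = cdet m ((as @ [t]) @ ts @ x # bs)" by simp
  also have "\<dots> = (- 1) ^ length ts * cdet m ((as @ [t]) @ x # ts @ bs)"
    by (rule Cons.IH) (use Cons.prems in auto)
  also have "cdet m ((as @ [t]) @ x # ts @ bs) = - cdet m (as @ x # t # ts @ bs)"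
    using cdet_swap[of as "ts @ bs" m t x] Cons.prems by simp
  finally show ?case by simp
qed simp

section \<open>Pluecker relations between determinants\<close>

lemma plucker_cdet:
  assumes "length ks + 1 = m" "length js = m + 1"
  shows "(\<Sum>t<m + 1. (- 1) ^ t * cdet m (ks @ [js ! t]) * cdet m (take t js @ drop (Suc t) js)) = 0"
proof -
  obtain C where C: "\<And>x. cdet m (ks @ [x]) = (\<Sum>i<m. x $ i * C i)"
    using cdet_expand_col[of ks "[]" m] assms by auto
  have *: "(\<Sum>t<m + 1. (- 1) ^ t * (js ! t $ i) * cdet m (take t js @ drop (Suc t) js)) = 0"
    if i: "i < m" for i
  proof -
    \<comment> \<open>For fixed i the sum is the Laplace expansion, along the top row, of the matrix
      with the m + 1 columns \<open>js\<close> and with its row i repeated on top.\<close>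
    define M where "M = mat (m + 1) (m + 1) (\<lambda>(r, t). if r = 0 then js ! t $ i else js ! t $ (r - 1))"
    have M: "M \<in> carrier_mat (m + 1) (m + 1)" by (simp add: M_def)
    have "det M = 0"
      by (rule det_identical_rows[OF M, of 0 "i + 1"]) (use i in \<open>auto simp: M_def intro!: eq_vecI\<close>)
    moreover have "det M = (\<Sum>t<m + 1. M $$ (0, t) * cofactor M 0 t)"
      by (rule laplace_expansion_row[OF M]) simp
    moreover have "M $$ (0, t) * cofactor M 0 t
        = (- 1) ^ t * (js ! t $ i) * cdet m (take t js @ drop (Suc t) js)" if "t < m + 1" for t
    proof -
      have "mat_delete M 0 t = mat_of_cols m (take t js @ drop (Suc t) js)"
        unfolding mat_delete_def using that assms
        by (subst mat_of_cols_drop_nth) (auto simp: M_def intro!: eq_matI)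
      then show ?thesis using that by (simp add: cofactor_def M_def)
    qed
    ultimately show ?thesis by simp
  qed
  have "(\<Sum>t<m + 1. (- 1) ^ t * cdet m (ks @ [js ! t]) * cdet m (take t js @ drop (Suc t) js))
      = (\<Sum>t<m + 1. \<Sum>i<m. C i * ((- 1) ^ t * (js ! t $ i) * cdet m (take t js @ drop (Suc t) js)))"
    by (simp add: C sum_distrib_left sum_distrib_right algebra_simps)
  also have "\<dots> = (\<Sum>i<m. C i * (\<Sum>t<m + 1. (- 1) ^ t * (js ! t $ i) * cdet m (take t js @ drop (Suc t) js)))"
    by (subst sum.swap) (simp only: sum_distrib_left)
  also have "\<dots> = 0" using * by simp
  finally show ?thesis .
qed

text \<open>The Pluecker relation for \<open>v # ts\<close> and \<open>u # y # p # ts\<close>: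
  exchanging an entry of \<open>ts\<close> repeats a column, so three terms survive.\<close>

lemma cdet_exchange2:
  assumes "length ts + 2 = m" "set ts \<subseteq> carrier_vec m" "u \<in> carrier_vec m" "v \<in> carrier_vec m"
    "y \<in> carrier_vec m" "p \<in> carrier_vec m"
  shows "cdet m (u # v # ts) * cdet m (y # p # ts) =
    cdet m (y # v # ts) * cdet m (u # p # ts) + cdet m (p # v # ts) * cdet m (y # u # ts)"
proof -
  define s :: complex where "s = (- 1) ^ length ts"
  have last: "cdet m (v # ts @ [k]) = - s * cdet m (k # v # ts)" if "k \<in> carrier_vec m" for k
    using cdet_move[of "[v]" ts "[]" m k] cdet_swap[of "[]" ts m v k] that assms
    by (auto simp: s_def)
  have rep: "cdet m (v # ts @ [ts ! t]) = 0" if "t < length ts" for t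
    by (rule cdet_identical) (use assms that in auto)
  have m1: "m + 1 = Suc (Suc (Suc (length ts)))" using assms by simp
  have "(\<Sum>t<m + 1. (- 1) ^ t * cdet m ((v # ts) @ [(u # y # p # ts) ! t])
      * cdet m (take t (u # y # p # ts) @ drop (Suc t) (u # y # p # ts))) = 0"
    by (rule plucker_cdet) (use assms in auto)
  then have "- (s * (cdet m (u # v # ts) * cdet m (y # p # ts))) +
    s * (cdet m (y # v # ts) * cdet m (u # p # ts)) - s * (cdet m (p # v # ts) * cdet m (u # y # ts)) = 0"
    unfolding m1 by (simp add: sum.lessThan_Suc_shift rep last assms del: sum.lessThan_Suc)
      (simp add: algebra_simps)
  moreover have "cdet m (u # y # ts) = - cdet m (y # u # ts)"
    using cdet_swap[of "[]" ts m u y] assms by simp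
  ultimately have "s * (cdet m (u # v # ts) * cdet m (y # p # ts)) = s *
    (cdet m (y # v # ts) * cdet m (u # p # ts) + cdet m (p # v # ts) * cdet m (y # u # ts))"
    by (simp add: algebra_simps)
  then show ?thesis by (simp add: s_def)
qed

text \<open>Cramer's rule modulo the span of \<open>ts\<close>: u is expanded in y, z, p. It is the
  Pluecker relation for \<open>v # w # ts\<close> and \<open>u # y # z # p # ts\<close>, of which
  four terms survive.\<close>

lemma cdet_exchange3:
  assumes "length ts + 3 = m" "set ts \<subseteq> carrier_vec m" "u \<in> carrier_vec m" "v \<in> carrier_vec m"
    "w \<in> carrier_vec m" "y \<in> carrier_vec m" "z \<in> carrier_vec m" "p \<in> carrier_vec m"
  shows "cdet m (u # v # w # ts) * cdet m (y # z # p # ts) =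
    cdet m (y # v # w # ts) * cdet m (u # z # p # ts) +
    cdet m (z # v # w # ts) * cdet m (y # u # p # ts) +
    cdet m (p # v # w # ts) * cdet m (y # z # u # ts)"
proof -
  define s :: complex where "s = (- 1) ^ length ts"
  have last: "cdet m (v # w # ts @ [k]) = s * cdet m (k # v # w # ts)" if "k \<in> carrier_vec m" for k
    using cdet_move[of "[v, w]" ts "[]" m k] cdet_swap[of "[]" "w # ts" m v k]
      cdet_swap[of "[v]" ts m w k] that assms
    by (auto simp: s_def)
  have rep: "cdet m (v # w # ts @ [ts ! t]) = 0" if "t < length ts" for t
    by (rule cdet_identical) (use assms that in auto)
  have m1: "m + 1 = Suc (Suc (Suc (Suc (length ts))))" using assms by simp
  have "(\<Sum>t<m + 1. (- 1) ^ t * cdet m ((v # w # ts) @ [(u # y # z # p # ts) ! t])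
      * cdet m (take t (u # y # z # p # ts) @ drop (Suc t) (u # y # z # p # ts))) = 0"
    by (rule plucker_cdet) (use assms in auto)
  then have "s * (cdet m (u # v # w # ts) * cdet m (y # z # p # ts)) -
    s * (cdet m (y # v # w # ts) * cdet m (u # z # p # ts)) +
    s * (cdet m (z # v # w # ts) * cdet m (u # y # p # ts)) -
    s * (cdet m (p # v # w # ts) * cdet m (u # y # z # ts)) = 0"
    unfolding m1 by (simp add: sum.lessThan_Suc_shift rep last assms del: sum.lessThan_Suc)
      (simp add: algebra_simps)
  moreover have "cdet m (u # y # p # ts) = - cdet m (y # u # p # ts)"
    using cdet_swap[of "[]" "p # ts" m u y] assms by simp
  moreover have "cdet m (u # y # z # ts) = cdet m (y # z # u # ts)"
    using cdet_swap[of "[]" "z # ts" m u y] cdet_swap[of "[y]" "ts" m u z] assms by simp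
  ultimately have "s * (cdet m (u # v # w # ts) * cdet m (y # z # p # ts)) = s *
    (cdet m (y # v # w # ts) * cdet m (u # z # p # ts) +
    cdet m (z # v # w # ts) * cdet m (y # u # p # ts) +
    cdet m (p # v # w # ts) * cdet m (y # z # u # ts))"
    by (simp add: algebra_simps)
  then show ?thesis by (simp add: s_def)
qed

text \<open>Modulo the span of \<open>ts\<close> the space is three-dimensional, and \<open>f\<close>, \<open>g\<close>, \<open>h\<close> are the coordinates in
  the basis \<open>y\<close>, \<open>z\<close>, \<open>p\<close>.\<close>

lemma cdet_coords3:
  assumes ts: "length ts + 3 = m" "set ts \<subseteq> carrier_vec m" and yzp: "y \<in> carrier_vec m"
    "z \<in> carrier_vec m" "p \<in> carrier_vec m"
    and nz: "cdet m (y # z # p # ts) \<noteq> 0"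
  obtains d f g h where "d \<noteq> 0"
    "f y = 1" "f z = 0" "f p = 0" "g y = 0" "g z = 1" "g p = 0" "h y = 0" "h z = 0" "h p = 1"
    "\<And>c u v. u \<in> carrier_vec m \<Longrightarrow> v \<in> carrier_vec m \<Longrightarrow> f (c \<cdot>\<^sub>v u - v) = c * f u - f v"
    "\<And>c u v. u \<in> carrier_vec m \<Longrightarrow> v \<in> carrier_vec m \<Longrightarrow> g (c \<cdot>\<^sub>v u - v) = c * g u - g v"
    "\<And>c u v. u \<in> carrier_vec m \<Longrightarrow> v \<in> carrier_vec m \<Longrightarrow> h (c \<cdot>\<^sub>v u - v) = c * h u - h v"
    "\<And>u v w. u \<in> carrier_vec m \<Longrightarrow> v \<in> carrier_vec m \<Longrightarrow> w \<in> carrier_vec m \<Longrightarrow>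
      cdet m (u # v # w # ts) = d * (f u * (g v * h w - h v * g w)
        - g u * (f v * h w - h v * f w) + h u * (f v * g w - g v * f w))"
proof -
  define br where "br u v w = cdet m (u # v # w # ts)" for u v w
  define d where "d = br y z p"
  define f where "f u = br u z p / d" for u
  define g where "g u = br y u p / d" for u
  define h where "h u = br y z u / d" for u
  let ?C = "carrier_vec m :: complex vec set"
  have d: "d \<noteq> 0" using nz by (simp add: d_def br_def)
  have alt: "br u u w = 0" "br u w u = 0" "br w u u = 0" for u w
    using cdet_identical[of "u # u # w # ts" m] cdet_identical[of "u # w # u # ts" m]
      cdet_identical[of "w # u # u # ts" m] ts by (auto simp: br_def)
  have cyc: "br u v w = br v w u" if "u \<in> ?C" "v \<in> ?C" "w \<in> ?C" for u v w
    using cdet_swap[of "[]" "w # ts" m u v] cdet_swap[of "[v]" ts m u w] that ts by (simp add: br_def)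
  have exch: "br u v w = f u * br y v w + g u * br z v w + h u * br p v w"
    if "u \<in> ?C" "v \<in> ?C" "w \<in> ?C" for u v w
    using cdet_exchange3[of ts m u v w y z p] that ts yzp d
    by (simp add: br_def[symmetric] f_def g_def h_def d_def[symmetric] field_simps)
  have formula: "br u v w = d * (f u * (g v * h w - h v * g w)
        - g u * (f v * h w - h v * f w) + h u * (f v * g w - g v * f w))"
    if C: "u \<in> ?C" "v \<in> ?C" "w \<in> ?C" for u v w
  proof -
    \<comment> \<open>Brackets with a basis vector in front are 2 x 2 minors of the coordinates;
      inserted into \<open>exch\<close> they give the expansion of a 3 x 3 determinant along
      u.\<close>
    have y2: "br y a b = d * (g a * h b - h a * g b)" if "a \<in> ?C" "b \<in> ?C" for a b
    proof -
      have "br y a b = br a b y" using cyc that yzp by blast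
      also have "\<dots> = g a * br z b y + h a * br p b y" using exch[of a b y] that yzp by (simp add: alt cyc[of y b y])
      also have "br z b y = h b * d"
        using cyc[of z b y] exch[of b y z] cyc[of p y z] that yzp by (simp add: alt d_def)
      also have "br p b y = - g b * d"
      proof -
        have "br p b y = br y p b" using cyc that yzp by metis
        also have "\<dots> = - br y b p"
          using cdet_swap[of "[y]" ts m p b] that yzp ts by (simp add: br_def)
        also have "\<dots> = - g b * d" using d by (simp add: g_def)
        finally show ?thesis .
      qed
      finally show ?thesis by (simp add: algebra_simps)
    qed
    have z2: "br z a b = - d * (f a * h b - h a * f b)" if "a \<in> ?C" "b \<in> ?C" for a b
    proof -
      have "br z a b = f a * br y b z + h a * br p b z"
        using cyc[of z a b] exch[of a b z] that yzp by (simp add: alt)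
      also have "br y b z = - d * h b"
        using cdet_swap[of "[y]" ts m b z] that yzp ts d by (simp add: br_def h_def)
      also have "br p b z = d * f b"
        using cyc[of p b z] cyc[of b z p] that yzp d by (simp add: f_def)
      finally show ?thesis by (simp add: algebra_simps)
    qed
    have p2: "br p a b = d * (f a * g b - g a * f b)" if "a \<in> ?C" "b \<in> ?C" for a b
    proof -
      have "br p a b = f a * br y b p + g a * br z b p"
        using cyc[of p a b] exch[of a b p] that yzp by (simp add: alt)
      also have "br y b p = d * g b" using d by (simp add: g_def)
      also have "br z b p = - d * f b"
        using cdet_swap[of "[]" "p # ts" m z b] that yzp ts d by (simp add: br_def f_def)
      finally show ?thesis by (simp add: algebra_simps)
    qed
    show ?thesis
      using exch[OF C] y2[of v w] z2[of v w] p2[of v w] C by (simp add: algebra_simps)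
  qed
  show ?thesis
  proof (rule that[of d f g h])
    show "f (c \<cdot>\<^sub>v u - v) = c * f u - f v" if "u \<in> ?C" "v \<in> ?C" for c u v
      using cdet_lincomb[of "[]" "z # p # ts" m u v c] that ts by (simp add: f_def br_def diff_divide_distrib)
    show "g (c \<cdot>\<^sub>v u - v) = c * g u - g v" if "u \<in> ?C" "v \<in> ?C" for c u v
      using cdet_lincomb[of "[y]" "p # ts" m u v c] that ts by (simp add: g_def br_def diff_divide_distrib)
    show "h (c \<cdot>\<^sub>v u - v) = c * h u - h v" if "u \<in> ?C" "v \<in> ?C" for c u v
      using cdet_lincomb[of "[y, z]" ts m u v c] that ts by (simp add: h_def br_def diff_divide_distrib)
    show "cdet m (u # v # w # ts) = d * (f u * (g v * h w - h v * g w)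
        - g u * (f v * h w - h v * f w) + h u * (f v * g w - g v * f w))"
      if "u \<in> ?C" "v \<in> ?C" "w \<in> ?C" for u v w
      using formula[OF that] by (simp add: br_def)
  qed (use d alt in \<open>auto simp: f_def g_def h_def d_def[symmetric]\<close>)
qed

text \<open>Here x, y, z stand in three adjacent moving positions, p, q, r one period later, and
  \<open>ts\<close> lists the fixed vectors in between. One composite sends the triple to z,
  \<open>\<gamma> \<cdot>\<^sub>v z - y\<close>, x', the other one to z, w1,
  \<open>\<delta> \<cdot>\<^sub>v w1 - u1\<close>. In coordinates with respect to y, z, p, the third
  vector is a multiple of p modulo \<open>ts\<close> on both sides. The parameters
  \<open>\<alpha>'\<close> and \<open>\<gamma>'\<close> are free, because they add multiples of q
  and r to determinants that already contain q and r.\<close>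

lemma braid_vectors:
  fixes x y z p q r :: "complex vec" and ts :: "complex vec list"
  assumes ts: "length ts + 3 = m" "set ts \<subseteq> carrier_vec m"
    and C: "x \<in> carrier_vec m" "y \<in> carrier_vec m" "z \<in> carrier_vec m"
      "p \<in> carrier_vec m" "q \<in> carrier_vec m" "r \<in> carrier_vec m"
    and nz: "cdet m (y # z # ts @ [p]) \<noteq> 0" "cdet m (z # ts @ [p, q]) \<noteq> 0" "cdet m (ts @ [p, q, r]) \<noteq> 0"
    and \<alpha>: "\<alpha> = cdet m (x # z # ts @ [p]) / cdet m (y # z # ts @ [p])"
    and w: "w = \<alpha> \<cdot>\<^sub>v y - x" and w': "w' = \<alpha>' \<cdot>\<^sub>v q - p"
    and \<beta>: "\<beta> = cdet m (w # ts @ [q, w']) / cdet m (z # ts @ [q, w'])"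
    and x': "x' = \<beta> \<cdot>\<^sub>v z - w"
    and \<gamma>: "\<gamma> = cdet m (y # x' # ts @ [q]) / cdet m (z # x' # ts @ [q])"
    and \<beta>1: "\<beta>1 = cdet m (y # ts @ [p, q]) / cdet m (z # ts @ [p, q])"
    and w1: "w1 = \<beta>1 \<cdot>\<^sub>v z - y"
    and \<gamma>1: "\<gamma>1 = cdet m (x # w1 # ts @ [p]) / cdet m (z # w1 # ts @ [p])"
    and u1: "u1 = \<gamma>1 \<cdot>\<^sub>v z - x" and u1': "u1' = \<gamma>' \<cdot>\<^sub>v r - p"
    and \<delta>: "\<delta> = cdet m (u1 # ts @ [r, u1']) / cdet m (w1 # ts @ [r, u1'])"
    and nzx: "cdet m (x # y # z # ts) \<noteq> 0"
  shows "\<gamma> \<cdot>\<^sub>v z - y = w1 \<and> x' = \<delta> \<cdot>\<^sub>v w1 - u1"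
proof -
  let ?C = "carrier_vec m :: complex vec set"
  define s :: complex where "s = (- 1) ^ length ts"
  have s2: "s * s = 1" by (simp add: s_def flip: power_add)
  have s: "s \<noteq> 0" by (simp add: s_def)
  \<comment> \<open>Each column moved across \<open>ts\<close> costs a factor s, so one or three
    columns give s and two give 1.\<close>
  have l1: "cdet m (a # b # ts @ [c]) = s * cdet m (a # b # c # ts)" if "c \<in> ?C" for a b c
    using cdet_move[of "[a, b]" ts "[]" m c] that ts by (simp add: s_def)
  have l2: "cdet m (a # ts @ [b, c]) = cdet m (a # b # c # ts)" if "b \<in> ?C" "c \<in> ?C" for a b c
  proof -
    have "cdet m (a # ts @ [b, c]) = s * cdet m (a # b # ts @ [c])"
      using cdet_move[of "[a]" ts "[c]" m b] that ts by (simp add: s_def)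
    then show ?thesis using l1[of c a b] that s2 by simp
  qed
  have l3: "cdet m (ts @ [a, b, c]) = s * cdet m (a # b # c # ts)" if "a \<in> ?C" "b \<in> ?C" "c \<in> ?C" for a b c
  proof -
    have "cdet m (ts @ [a, b, c]) = s * cdet m (a # ts @ [b, c])"
      using cdet_move[of "[]" ts "[b, c]" m a] that ts by (simp add: s_def)
    then show ?thesis using l2[of b c a] that by simp
  qed
  have yzp: "cdet m (y # z # p # ts) \<noteq> 0" using nz(1) l1[OF C(4)] by simp
  obtain d f g h where d: "d \<noteq> 0"
    and bas: "f y = 1" "f z = 0" "f p = 0" "g y = 0" "g z = 1" "g p = 0" "h y = 0" "h z = 0" "h p = 1"
    and lin: "\<And>c u v. u \<in> ?C \<Longrightarrow> v \<in> ?C \<Longrightarrow> f (c \<cdot>\<^sub>v u - v) = c * f u - f v"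
    "\<And>c u v. u \<in> ?C \<Longrightarrow> v \<in> ?C \<Longrightarrow> g (c \<cdot>\<^sub>v u - v) = c * g u - g v"
    "\<And>c u v. u \<in> ?C \<Longrightarrow> v \<in> ?C \<Longrightarrow> h (c \<cdot>\<^sub>v u - v) = c * h u - h v"
    and br: "\<And>u v w. u \<in> ?C \<Longrightarrow> v \<in> ?C \<Longrightarrow> w \<in> ?C \<Longrightarrow>
      cdet m (u # v # w # ts) = d * (f u * (g v * h w - h v * g w)
        - g u * (f v * h w - h v * f w) + h u * (f v * g w - g v * f w))"
    using cdet_coords3[OF ts C(2,3,4) yzp] by blast
  have [simp]: "w \<in> ?C" "w' \<in> ?C" "x' \<in> ?C" "w1 \<in> ?C" "u1 \<in> ?C" "u1' \<in> ?C"
    using C by (auto simp: w w' x' w1 u1 u1')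
  \<comment> \<open>The independence of z, \<open>ts\<close>, p, q and of \<open>ts\<close>, p, q, r
    supplies the denominators below, while \<open>hx\<close> cancels in \<gamma>.\<close>
  have f1: "f q \<noteq> 0" using nz(2) C by (simp add: l2 br bas)
  have f2: "f q * g r - g q * f r \<noteq> 0" using nz(3) C by (simp add: l3 br bas)
  have hx: "h x \<noteq> 0" using nzx C by (simp add: br bas)
  have a: "\<alpha> = f x" using C d s by (simp add: \<alpha> l1 br bas)
  have wc: "f w = 0" "g w = - g x" "h w = - h x"
    using C by (simp_all add: w lin bas a)
  have w'c: "f w' = \<alpha>' * f q" "g w' = \<alpha>' * g q" "h w' = \<alpha>' * h q - 1"
    using C by (simp_all add: w' lin bas)
  have "cdet m (w # ts @ [q, w']) = d * (- g x * f q)"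
    using C by (simp add: l2 br wc w'c) (simp add: algebra_simps)
  moreover have "cdet m (z # ts @ [q, w']) = d * f q"
    using C by (simp add: l2 br bas w'c) (simp add: algebra_simps)
  ultimately have b: "\<beta> = - g x" using d f1 by (simp add: \<beta>)
  \<comment> \<open>Modulo \<open>ts\<close> the vector x' is a multiple of p, which makes \<gamma>
    independent of x.\<close>
  have x'c: "f x' = 0" "g x' = 0" "h x' = h x"
    using C by (simp_all add: x' lin bas wc b)
  have b1: "\<beta>1 = - g q / f q" using C d by (simp add: \<beta>1 l2 br bas)
  have "cdet m (y # x' # ts @ [q]) = s * d * (- h x * g q)"
    using C by (simp add: l1 br bas x'c)
  moreover have "cdet m (z # x' # ts @ [q]) = s * d * (h x * f q)"
    using C by (simp add: l1 br bas x'c)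
  ultimately have c: "\<gamma> = \<beta>1" using d hx s f1 by (simp add: \<gamma> b1)
  have w1c: "f w1 = - 1" "g w1 = \<beta>1" "h w1 = 0"
    using C by (simp_all add: w1 lin bas)
  have c1: "\<gamma>1 = f x * \<beta>1 + g x" using C d s by (simp add: \<gamma>1 l1 br bas w1c)
  have u1c: "f u1 = - f x" "g u1 = f x * \<beta>1" "h u1 = - h x"
    using C by (simp_all add: u1 lin bas c1)
  have u1'c: "f u1' = \<gamma>' * f r" "g u1' = \<gamma>' * g r" "h u1' = \<gamma>' * h r - 1"
    using C by (simp_all add: u1' lin bas)
  have n: "cdet m (u1 # ts @ [r, u1']) = f x * (d * (g r + \<beta>1 * f r))"
    using C by (simp add: l2 br u1c u1'c) (simp add: algebra_simps)
  have e: "cdet m (w1 # ts @ [r, u1']) = d * (g r + \<beta>1 * f r)"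
    using C by (simp add: l2 br w1c u1'c) (simp add: algebra_simps)
  have "g r + \<beta>1 * f r \<noteq> 0" using f1 f2 by (simp add: b1 field_simps)
  then have dd: "\<delta> = f x" using d by (simp add: \<delta> n e)
  have "\<gamma> \<cdot>\<^sub>v z - y = w1" by (simp add: c w1)
  moreover have "x' = \<delta> \<cdot>\<^sub>v w1 - u1"
    using C by (intro eq_vecI) (auto simp: x' w w1 u1 a b c1 dd algebra_simps)
  ultimately show ?thesis ..
qed

section \<open>The Fraser map on sequences of vectors\<close>

definition conf :: "nat \<Rightarrow> (int \<Rightarrow> complex vec) set" where
  "conf m = {v. (\<forall>k. v k \<in> carrier_vec m) \<and> (\<forall>a. Delta m [a..a + int m - 1] v \<noteq> 0)}"

definition fraser_coeff :: "nat \<Rightarrow> (int \<Rightarrow> complex vec) \<Rightarrow> int \<Rightarrow> complex" where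
  "fraser_coeff m v a = Delta m (a # [a + 2..a + int m]) v / Delta m [a + 1..a + int m] v"

definition fraser_map :: "nat \<Rightarrow> nat \<Rightarrow> (int \<Rightarrow> complex vec) \<Rightarrow> int \<Rightarrow> complex vec" where
  "fraser_map m i v k =
    (if int m dvd k - int i then v (k + 1)
     else if int m dvd k - int i - 1 then fraser_coeff m v (k - 1) \<cdot>\<^sub>v v k - v (k - 1)
     else v k)"

lemma conf_carrier: "v \<in> conf m \<Longrightarrow> v k \<in> carrier_vec m"
  by (simp add: conf_def)

lemma conf_nz: "v \<in> conf m \<Longrightarrow> b = a + int m - 1 \<Longrightarrow> Delta m [a..b] v \<noteq> 0"
  by (simp add: conf_def)

lemma fraser_map_carrier:
  assumes "\<And>k. v k \<in> carrier_vec m" shows "fraser_map m i v k \<in> carrier_vec m"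
  using assms by (simp add: fraser_map_def)

section \<open>Residues modulo m and the positions of the pairs\<close>

lemma not_dvd_between:
  assumes "int m dvd a - int i" "a < k" "k < a + int m"
  shows "\<not> int m dvd k - int i"
proof
  assume "int m dvd k - int i"
  then have "int m dvd (k - int i) - (a - int i)" using assms(1) by (rule dvd_diff)
  then show False using assms zdvd_not_zless[of "k - a" "int m"] by simp
qed

lemma fraser_map_first: "int m dvd a - int i \<Longrightarrow> fraser_map m i v a = v (a + 1)"
  by (simp add: fraser_map_def)

lemma fraser_map_second:
  assumes "int m dvd a - int i" "m \<ge> 2" "k = a + 1"
  shows "fraser_map m i v k = fraser_coeff m v a \<cdot>\<^sub>v v k - v a"
  using not_dvd_between[OF assms(1), of k] assms by (simp add: fraser_map_def)

lemma fraser_map_other: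
  assumes "int m dvd a - int i" "a + 1 < k" "k < a + int m"
  shows "fraser_map m i v k = v k"
proof -
  have "\<not> int m dvd k - int i" by (rule not_dvd_between[OF assms(1)]) (use assms in auto)
  moreover have "\<not> int m dvd (k - 1) - int i" by (rule not_dvd_between[OF assms(1)]) (use assms in auto)
  ultimately show ?thesis by (simp add: fraser_map_def algebra_simps)
qed

lemma residue_base:
  assumes "m > 0"
  obtains a where "int m dvd a - int i" "a \<le> k" "k < a + int m"
proof (rule that[of "k - (k - int i) mod int m"])
  show "int m dvd k - (k - int i) mod int m - int i"
    using dvd_minus_mod[of "int m" "k - int i"] by (simp add: algebra_simps)
qed (use assms pos_mod_sign[of "int m" "k - int i"] pos_mod_bound[of "int m" "k - int i"] in linarith)+

text \<open>Index lists that contain, of each pair moved by the map, both members in order or none.  As the map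
  preserves the bivector of a pair, it changes no determinant of such columns.\<close>

inductive pair_closed :: "nat \<Rightarrow> nat \<Rightarrow> int list \<Rightarrow> bool" for m j where
  nil: "pair_closed m j []"
| single: "\<lbrakk> \<not> int m dvd x - int j; \<not> int m dvd x - int j - 1; pair_closed m j xs \<rbrakk> \<Longrightarrow> pair_closed m j (x # xs)"
| pair: "\<lbrakk> int m dvd b - int j; pair_closed m j xs \<rbrakk> \<Longrightarrow> pair_closed m j (b # (b + 1) # xs)"

lemma pair_closed_cdet:
  assumes "pair_closed m j xs" "m \<ge> 2" "\<And>k. v k \<in> carrier_vec m" "length as + length xs = m"
  shows "cdet m (as @ map (fraser_map m j v) xs) = cdet m (as @ map v xs)"
  using assms(1,4)
proof (induction arbitrary: as)
  case (single x xs)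
  then have "fraser_map m j v x = v x" by (simp add: fraser_map_def)
  then show ?case using single.IH[of "as @ [v x]"] single.prems by simp
next
  case (pair b xs)
  let ?ys = "map (fraser_map m j v) xs"
  let ?c = "fraser_coeff m v b"
  have "cdet m (as @ map (fraser_map m j v) (b # (b + 1) # xs))
      = cdet m ((as @ [v (b + 1)]) @ (?c \<cdot>\<^sub>v v (b + 1) - v b) # ?ys)"
    using pair.hyps assms(2) by (simp add: fraser_map_first fraser_map_second)
  also have "\<dots> = ?c * cdet m ((as @ [v (b + 1)]) @ v (b + 1) # ?ys) - cdet m ((as @ [v (b + 1)]) @ v b # ?ys)"
    by (rule cdet_lincomb) (use assms(3) pair.prems in auto)
  also have "cdet m ((as @ [v (b + 1)]) @ v (b + 1) # ?ys) = 0"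
    by (rule cdet_identical) (use pair.prems in auto)
  also have "cdet m ((as @ [v (b + 1)]) @ v b # ?ys) = - cdet m (as @ v b # v (b + 1) # ?ys)"
    using cdet_swap[of as ?ys m "v (b + 1)" "v b"] assms(3) pair.prems by simp
  also have "cdet m (as @ v b # v (b + 1) # ?ys) = cdet m (as @ map v (b # (b + 1) # xs))"
    using pair.IH[of "as @ [v b, v (b + 1)]"] pair.prems by simp
  finally show ?case by simp
qed auto

lemma pair_closed_Delta:
  assumes "pair_closed m j xs" "m \<ge> 2" "\<And>k. v k \<in> carrier_vec m" "length xs = m"
  shows "Delta m xs (fraser_map m j v) = Delta m xs v"
  using pair_closed_cdet[OF assms(1-3), of "[]"] assms(4) by (simp add: Delta_def)

text \<open>Only the ends of an interval can split a pair: the left end by being a second member,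
  the right end by being a first one.\<close>

lemma pair_closed_upto:
  assumes "m \<ge> 2" "\<not> int m dvd c - int j - 1" "\<not> int m dvd d - int j"
  shows "pair_closed m j [c..d]"
  using assms(2)
proof (induction "nat (d - c + 1)" arbitrary: c rule: less_induct)
  case less
  show ?case
  proof (cases "c \<le> d")
    case False
    then show ?thesis by (simp add: pair_closed.nil)
  next
    case cd: True
    show ?thesis
    proof (cases "int m dvd c - int j")
      case True
      with assms(3) have "c \<noteq> d" by auto
      then have 1: "[c..d] = c # (c + 1) # [c + 1 + 1..d]" using cd by (simp add: upto_rec1)
      have "\<not> int m dvd (c + 1) - int j"
        by (rule not_dvd_between[OF True]) (use assms(1) in auto)
      then show ?thesis unfolding 1 
        by (intro pair_closed.pair True less.hyps) (use cd in \<open>auto simp: algebra_simps\<close>)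
    next
      case False
      have 1: "[c..d] = c # [c + 1..d]" using cd by (simp add: upto_rec1)
      show ?thesis unfolding 1
        by (intro pair_closed.single False less) (use cd False in auto)
    qed
  qed
qed

section \<open>Commutation of distant generators\<close>

lemma dvd_shift_iff:
  assumes "int m dvd a - int i"
  shows "int m dvd a + k \<longleftrightarrow> int m dvd int i + k"
proof -
  have "a + k = (a - int i) + (int i + k)" by simp
  then show ?thesis using assms dvd_add_right_iff by metis
qed

lemma not_dvd_small: "x \<noteq> 0 \<Longrightarrow> \<bar>x\<bar> < int m \<Longrightarrow> \<not> int m dvd x"
  using dvd_imp_le_int by force

text \<open>The two lists of columns in the coefficient break only around the positions a and a + 1
  and at a + m. A pair of index j is split there only if j is i - 1, i or i + 1.\<close>

lemma fraser_coeff_invariant: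
  assumes m: "m \<ge> 2" and ij: "i \<in> {1..m - 1}" "j \<in> {1..m - 1}" "\<bar>int i - int j\<bar> > 1"
    and a: "int m dvd a - int i" and v: "\<And>k. v k \<in> carrier_vec m"
  shows "fraser_coeff m (fraser_map m j v) a = fraser_coeff m v a"
proof -
  \<comment> \<open>Both indices lie in [1, m - 1], so they differ by at most m - 2 and are not
    adjacent around the period either.\<close>
  have nd: "\<not> int m dvd int i + (k - int j)" if "k \<in> {-1,0,1}" for k
    by (rule not_dvd_small) (use ij that in auto)
  have n1: "\<not> int m dvd a - int j" "\<not> int m dvd a - int j - 1" "\<not> int m dvd a + 1 - int j - 1"
    "\<not> int m dvd a + 2 - int j - 1" 
    using dvd_shift_iff[OF a, of "0 - int j"] dvd_shift_iff[OF a, of "- 1 - int j"] dvd_shift_iff[OF a, of "1 - int j"]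
      nd[of 0] nd[of 1] nd[of "-1"] by (simp_all add: algebra_simps)
  have n2: "\<not> int m dvd a + int m - int j"
    using n1(1) dvd_add_right_iff[of "int m" "int m" "a - int j"] by (simp add: algebra_simps)
  have 1: "Delta m (a # [a + 2..a + int m]) (fraser_map m j v) = Delta m (a # [a + 2..a + int m]) v"
    using m by (intro pair_closed_Delta pair_closed.single pair_closed_upto n1 n2 m v) auto
  have 2: "Delta m [a + 1..a + int m] (fraser_map m j v) = Delta m [a + 1..a + int m] v"
    using m by (intro pair_closed_Delta pair_closed_upto n1 n2 m v) auto
  show ?thesis by (simp add: fraser_coeff_def 1 2)
qed

text \<open>Distant maps move disjoint positions, so they could interact only through their
  coefficients, and these are invariant.\<close>

lemma fraser_map_commute:
  assumes m: "m \<ge> 2" and ij: "i \<in> {1..m - 1}" "j \<in> {1..m - 1}" "\<bar>int i - int j\<bar> > 1"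
    and v: "\<And>k. v k \<in> carrier_vec m"
  shows "fraser_map m i (fraser_map m j v) = fraser_map m j (fraser_map m i v)"
proof
  fix k
  have nd: "\<not> int m dvd int i - int j + e" if "e \<in> {-1,0,1}" for e
    by (rule not_dvd_small) (use ij that in auto)
  have ji: "\<bar>int j - int i\<bar> > 1" using ij by simp
  have excl: "\<not> int m dvd k - int j + e" if "int m dvd k - int i + d" "d - e \<in> {-1,0,1}" for d e
  proof
    assume "int m dvd k - int j + e"
    with that(1) have "int m dvd (k - int j + e) - (k - int i + d)" by (rule dvd_diff[rotated])
    then show False using nd[of "e - d"] that(2) by (auto simp: algebra_simps)
  qed
  consider "int m dvd k - int i" | "int m dvd k - int i - 1" "\<not> int m dvd k - int i"
    | "\<not> int m dvd k - int i" "\<not> int m dvd k - int i - 1" "int m dvd k - int j"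
    | "\<not> int m dvd k - int i" "\<not> int m dvd k - int i - 1" "\<not> int m dvd k - int j" "int m dvd k - int j - 1"
    | "\<not> int m dvd k - int i" "\<not> int m dvd k - int i - 1" "\<not> int m dvd k - int j" "\<not> int m dvd k - int j - 1"
    by blast
  then show "fraser_map m i (fraser_map m j v) k = fraser_map m j (fraser_map m i v) k"
  proof cases
    case 1
    then show ?thesis
      using excl[of 0 0] excl[of 0 1] excl[of 0 "-1"] by (simp add: fraser_map_def algebra_simps)
  next
    case 2
    have "int m dvd (k - 1) - int i" using 2(1) by (simp add: algebra_simps)
    from fraser_coeff_invariant[OF m ij this v] show ?thesis
      using 2 excl[of "-1" 0] excl[of "-1" "-1"] excl[of "-1" "-2"] by (simp add: fraser_map_def algebra_simps)
  next
    case 3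
    have "\<not> int m dvd k + 1 - int i" "\<not> int m dvd k + 1 - int i - 1"
      using excl[of 1 0] excl[of 0 0] 3 by (auto simp: algebra_simps)
    with 3 show ?thesis by (simp add: fraser_map_def algebra_simps)
  next
    case 4
    have "int m dvd (k - 1) - int j" using 4 by (simp add: algebra_simps)
    note inv = fraser_coeff_invariant[OF m ij(2,1) ji this v]
    have "\<not> int m dvd k - 1 - int i" "\<not> int m dvd k - 1 - int i - 1"
      using excl[of "-1" "-1"] excl[of "-2" "-1"] 4 by (auto simp: algebra_simps)
    with 4 inv show ?thesis by (simp add: fraser_map_def algebra_simps)
  next
    case 5
    then show ?thesis by (simp add: fraser_map_def)
  qed
qed

section \<open>Consecutive minors under the map\<close>

lemma fraser_window:
  assumes m: "m \<ge> 2" and v: "\<And>k. v k \<in> carrier_vec m" and b: "\<not> int m dvd b - int i - 1"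
  shows "Delta m [b..b + int m - 1] (fraser_map m i v) = Delta m [b..b + int m - 1] v"
proof (rule pair_closed_Delta[OF pair_closed_upto])
  \<comment> \<open>A window of length m ends with a first member exactly if it starts with a second
    one, so one condition covers both ends.\<close>
  show "\<not> int m dvd b + int m - 1 - int i"
    using b dvd_add_right_iff[of "int m" "int m" "b - int i - 1"] by (simp add: algebra_simps)
qed (use m v b in auto)

text \<open>This window splits a pair at either end, so its columns y, \<open>ts\<close>, p become
  w, \<open>ts\<close>, q. Expanding w and clearing the denominator leaves two terms of a three-term
  Pluecker relation, whose third term is the product of the neighbouring windows. New consecutive
  minors are thus Laurent monomials in old ones, which keeps configurations nondegenerate and lets
  the map descend to \<open>Gbar m\<close>.\<close>

lemma fraser_window_special:
  assumes m: "m \<ge> 2" and v: "v \<in> conf m" and a: "int m dvd a - int i"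
  shows "Delta m [a + 1..a + int m] (fraser_map m i v) * Delta m [a + 1..a + int m] v
    = Delta m [a..a + int m - 1] v * Delta m [a + 2..a + int m + 1] v"
proof -
  let ?C = "carrier_vec m :: complex vec set"
  define ts where "ts = map v [a + 2..a + int m - 1]"
  define x y p q where "x = v a" and "y = v (a + 1)" and "p = v (a + int m)" and "q = v (a + int m + 1)"
  have len: "length ts + 2 = m" using m by (simp add: ts_def)
  have C: "x \<in> ?C" "y \<in> ?C" "p \<in> ?C" "q \<in> ?C" "set ts \<subseteq> ?C"
    using conf_carrier[OF v] by (auto simp: x_def y_def p_def q_def ts_def)
  have l0: "[a..a + int m - 1] = a # (a + 1) # [a + 2..a + int m - 1]"
    using m upto_rec1[of a "a + int m - 1"] upto_rec1[of "a + 1" "a + int m - 1"] by (simp add: ac_simps)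
  have l1: "[a + 1..a + int m] = (a + 1) # [a + 2..a + int m - 1] @ [a + int m]"
    using m upto_rec1[of "a + 1" "a + int m"] upto_rec2[of "a + 2" "a + int m"] by (simp add: ac_simps)
  have l2: "[a + 2..a + int m + 1] = [a + 2..a + int m - 1] @ [a + int m, a + int m + 1]"
    using m upto_rec2[of "a + 2" "a + int m + 1"] upto_rec2[of "a + 2" "a + int m"] by simp
  have l3: "a # [a + 2..a + int m] = a # [a + 2..a + int m - 1] @ [a + int m]"
    using m upto_rec2[of "a + 2" "a + int m"] by simp
  have D0: "Delta m [a..a + int m - 1] v = cdet m (x # y # ts)"
    by (simp add: Delta_def l0 x_def y_def ts_def)
  have D1: "Delta m [a + 1..a + int m] v = cdet m (y # ts @ [p])"
    by (simp add: Delta_def l1 y_def p_def ts_def)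
  have D2: "Delta m [a + 2..a + int m + 1] v = cdet m (ts @ [p, q])"
    by (simp add: Delta_def l2 q_def p_def ts_def)
  define \<alpha> where "\<alpha> = cdet m (x # ts @ [p]) / cdet m (y # ts @ [p])"
  have \<alpha>: "fraser_coeff m v a = \<alpha>"
    by (simp add: fraser_coeff_def Delta_def l1 l3 \<alpha>_def x_def y_def p_def ts_def)
  have ts: "map (fraser_map m i v) [a + 2..a + int m - 1] = ts"
    using fraser_map_other[OF a] by (auto simp: ts_def)
  have am: "int m dvd a + int m - int i"
    using a dvd_add_right_iff[of "int m" "int m" "a - int i"] by (simp add: algebra_simps)
  have K: "Delta m [a + 1..a + int m] (fraser_map m i v) = cdet m ((\<alpha> \<cdot>\<^sub>v y - x) # ts @ [q])"
    using fraser_map_second[OF a m, of "a + 1"] fraser_map_first[OF am]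
    by (simp add: Delta_def l1 ts \<alpha> x_def y_def q_def)
  define s :: complex where "s = (- 1) ^ length ts"
  have s2: "s * s = 1" by (simp add: s_def flip: power_add)
  have e1: "cdet m (b # ts @ [c]) = s * cdet m (b # c # ts)" if "c \<in> ?C" for b c
    using cdet_move[of "[b]" ts "[]" m c] that C len by (simp add: s_def)
  have e2: "cdet m (ts @ [b, c]) = cdet m (b # c # ts)" if "b \<in> ?C" "c \<in> ?C" for b c
    using cdet_move[of "[]" ts "[c]" m b] e1[of c b] that C len s2 by (simp add: s_def)
  have nz: "cdet m (y # ts @ [p]) \<noteq> 0" using conf_nz[OF v, of "a + int m" "a + 1"] D1 by simp
  have "cdet m ((\<alpha> \<cdot>\<^sub>v y - x) # ts @ [q]) = \<alpha> * cdet m (y # ts @ [q]) - cdet m (x # ts @ [q])"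
    using cdet_lincomb[of "[]" "ts @ [q]" m y x \<alpha>] C len by simp
  then have "cdet m ((\<alpha> \<cdot>\<^sub>v y - x) # ts @ [q]) * cdet m (y # ts @ [p])
      = cdet m (x # ts @ [p]) * cdet m (y # ts @ [q]) - cdet m (x # ts @ [q]) * cdet m (y # ts @ [p])"
    using nz by (simp add: \<alpha>_def field_simps)
  also have "\<dots> = s * s * (cdet m (x # p # ts) * cdet m (y # q # ts) - cdet m (x # q # ts) * cdet m (y # p # ts))"
    using C by (simp add: e1 algebra_simps)
  also have "\<dots> = cdet m (x # p # ts) * cdet m (y # q # ts) - cdet m (x # q # ts) * cdet m (y # p # ts)"
    by (simp add: s2)
  also have "\<dots> = - cdet m (p # q # ts) * cdet m (y # x # ts)"
    using cdet_exchange2[of ts m x q y p] C len by (simp add: algebra_simps)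
  also have "\<dots> = cdet m (x # y # ts) * cdet m (p # q # ts)"
    using cdet_swap[of "[]" ts m y x] C len by simp
  finally show ?thesis using C by (simp add: K D0 D1 D2 e2)
qed

lemma fraser_map_conf:
  assumes "m \<ge> 2" "v \<in> conf m"
  shows "fraser_map m i v \<in> conf m"
proof -
  have "Delta m [b..b + int m - 1] (fraser_map m i v) \<noteq> 0" for b
  proof (cases "int m dvd b - int i - 1")
    case True
    then have a: "int m dvd (b - 1) - int i" by (simp add: algebra_simps)
    have "Delta m [b..b + int m - 1] (fraser_map m i v) * Delta m [b..b + int m - 1] v
        = Delta m [b - 1..b + int m - 2] v * Delta m [b + 1..b + int m] v"
      using fraser_window_special[OF assms a] by (simp add: algebra_simps)
    with conf_nz[OF assms(2), of "b + int m - 2" "b - 1"] conf_nz[OF assms(2), of "b + int m" "b + 1"]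
    show ?thesis by auto
  next
    case False
    then show ?thesis
      using fraser_window[OF assms(1) conf_carrier[OF assms(2)] False] conf_nz[OF assms(2)] by simp
  qed
  then show ?thesis using fraser_map_carrier conf_carrier[OF assms(2)] by (auto simp: conf_def)
qed

text \<open>In each period only the positions a, a + 1, a + 2 move. Their new values depend on the
  fixed vectors and on the corresponding positions a + m, a + m + 1, a + m + 2 of the next period,
  which together are the data of \<open>braid_vectors\<close>.\<close>

lemma fraser_map_braid:
  assumes i: "i \<in> {1..m - 2}" and v: "v \<in> conf m"
  shows "fraser_map m i (fraser_map m (i + 1) (fraser_map m i v))
    = fraser_map m (i + 1) (fraser_map m i (fraser_map m (i + 1) v))"
proof
  fix k
  let ?C = "carrier_vec m :: complex vec set"
  define K L where "K = fraser_map m i" and "L = fraser_map m (i + 1)"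
  have m: "m \<ge> 3" "m \<ge> 2" using i by auto
  obtain a where a: "int m dvd a - int i" "a \<le> k" "k < a + int m"
    using residue_base[of m i k] m by auto
  have a': "int m dvd (a + 1) - int (i + 1)" using a by simp
  have am: "int m dvd (a + int m) - int i"
    using a(1) dvd_add_right_iff[of "int m" "int m" "a - int i"] by (simp add: algebra_simps)
  have am': "int m dvd (a + int m + 1) - int (i + 1)"
  proof -
    have "(a + int m + 1) - int (i + 1) = (a + int m) - int i" by simp
    then show ?thesis using am by (simp only:)
  qed
  have K0: "K u a = u (a + 1)" "K u (a + int m) = u (a + int m + 1)" for u
    using fraser_map_first[OF a(1)] fraser_map_first[OF am] by (simp_all add: K_def)
  have K1: "K u (a + 1) = fraser_coeff m u a \<cdot>\<^sub>v u (a + 1) - u a"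
    "K u (a + int m + 1) = fraser_coeff m u (a + int m) \<cdot>\<^sub>v u (a + int m + 1) - u (a + int m)" for u
    using fraser_map_second[OF a(1) m(2)] fraser_map_second[OF am m(2)] by (simp_all add: K_def)
  have K2: "K u l = u l" if "a + 1 < l" "l < a + int m" for u l
    using fraser_map_other[OF a(1)] that by (simp add: K_def)
  have K3: "K u (a + int m + 2) = u (a + int m + 2)" for u
    using fraser_map_other[OF am] m by (simp add: K_def)
  have L0: "L u (a + 1) = u (a + 2)" "L u (a + int m + 1) = u (a + int m + 2)" for u
    using fraser_map_first[OF a'] fraser_map_first[OF am'] by (simp_all add: L_def add.assoc)
  have L1: "L u (a + 2) = fraser_coeff m u (a + 1) \<cdot>\<^sub>v u (a + 2) - u (a + 1)" for u
    using fraser_map_second[OF a' m(2), of "a + 2" u] by (simp add: L_def)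
  have L2: "L u l = u l" if "a + 2 < l" "l < a + int m + 1" for u l
    using fraser_map_other[OF a'] that by (simp add: L_def)
  \<comment> \<open>The position a closes the block that begins with the pair a - m + 1, a - m + 2,
    and differs from both members because m is at least 3.\<close>
  have L3: "L u a = u a" for u
  proof -
    have "int m dvd a - int m + 1 - int (i + 1)"
      using a(1) dvd_diff[of "int m" "a - int i" "int m"] by (simp add: algebra_simps)
    from fraser_map_other[OF this, of a] show ?thesis using m by (simp add: L_def)
  qed
  define T where "T = [a + 3..a + int m - 1]"
  have KT: "map (K u) T = map u T" and LT: "map (L u) T = map u T" for u
    using K2 L2 by (auto simp: T_def)
  have la: "a # [a + 2..a + int m] = a # (a + 2) # T @ [a + int m]"
    using m upto_rec1[of "a + 2" "a + int m"] upto_rec2[of "a + 3" "a + int m"] by (simp add: T_def ac_simps)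
  have lb: "[a + 1..a + int m] = (a + 1) # (a + 2) # T @ [a + int m]"
    using m upto_rec1[of "a + 1" "a + int m"] la by (simp add: ac_simps)
  have ld: "[a + 3..a + int m + 1] = T @ [a + int m, a + int m + 1]"
    using m upto_rec2[of "a + 3" "a + int m"] upto_rec2[of "a + 3" "a + int m + 1"] by (simp add: T_def ac_simps)
  have le: "[a + 2..a + int m + 1] = (a + 2) # T @ [a + int m, a + int m + 1]"
    using m upto_rec1[of "a + 2" "a + int m + 1"] ld by (simp add: ac_simps)
  have lf: "[a + 3..a + int m + 2] = T @ [a + int m, a + int m + 1, a + int m + 2]"
    using m upto_rec2[of "a + 3" "a + int m + 2"] ld by (simp add: ac_simps)
  have lg: "[a..a + int m - 1] = a # (a + 1) # (a + 2) # T"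
    using m upto_rec1[of "a" "a + int m - 1"] upto_rec1[of "a + 1" "a + int m - 1"]
      upto_rec1[of "a + 2" "a + int m - 1"] by (simp add: T_def ac_simps)
  have F0: "fraser_coeff m u a = cdet m (u a # u (a + 2) # map u T @ [u (a + int m)])
      / cdet m (u (a + 1) # u (a + 2) # map u T @ [u (a + int m)])" for u
    by (simp add: fraser_coeff_def Delta_def la lb)
  have F1: "fraser_coeff m u (a + 1)
      = cdet m (u (a + 1) # map u T @ [u (a + int m), u (a + int m + 1)])
      / cdet m (u (a + 2) # map u T @ [u (a + int m), u (a + int m + 1)])" for u
  proof -
    have e: "[a + 1 + 2..a + 1 + int m] = T @ [a + int m, a + int m + 1]"
      "[a + 1 + 1..a + 1 + int m] = (a + 2) # T @ [a + int m, a + int m + 1]"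
      using ld le by (simp_all add: ac_simps)
    show ?thesis unfolding fraser_coeff_def Delta_def e by simp
  qed
  define x y z p q r where "x = v a" and "y = v (a + 1)" and "z = v (a + 2)"
    and "p = v (a + int m)" and "q = v (a + int m + 1)" and "r = v (a + int m + 2)"
  define ts where "ts = map v T"
  have len: "length ts + 3 = m" using m by (simp add: ts_def T_def)
  have vC: "v l \<in> ?C" for l using conf_carrier[OF v] .
  have C: "set ts \<subseteq> ?C" "x \<in> ?C" "y \<in> ?C" "z \<in> ?C" "p \<in> ?C" "q \<in> ?C" "r \<in> ?C"
    using vC by (auto simp: x_def y_def z_def p_def q_def r_def ts_def)
  have nz: "cdet m (y # z # ts @ [p]) \<noteq> 0" "cdet m (z # ts @ [p, q]) \<noteq> 0"
    "cdet m (ts @ [p, q, r]) \<noteq> 0" "cdet m (x # y # z # ts) \<noteq> 0"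
    using conf_nz[OF v, of "a + int m" "a + 1"] conf_nz[OF v, of "a + int m + 1" "a + 2"]
      conf_nz[OF v, of "a + int m + 2" "a + 3"] conf_nz[OF v, of "a + int m - 1" "a"]
    by (simp_all add: Delta_def lb le lf lg x_def y_def z_def p_def q_def r_def ts_def)
  define v1 v2 u1 u2 where "v1 = K v" and "v2 = L v1" and "u1 = L v" and "u2 = K u1"
  have mt: "map v1 T = ts" "map v2 T = ts" "map u1 T = ts" "map u2 T = ts"
    by (simp_all add: v1_def v2_def u1_def u2_def KT LT ts_def)
  have vv1: "v1 a = y" "v1 (a + 2) = z" "v1 (a + int m) = q" "v1 (a + int m + 2) = r"
    "v1 (a + 1) = fraser_coeff m v a \<cdot>\<^sub>v y - x"
    "v1 (a + int m + 1) = fraser_coeff m v (a + int m) \<cdot>\<^sub>v q - p"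
    using m by (simp_all add: v1_def K0 K1 K2 K3 x_def y_def z_def p_def q_def r_def)
  have vv2: "v2 a = y" "v2 (a + 1) = z" "v2 (a + 2) = fraser_coeff m v1 (a + 1) \<cdot>\<^sub>v z - v1 (a + 1)"
    "v2 (a + int m) = q"
    using m by (simp_all add: v2_def L0 L1 L2 L3 vv1)
  have uu1: "u1 a = x" "u1 (a + 1) = z" "u1 (a + 2) = fraser_coeff m v (a + 1) \<cdot>\<^sub>v z - y"
    "u1 (a + int m) = p" "u1 (a + int m + 1) = r"
    using m by (simp_all add: u1_def L0 L1 L2 L3 x_def y_def z_def p_def q_def r_def)
  have uu2: "u2 a = z" "u2 (a + 1) = fraser_coeff m u1 a \<cdot>\<^sub>v z - x" "u2 (a + 2) = u1 (a + 2)"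
    "u2 (a + int m) = r" "u2 (a + int m + 1) = fraser_coeff m u1 (a + int m) \<cdot>\<^sub>v r - p"
    using m by (simp_all add: u2_def K0 K1 K2 uu1)
  \<comment> \<open>The two composites are \<open>K v2\<close> and \<open>L u2\<close>; at a both
    give z. The coefficients at a + m, which look into yet another period, enter as the free
    parameters of \<open>braid_vectors\<close>.\<close>
  have main: "fraser_coeff m v2 a \<cdot>\<^sub>v z - y = u1 (a + 2) \<and>
    v2 (a + 2) = fraser_coeff m u2 (a + 1) \<cdot>\<^sub>v u1 (a + 2) - u2 (a + 1)"
  proof (rule braid_vectors[OF len C(1-7) nz(1-3)])
    show "fraser_coeff m v a = cdet m (x # z # ts @ [p]) / cdet m (y # z # ts @ [p])"
      by (simp add: F0 x_def y_def z_def p_def ts_def)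
    show "fraser_coeff m v1 (a + 1) = cdet m (v1 (a + 1) # ts @ [q, v1 (a + int m + 1)]) / cdet m (z # ts @ [q, v1 (a + int m + 1)])"
      by (simp add: F1 mt vv1(2,3))
    show "fraser_coeff m v2 a = cdet m (y # v2 (a + 2) # ts @ [q]) / cdet m (z # v2 (a + 2) # ts @ [q])"
      by (simp add: F0 mt vv2(1,2,4))
    show "fraser_coeff m v (a + 1) = cdet m (y # ts @ [p, q]) / cdet m (z # ts @ [p, q])"
      by (simp add: F1 z_def y_def q_def p_def ts_def)
    show "fraser_coeff m u1 a = cdet m (x # u1 (a + 2) # ts @ [p]) / cdet m (z # u1 (a + 2) # ts @ [p])"
      by (simp add: F0 mt uu1(1,2,4))
    show "fraser_coeff m u2 (a + 1) = cdet m (u2 (a + 1) # ts @ [r, u2 (a + int m + 1)]) / cdet m (u1 (a + 2) # ts @ [r, u2 (a + int m + 1)])"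
      by (simp add: F1 mt uu2(3,4))
  qed (use vv1 vv2 uu1 uu2 nz in \<open>auto\<close>)
  consider "k = a" | "k = a + 1" | "k = a + 2" | "a + 2 < k" using a(2) by linarith
  then have "K v2 k = L u2 k"
  proof cases
    case 1
    then show ?thesis by (simp add: K0 L3 vv2 uu2)
  next
    case 2
    then show ?thesis using main by (simp add: K1 L0 vv2 uu2)
  next
    case 3
    have "K v2 (a + 2) = v2 (a + 2)" using K2[of "a + 2" v2] m by simp
    then show ?thesis using 3 main by (simp add: L1 uu2)
  next
    case 4
    then show ?thesis using a(3) by (simp add: K2 L2 v2_def v1_def u2_def u1_def)
  qed
  then show "fraser_map m i (fraser_map m (i + 1) (fraser_map m i v)) k
    = fraser_map m (i + 1) (fraser_map m i (fraser_map m (i + 1) v)) k"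
    by (simp add: K_def L_def v1_def v2_def u1_def u2_def)
qed

section \<open>Evaluation of Laurent polynomials\<close>

abbreviation "keys \<equiv> Poly_Mapping.keys"
abbreviation "lookup \<equiv> Poly_Mapping.lookup"
abbreviation "single \<equiv> Poly_Mapping.single"

definition monom_eval :: "(int list \<Rightarrow> complex) \<Rightarrow> (int list \<Rightarrow>\<^sub>0 int) \<Rightarrow> complex" where
  "monom_eval z \<mu> = (\<Prod>xs\<in>keys \<mu>. z xs powi lookup \<mu> xs)"

definition leval :: "(int list \<Rightarrow> complex) \<Rightarrow> laurent \<Rightarrow> complex" where
  "leval z f = (\<Sum>\<mu>\<in>keys f. lookup f \<mu> * monom_eval z \<mu>)"

text \<open>The parameter V restricts the variables: \<open>UNIV\<close> gives the whole ring, the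
  tuples with entries in a range give the subalgebras, and \<open>cell m\<close> gives the
  coordinates of one chart.\<close>

definition good_monom :: "nat \<Rightarrow> int list set \<Rightarrow> (int list \<Rightarrow>\<^sub>0 int) \<Rightarrow> bool" where
  "good_monom m V \<mu> \<longleftrightarrow> keys \<mu> \<subseteq> tuples m \<inter> V \<and>
    (\<forall>xs \<in> keys \<mu> - consec m. lookup \<mu> xs \<ge> 0)"

definition lset :: "nat \<Rightarrow> int list set \<Rightarrow> laurent set" where
  "lset m V = {f. \<forall>\<mu> \<in> keys f. good_monom m V \<mu>}"

lemma carrier_laurent: "carrier (laurent_alg m) = lset m UNIV"
  by (simp add: laurent_alg_def lset_def good_monom_def)

lemma laurent_ops [simp]:
  "x \<otimes>\<^bsub>laurent_alg m\<^esub> y = x * y" "x \<oplus>\<^bsub>laurent_alg m\<^esub> y = x + y"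
  "\<one>\<^bsub>laurent_alg m\<^esub> = 1" "\<zero>\<^bsub>laurent_alg m\<^esub> = 0"
  "c \<odot>\<^bsub>laurent_alg m\<^esub> x = single 0 c * x"
  by (simp_all add: laurent_alg_def)

lemma lset_mono: "V \<subseteq> W \<Longrightarrow> lset m V \<subseteq> lset m W"
  by (auto simp: lset_def good_monom_def)

lemma monom_eval_superset:
  assumes "finite S" "keys \<mu> \<subseteq> S"
  shows "monom_eval z \<mu> = (\<Prod>xs\<in>S. z xs powi lookup \<mu> xs)"
  unfolding monom_eval_def using assms
  by (intro prod.mono_neutral_left) (auto simp: in_keys_iff)

lemma leval_superset:
  assumes "finite S" "keys f \<subseteq> S"
  shows "leval z f = (\<Sum>\<mu>\<in>S. lookup f \<mu> * monom_eval z \<mu>)"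
  unfolding leval_def using assms
  by (intro sum.mono_neutral_left) (auto simp: in_keys_iff)

lemma monom_eval_add:
  assumes "good_monom m V \<mu>" "good_monom m V \<nu>" "\<And>xs. xs \<in> consec m \<Longrightarrow> z xs \<noteq> 0"
  shows "monom_eval z (\<mu> + \<nu>) = monom_eval z \<mu> * monom_eval z \<nu>"
proof -
  let ?S = "keys \<mu> \<union> keys \<nu>"
  have "monom_eval z (\<mu> + \<nu>) = (\<Prod>xs\<in>?S. z xs powi lookup (\<mu> + \<nu>) xs)"
    by (rule monom_eval_superset) (auto dest: subsetD[OF keys_add])
  also have "\<dots> = (\<Prod>xs\<in>?S. z xs powi lookup \<mu> xs * z xs powi lookup \<nu> xs)"
  proof (rule prod.cong[OF refl])
    fix xs assume "xs \<in> ?S"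
    \<comment> \<open>Exponents of a vanishing base add up correctly unless their sum is 0; off
      \<open>consec m\<close> both are nonnegative, so this happens only if both are 0.\<close>
    have ge: "xs \<notin> consec m \<Longrightarrow> lookup \<mu> xs \<ge> 0 \<and> lookup \<nu> xs \<ge> 0"
      using assms(1,2) unfolding good_monom_def by (metis Diff_iff in_keys_iff order_refl)
    show "z xs powi lookup (\<mu> + \<nu>) xs
        = z xs powi lookup \<mu> xs * z xs powi lookup \<nu> xs"
    proof (cases "xs \<in> consec m")
      case True
      then show ?thesis using assms(3) by (simp add: lookup_add power_int_add)
    next
      case False
      with ge have "lookup \<mu> xs + lookup \<nu> xs \<noteq> 0 \<or>
        (lookup \<mu> xs = 0 \<and> lookup \<nu> xs = 0)" by linarith
      then show ?thesis by (auto simp: lookup_add power_int_add)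
    qed
  qed
  also have "\<dots> = monom_eval z \<mu> * monom_eval z \<nu>"
    by (simp add: prod.distrib monom_eval_superset[of ?S])
  finally show ?thesis .
qed

lemma leval_add: "leval z (f + g) = leval z f + leval z g"
proof -
  let ?S = "keys f \<union> keys g"
  have "leval z (f + g) = (\<Sum>\<mu>\<in>?S. lookup (f + g) \<mu> * monom_eval z \<mu>)"
    by (rule leval_superset) (auto dest: subsetD[OF keys_add])
  also have "\<dots> = leval z f + leval z g"
    by (simp add: leval_superset[of ?S] lookup_add sum.distrib algebra_simps)
  finally show ?thesis .
qed

lemma leval_zero [simp]: "leval z 0 = 0"
  by (simp add: leval_def)

lemma leval_uminus: "leval z (- f) = - leval z f"
  using leval_add[of z f "- f"] by (simp add: eq_neg_iff_add_eq_0 add.commute)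

lemma leval_diff: "leval z (f - g) = leval z f - leval z g"
  using leval_add[of z f "- g"] by (simp add: leval_uminus)

lemma leval_sum: "leval z (sum F A) = (\<Sum>a\<in>A. leval z (F a))"
  by (induction A rule: infinite_finite_induct) (auto simp: leval_add)

lemma leval_single: "leval z (single \<mu> c) = c * monom_eval z \<mu>"
  by (simp add: leval_def)

lemma leval_const [simp]: "leval z (single 0 c) = c"
  by (simp add: leval_single monom_eval_def)

lemma leval_one [simp]: "leval z 1 = 1"
  using leval_const[of z 1] by simp

lemma leval_Lvar [simp]: "leval z (Lvar xs) = z xs"
  by (simp add: leval_single monom_eval_def Lvar_def)

lemma leval_Lvar_inv [simp]: "leval z (Lvar_inv xs) = inverse (z xs)"
  by (simp add: leval_single monom_eval_def Lvar_inv_def power_int_minus)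

lemma poly_mapping_sum_single:
  "f = (\<Sum>\<mu>\<in>keys f. single \<mu> (lookup f \<mu>))"
proof (rule poly_mapping_eqI)
  fix k
  have "lookup (\<Sum>\<mu>\<in>keys f. single \<mu> (lookup f \<mu>)) k
     = (\<Sum>\<mu>\<in>keys f. if k = \<mu> then lookup f \<mu> else 0)"
    by (simp add: lookup_sum lookup_single when_def eq_commute)
  also have "\<dots> = lookup f k"
    by (simp add: in_keys_iff)
  finally show "lookup f k = lookup (\<Sum>\<mu>\<in>keys f. single \<mu> (lookup f \<mu>)) k" ..
qed

lemma leval_mult:
  assumes "f \<in> lset m V" "g \<in> lset m V" "\<And>xs. xs \<in> consec m \<Longrightarrow> z xs \<noteq> 0"
  shows "leval z (f * g) = leval z f * leval z g"
proof -
  have "f * g = (\<Sum>\<mu>\<in>keys f. single \<mu> (lookup f \<mu>)) *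
      (\<Sum>\<nu>\<in>keys g. single \<nu> (lookup g \<nu>))"
    using poly_mapping_sum_single[of f] poly_mapping_sum_single[of g] by simp
  also have "\<dots> = (\<Sum>\<mu>\<in>keys f. \<Sum>\<nu>\<in>keys g.
      single (\<mu> + \<nu>) (lookup f \<mu> * lookup g \<nu>))"
    by (simp add: sum_product mult_single)
  finally have "leval z (f * g) = (\<Sum>\<mu>\<in>keys f. \<Sum>\<nu>\<in>keys g.
      lookup f \<mu> * lookup g \<nu> * monom_eval z (\<mu> + \<nu>))"
    by (simp add: leval_sum leval_single)
  also have "\<dots> = (\<Sum>\<mu>\<in>keys f. \<Sum>\<nu>\<in>keys g.
      (lookup f \<mu> * monom_eval z \<mu>) * (lookup g \<nu> * monom_eval z \<nu>))"
    using assms by (intro sum.cong refl) (simp add: lset_def monom_eval_add[of m V])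
  finally show ?thesis by (simp add: leval_def sum_product)
qed

section \<open>Subrings of Laurent polynomials in some of the variables\<close>

lemma good_monom_add:
  assumes "good_monom m V \<mu>" "good_monom m V \<nu>"
  shows "good_monom m V (\<mu> + \<nu>)"
  unfolding good_monom_def
proof (intro conjI ballI)
  show "keys (\<mu> + \<nu>) \<subseteq> tuples m \<inter> V"
    using keys_add[of \<mu> \<nu>] assms by (auto simp: good_monom_def)
  fix xs assume "xs \<in> keys (\<mu> + \<nu>) - consec m"
  then have "lookup \<mu> xs \<ge> 0" "lookup \<nu> xs \<ge> 0"
    using assms unfolding good_monom_def by (metis Diff_iff in_keys_iff order_refl DiffE)+
  then show "lookup (\<mu> + \<nu>) xs \<ge> 0" by (simp add: lookup_add)
qed

lemma lset_const [simp]: "single 0 c \<in> lset m V"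
  by (simp add: lset_def good_monom_def)

lemma lset_zero [simp]: "0 \<in> lset m V"
  by (simp add: lset_def)

lemma lset_one [simp]: "1 \<in> lset m V"
  using lset_const[of 1] by simp

lemma lset_add: "f \<in> lset m V \<Longrightarrow> g \<in> lset m V \<Longrightarrow> f + g \<in> lset m V"
  using keys_add[of f g] by (auto simp: lset_def)

lemma lset_uminus: "f \<in> lset m V \<Longrightarrow> - f \<in> lset m V"
  by (simp add: lset_def in_keys_iff)

lemma lset_diff: "f \<in> lset m V \<Longrightarrow> g \<in> lset m V \<Longrightarrow> f - g \<in> lset m V"
  using lset_add[of f m V "- g"] lset_uminus by simp

lemma lset_mult: "f \<in> lset m V \<Longrightarrow> g \<in> lset m V \<Longrightarrow> f * g \<in> lset m V"
  using keys_mult[of f g] good_monom_add by (fastforce simp: lset_def)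

lemma lset_sum: "(\<And>a. a \<in> A \<Longrightarrow> F a \<in> lset m V) \<Longrightarrow> sum F A \<in> lset m V"
  by (induction A rule: infinite_finite_induct) (auto intro: lset_add)

lemma lset_power: "f \<in> lset m V \<Longrightarrow> f ^ n \<in> lset m V"
  by (induction n) (auto intro: lset_mult)

lemma lset_of_int: "of_int k \<in> lset m V"
  by (metis lset_const single_of_int)

lemma lset_Lvar: "xs \<in> tuples m \<Longrightarrow> xs \<in> V \<Longrightarrow> Lvar xs \<in> lset m V"
  by (simp add: lset_def Lvar_def good_monom_def)

lemma upto_strict: "sorted_wrt (<) [a..b]"
proof (induction a b rule: upto.induct)
  case (1 i j)
  then show ?case by (cases "i \<le> j") (auto simp: upto_rec1)
qed

lemma consec_tuples: "xs \<in> consec m \<Longrightarrow> xs \<in> tuples m"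
  by (auto simp: consec_def tuples_def upto_strict)

lemma lset_Lvar_inv: "xs \<in> consec m \<Longrightarrow> xs \<in> V \<Longrightarrow> Lvar_inv xs \<in> lset m V"
  by (simp add: lset_def Lvar_inv_def good_monom_def consec_tuples)

lemma Lvar_mult_inv [simp]: "Lvar xs * Lvar_inv xs = 1"
  by (simp add: Lvar_def Lvar_inv_def mult_single flip: single_add)

text \<open>Every element is a sum of multiples of monomials, and every monomial a product of
  variables and inverses. Claims about evaluations and homomorphisms are thereby reduced to
  generators.\<close>

lemma lset_induct [consumes 1, case_names const var inv add mult]:
  assumes f: "f \<in> lset m V"
    and const: "\<And>c. P (single 0 c)"
    and var: "\<And>xs. xs \<in> tuples m \<Longrightarrow> xs \<in> V \<Longrightarrow> P (Lvar xs)"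
    and inv: "\<And>xs. xs \<in> consec m \<Longrightarrow> xs \<in> V \<Longrightarrow> P (Lvar_inv xs)"
    and add: "\<And>f g. f \<in> lset m V \<Longrightarrow> g \<in> lset m V \<Longrightarrow> P f \<Longrightarrow> P g \<Longrightarrow> P (f + g)"
    and mult: "\<And>f g. f \<in> lset m V \<Longrightarrow> g \<in> lset m V \<Longrightarrow> P f \<Longrightarrow> P g \<Longrightarrow> P (f * g)"
  shows "P f"
proof -
  define Q where "Q h \<longleftrightarrow> h \<in> lset m V \<and> P h" for h
  have Qm: "Q (f * g)" if "Q f" "Q g" for f g
    using that by (auto simp: Q_def intro: lset_mult mult)
  have Q0: "Q (single 0 c)" for c
    by (simp add: Q_def const)
  have Q1: "Q 1" using Q0[of 1] by simp
  have Qp: "Q (f ^ n)" if "Q f" for f n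
    by (induction n) (auto intro: Q1 Qm that)
  have pow: "single (single xs k) 1 ^ n
      = (single (single xs (k * int n)) 1 :: laurent)" for xs k n
    by (induction n) (simp_all add: mult_single algebra_simps flip: single_add)
  have mon1: "Q (single (single xs k) 1)"
    if "xs \<in> tuples m" "xs \<in> V" "k \<ge> 0 \<or> xs \<in> consec m" for xs k
  proof (cases "k \<ge> 0")
    case True
    have "Q (Lvar xs ^ nat k)" by (rule Qp) (use that in \<open>simp add: Q_def lset_Lvar var\<close>)
    with True show ?thesis by (simp add: Lvar_def pow)
  next
    case False
    have "Q (Lvar_inv xs ^ nat (- k))"
      by (rule Qp) (use that False in \<open>simp add: Q_def lset_Lvar_inv inv\<close>)
    with False show ?thesis by (simp add: Lvar_inv_def pow)
  qed
  have mon: "good_monom m V \<mu> \<Longrightarrow> Q (single \<mu> 1)" for \<mu>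
  proof (induction \<mu> rule: update_induct)
    case const
    show ?case using Q1 by simp
  next
    case (update \<mu> xs k)
    \<comment> \<open>Updating a fresh variable adds its exponent, which splits one factor off the
      monomial.\<close>
    have eq: "Poly_Mapping.update xs k \<mu> = \<mu> + single xs k"
      using update.hyps(1) by (intro poly_mapping_eqI) (auto simp: lookup_update lookup_add lookup_single in_keys_iff)
    have keys: "keys (Poly_Mapping.update xs k \<mu>) = insert xs (keys \<mu>)"
      using update.hyps(2) by (simp add: keys_update)
    have "good_monom m V \<mu>"
      using update.prems update.hyps(1) unfolding good_monom_def keys
      by (auto simp: lookup_update split: if_splits)
    moreover have "xs \<in> tuples m" "xs \<in> V"
      using update.prems unfolding good_monom_def keys by auto
    moreover have "lookup (Poly_Mapping.update xs k \<mu>) xs \<ge> 0 \<or> xs \<in> consec m"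
      using update.prems unfolding good_monom_def keys by blast
    then have "k \<ge> 0 \<or> xs \<in> consec m" by (simp add: lookup_update)
    ultimately have "Q (single \<mu> 1 * single (single xs k) 1)"
      by (intro Qm update.IH mon1)
    then show ?case by (simp add: eq mult_single)
  qed
  have "Q (\<Sum>\<mu>\<in>S. single \<mu> (lookup f \<mu>))"
    if "finite S" "S \<subseteq> keys f" for S
    using that
  proof (induction S rule: finite_induct)
    case empty
    show ?case using Q0[of 0] by simp
  next
    case (insert \<mu> S)
    have "good_monom m V \<mu>" using insert.prems f by (auto simp: lset_def)
    then have "Q (single 0 (lookup f \<mu>) * single \<mu> 1)"
      by (intro Qm Q0 mon)
    then have "Q (single \<mu> (lookup f \<mu>))"
      by (simp add: mult_single)
    with insert show ?case by (auto simp: Q_def intro: lset_add add)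
  qed
  from this[of "keys f"] show ?thesis
    using poly_mapping_sum_single[of f] by (simp add: Q_def)
qed

lemma laurent_cring: "cring (laurent_alg m)"
proof (rule cringI)
  show "abelian_group (laurent_alg m)"
  proof (rule abelian_groupI)
    fix x assume "x \<in> carrier (laurent_alg m)"
    then show "\<exists>y\<in>carrier (laurent_alg m). y \<oplus>\<^bsub>laurent_alg m\<^esub> x = \<zero>\<^bsub>laurent_alg m\<^esub>"
      by (intro bexI[of _ "- x"]) (auto simp: carrier_laurent lset_uminus)
  qed (auto simp: carrier_laurent lset_add algebra_simps)
  show "comm_monoid (laurent_alg m)"
    by (rule comm_monoidI) (auto simp: carrier_laurent lset_mult algebra_simps)
qed (auto simp: carrier_laurent algebra_simps)

lemma laurent_ring: "ring (laurent_alg m)"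
  using laurent_cring by (rule cring.axioms)

lemma laurent_uminus: 
  assumes "x \<in> lset m UNIV" shows "\<ominus>\<^bsub>laurent_alg m\<^esub> x = - x"
proof -
  interpret cring "laurent_alg m" by (rule laurent_cring)
  have "x \<oplus>\<^bsub>laurent_alg m\<^esub> - x = \<zero>\<^bsub>laurent_alg m\<^esub>" by simp
  then show ?thesis using assms by (intro minus_equality) (auto simp: carrier_laurent lset_uminus)
qed

section \<open>The Pluecker ideal vanishes on vector configurations\<close>

text \<open>With distinct entries the sorting permutation is unique, so the definite description in
  \<open>psym\<close> may be replaced by any witness.\<close>

lemma psym_eq:
  assumes "distinct xs"
  obtains \<pi> where "\<pi> permutes {..<length xs}" "permute_list \<pi> (sort xs) = xs"
    "psym xs = of_int (sign \<pi>) * Lvar (sort xs)"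
proof -
  obtain \<pi> where \<pi>: "\<pi> permutes {..<length xs}" "permute_list \<pi> (sort xs) = xs"
    using mset_eq_permutation[of xs "sort xs"] by auto
  have "(THE \<pi>. \<pi> permutes {..<length xs} \<and> permute_list \<pi> (sort xs) = xs) = \<pi>"
  proof (rule the_equality)
    fix \<rho> assume \<rho>: "\<rho> permutes {..<length xs} \<and> permute_list \<rho> (sort xs) = xs"
    show "\<rho> = \<pi>"
    proof
      fix i
      show "\<rho> i = \<pi> i"
      proof (cases "i < length xs")
        case True
        have "\<pi> i < length xs" "\<rho> i < length xs"
          using True permutes_in_image[OF \<pi>(1), of i] \<rho> permutes_in_image[of \<rho> "{..<length xs}" i] by auto
        moreover have "sort xs ! \<pi> i = sort xs ! \<rho> i"
          using True permute_list_nth[of \<pi> "sort xs" i] permute_list_nth[of \<rho> "sort xs" i] \<pi> \<rho> by simp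
        ultimately show ?thesis using assms by (simp add: nth_eq_iff_index_eq)
      next
        case False
        then show ?thesis using \<pi>(1) \<rho> by (simp add: permutes_def)
      qed
    qed
  qed (use \<pi> in auto)
  with assms \<pi> show ?thesis by (intro that[of \<pi>]) (auto simp: psym_def)
qed

lemma psym_sign:
  assumes "distinct xs"
  obtains e :: int where "e = 1 \<or> e = - 1" "psym xs = of_int e * Lvar (sort xs)"
  using psym_eq[OF assms] sign_cases by metis

lemma sort_tuples: "distinct xs \<Longrightarrow> length xs = m \<Longrightarrow> sort xs \<in> tuples m"
  by (simp add: tuples_def strict_sorted_iff)

lemma lset_psym:
  assumes "length xs = m" "distinct xs \<Longrightarrow> sort xs \<in> V"
  shows "psym xs \<in> lset m V"
proof (cases "distinct xs")
  case True
  then obtain e where "psym xs = of_int e * Lvar (sort xs)" by (rule psym_sign)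
  then show ?thesis using assms True by (auto intro!: lset_mult lset_of_int lset_Lvar sort_tuples)
qed (simp add: psym_def)

lemma leval_of_int_mult_Lvar: "leval z (of_int e * Lvar xs) = of_int e * z xs"
proof -
  have "(of_int e :: laurent) * Lvar xs = single (single xs 1) (of_int e)"
    by (simp add: Lvar_def mult_single flip: single_of_int)
  then show ?thesis by (simp add: leval_single monom_eval_def)
qed

text \<open>The sign convention for permuted tuples is the antisymmetry of determinants in their
  columns, and a repeated index gives zero on both sides.\<close>

lemma leval_psym:
  assumes "length xs = m"
  shows "leval (\<lambda>xs. Delta m xs v) (psym xs) = Delta m xs v"
proof (cases "distinct xs")
  case True
  then obtain \<pi> where \<pi>: "\<pi> permutes {..<length xs}" "permute_list \<pi> (sort xs) = xs"
    "psym xs = of_int (sign \<pi>) * Lvar (sort xs)" by (rule psym_eq)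
  have "Delta m xs v = cdet m (permute_list \<pi> (map v (sort xs)))"
    using \<pi> by (simp add: Delta_def permute_list_map)
  also have "\<dots> = of_int (sign \<pi>) * Delta m (sort xs) v"
    using assms \<pi> by (subst cdet_permute) (auto simp: Delta_def)
  finally show ?thesis by (simp add: \<pi>(3) leval_of_int_mult_Lvar)
next
  case False
  then have "\<not> distinct (map v xs)" by (simp add: distinct_map)
  then have "Delta m xs v = 0" using assms by (simp add: Delta_def cdet_identical)
  with False show ?thesis by (simp add: psym_def)
qed

lemma psym_Delta_sign:
  assumes "distinct xs" "length xs = m"
  obtains e :: int where "e = 1 \<or> e = - 1" "\<And>v. Delta m xs v = of_int e * Delta m (sort xs) v"
proof -
  obtain e :: int where e: "e = 1 \<or> e = - 1" "psym xs = of_int e * Lvar (sort xs)"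
    using psym_sign[OF assms(1)] .
  have "Delta m xs v = of_int e * Delta m (sort xs) v" for v
    using leval_psym[OF assms(2), of v] by (simp add: e(2) leval_of_int_mult_Lvar)
  with e show ?thesis by (intro that)
qed

abbreviation dval :: "nat \<Rightarrow> (int \<Rightarrow> complex vec) \<Rightarrow> laurent \<Rightarrow> complex" where
  "dval m v \<equiv> leval (\<lambda>xs. Delta m xs v)"

lemma conf_consec_nz: "v \<in> conf m \<Longrightarrow> xs \<in> consec m \<Longrightarrow> Delta m xs v \<noteq> 0"
  by (auto simp: conf_def consec_def)

lemma leval_of_int [simp]: "leval z (of_int k) = of_int k"
  by (metis leval_const single_of_int)

lemma dval_mult:
  "v \<in> conf m \<Longrightarrow> f \<in> lset m V \<Longrightarrow> g \<in> lset m V \<Longrightarrow> dval m v (f * g) = dval m v f * dval m v g"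
  by (rule leval_mult) (auto dest: conf_consec_nz)

lemma remove1_split_nth:
  assumes "distinct xs" "i < length xs"
  shows "remove1 (xs ! i) xs = take i xs @ drop (Suc i) xs"
proof -
  have "xs = take i xs @ xs ! i # drop (Suc i) xs" using assms(2) by (rule id_take_nth_drop)
  moreover from this have "xs ! i \<notin> set (take i xs)"
    using assms(1) by (metis distinct_append Int_iff empty_iff list.set_intros(1))
  ultimately show ?thesis by (metis remove1_append remove1.simps(2))
qed

lemma psym_mem:
  assumes "length xs = m" shows "psym xs \<in> lset m UNIV"
  by (rule lset_psym) (use assms in auto)

lemma neg_one_power_lset: "(- 1) ^ t \<in> lset m V"
  by (intro lset_power lset_uminus lset_one)

lemma plucker_rels_mem:
  assumes "m \<ge> 1" "r \<in> plucker_rels m"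
  shows "r \<in> lset m UNIV"
proof -
  from assms(2) obtain ks js where kj: "ks \<in> tuples (m - 1)" "js \<in> tuples (m + 1)"
    and r: "r = (\<Sum>t = 1..m + 1. (- 1) ^ t * psym (ks @ [js ! (t - 1)]) * psym (take (t - 1) js @ drop t js))"
    by (auto simp: plucker_rels_def)
  show ?thesis unfolding r
    by (intro lset_sum lset_mult neg_one_power_lset psym_mem) (use kj assms(1) in \<open>auto simp: tuples_def\<close>)
qed

lemma dval_plucker_rels:
  assumes m: "m \<ge> 1" and v: "v \<in> conf m" and r: "r \<in> plucker_rels m"
  shows "dval m v r = 0"
proof -
  from r obtain ks js where kj: "ks \<in> tuples (m - 1)" "js \<in> tuples (m + 1)"
    and r: "r = (\<Sum>t = 1..m + 1. (- 1) ^ t * psym (ks @ [js ! (t - 1)]) * psym (take (t - 1) js @ drop t js))"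
    by (auto simp: plucker_rels_def)
  have len: "length ks + 1 = m" "length js = m + 1" using kj m by (auto simp: tuples_def)
  have pw: "leval z ((- 1) ^ t) = (- 1) ^ t" for z t
    using leval_of_int[of z "(- 1) ^ t"] by simp
  have "dval m v r = (\<Sum>t = 1..m + 1. (- 1) ^ t * Delta m (ks @ [js ! (t - 1)]) v
      * Delta m (take (t - 1) js @ drop t js) v)"
    unfolding r leval_sum
  proof (rule sum.cong[OF refl])
    fix t assume t: "t \<in> {1..m + 1}"
    have l: "length (ks @ [js ! (t - 1)]) = m" "length (take (t - 1) js @ drop t js) = m"
      using len t by auto
    show "dval m v ((- 1) ^ t * psym (ks @ [js ! (t - 1)]) * psym (take (t - 1) js @ drop t js)) =
      (- 1) ^ t * Delta m (ks @ [js ! (t - 1)]) v * Delta m (take (t - 1) js @ drop t js) v"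
      by (simp only: dval_mult[OF v lset_mult[OF neg_one_power_lset psym_mem[OF l(1)]] psym_mem[OF l(2)]]
          dval_mult[OF v neg_one_power_lset psym_mem[OF l(1)]] leval_psym[OF l(1)] leval_psym[OF l(2)] pw)
  qed
  \<comment> \<open>Counting positions from 0 instead of 1 reverses every sign.\<close>
  also have "\<dots> = (\<Sum>t<m + 1. - ((- 1) ^ t * cdet m (map v ks @ [map v js ! t])
      * cdet m (take t (map v js) @ drop (Suc t) (map v js))))"
    unfolding One_nat_def sum.atLeast1_atMost_eq
    by (intro sum.cong refl) (use len in \<open>auto simp: Delta_def take_map drop_map\<close>)
  also have "\<dots> = 0"
    unfolding sum_negf using plucker_cdet[of "map v ks" m "map v js"] len by simp
  finally show ?thesis .
qed

lemma plucker_ideal_ideal: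
  assumes "m \<ge> 1" shows "ideal (plucker_ideal m) (laurent_alg m)"
  unfolding plucker_ideal_def
  by (rule ring.genideal_ideal[OF laurent_ring]) (use assms plucker_rels_mem in \<open>auto simp: carrier_laurent\<close>)

lemma plucker_ideal_rels:
  assumes "m \<ge> 1" "r \<in> plucker_rels m" shows "r \<in> plucker_ideal m"
  unfolding plucker_ideal_def
  using ring.genideal_self[OF laurent_ring, of "plucker_rels m" m] assms plucker_rels_mem
  by (auto simp: carrier_laurent)

text \<open>The coordinates of the chart of the Grassmannian where the minor [1, m] is nonzero: once
  the first m vectors are taken as a basis, the other vectors have these minors, up to sign and
  scaling, as their entries.\<close>

definition cell :: "nat \<Rightarrow> int list set" where
  "cell m = {xs. card (set xs - {1..int m}) \<le> 1}"

context
  fixes m :: nat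
  assumes m: "m \<ge> 1"
begin

interpretation I: ideal "plucker_ideal m" "laurent_alg m"
  by (rule plucker_ideal_ideal[OF m])

lemma pideal_add: "f \<in> plucker_ideal m \<Longrightarrow> g \<in> plucker_ideal m \<Longrightarrow> f + g \<in> plucker_ideal m"
  using additive_subgroup.a_closed[OF I.is_additive_subgroup] by simp

lemma pideal_zero: "0 \<in> plucker_ideal m"
  using additive_subgroup.zero_closed[OF I.is_additive_subgroup] by simp

lemma pideal_mult: "f \<in> plucker_ideal m \<Longrightarrow> g \<in> lset m UNIV \<Longrightarrow> g * f \<in> plucker_ideal m"
  using I.I_l_closed by (simp add: carrier_laurent)

lemma pideal_uminus: "f \<in> plucker_ideal m \<Longrightarrow> - f \<in> plucker_ideal m"
  using pideal_mult[of f "- 1"] lset_uminus[OF lset_one] by simp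

lemma pideal_diff: "f \<in> plucker_ideal m \<Longrightarrow> g \<in> plucker_ideal m \<Longrightarrow> f - g \<in> plucker_ideal m"
  using pideal_add[of f "- g"] pideal_uminus by simp

lemma pideal_sum: "(\<And>a. a \<in> A \<Longrightarrow> F a \<in> plucker_ideal m) \<Longrightarrow> sum F A \<in> plucker_ideal m"
  by (induction A rule: infinite_finite_induct) (auto intro: pideal_add pideal_zero)

text \<open>The kernel of an evaluation is an ideal and contains the relations.\<close>

lemma dval_plucker_ideal:
  assumes v: "v \<in> conf m" and f: "f \<in> plucker_ideal m"
  shows "dval m v f = 0"
proof -
  let ?K = "{f \<in> lset m UNIV. dval m v f = 0}"
  have "ideal ?K (laurent_alg m)"
  proof (rule idealI)
    show "subgroup ?K (add_monoid (laurent_alg m))"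
    proof (rule group.subgroupI)
      show "group (add_monoid (laurent_alg m))"
        using abelian_group.a_group[OF ring.is_abelian_group[OF laurent_ring]] .
    next
      fix a assume a: "a \<in> ?K"
      then have "inv\<^bsub>add_monoid (laurent_alg m)\<^esub> a = - a"
        using laurent_uminus[of a m] by (simp add: a_inv_def)
      with a show "inv\<^bsub>add_monoid (laurent_alg m)\<^esub> a \<in> ?K"
        by (simp add: lset_uminus leval_uminus)
    qed (auto simp: carrier_laurent intro: exI[of _ 0] lset_add simp: leval_add)
  qed (auto simp: laurent_ring carrier_laurent lset_mult dval_mult[OF v, of _ UNIV])
  moreover have "plucker_rels m \<subseteq> ?K"
    using plucker_rels_mem[OF m] dval_plucker_rels[OF m v] by auto
  ultimately have "plucker_ideal m \<subseteq> ?K"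
    unfolding plucker_ideal_def by (rule ring.genideal_minimal[OF laurent_ring])
  with f show ?thesis by auto
qed

section \<open>Rewriting in the coordinates of one chart\<close>

lemma base_mem: "[1..int m] \<in> consec m" "[1..int m] \<in> cell m"
  by (auto simp: consec_def cell_def intro: exI[of _ 1])

text \<open>The Pluecker relation that exchanges an index outside \<open>[1, m]\<close> lowers the number of such
  indices.\<close>

lemma cell_reduction:
  assumes "xs \<in> tuples m"
  shows "\<exists>g \<in> lset m (cell m). Lvar xs - g \<in> plucker_ideal m"
  using assms
proof (induction "card (set xs - {1..int m})" arbitrary: xs rule: less_induct)
  case less
  let ?J = "{1..int m}"
  show ?case
  proof (cases "card (set xs - ?J) \<le> 1")
    case True
    then have "Lvar xs \<in> lset m (cell m)" using less.prems by (intro lset_Lvar) (auto simp: cell_def)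
    then show ?thesis using pideal_zero by (intro bexI[of _ "Lvar xs"]) auto
  next
    case False
    then have "set xs - ?J \<noteq> {}" by (metis card.empty zero_le)
    then obtain b where b: "b \<in> set xs" "b \<notin> ?J" by blast
    have xs: "length xs = m" "sorted_wrt (<) xs" "distinct xs" "sorted xs"
      using less.prems by (auto simp: tuples_def strict_sorted_iff)
    \<comment> \<open>In the relation for \<open>ks\<close> and \<open>js\<close>, the term that
      exchanges b is the wanted variable times the variable of [1, m]. Every other term puts some a
      from [1, m] in the place of b, so that one factor has fewer indices outside and the other has
      only b outside.\<close>
    define ks where "ks = remove1 b xs"
    define S where "S = insert b ?J"
    have S: "finite S" "card S = m + 1" using b by (auto simp: S_def)
    define js where "js = sorted_list_of_set S"
    have ks: "ks \<in> tuples (m - 1)" "length ks + 1 = m" "distinct ks" "set ks = set xs - {b}"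
      using xs b m by (auto simp: ks_def tuples_def length_remove1 strict_sorted_iff sorted_remove1)
    have js: "js \<in> tuples (m + 1)" "length js = m + 1" "set js = S" "distinct js" "sorted_wrt (<) js"
      using S by (auto simp: js_def tuples_def)
    define F where "F t = (- 1) ^ t * psym (ks @ [js ! (t - 1)]) * psym (take (t - 1) js @ drop t js)" for t
    have rel: "(\<Sum>t = 1..m + 1. F t) \<in> plucker_ideal m"
      by (rule plucker_ideal_rels[OF m]) (use ks js in \<open>auto simp: plucker_rels_def F_def\<close>)
    have "b \<in> set js" by (simp add: js S_def)
    then obtain i0 where i0: "i0 < length js" "js ! i0 = b" by (auto simp: in_set_conv_nth)
    define t0 where "t0 = Suc i0"
    have t0: "t0 \<in> {1..m + 1}" "js ! (t0 - 1) = b" using i0 js by (auto simp: t0_def)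
    have rest: "take (t - 1) js @ drop t js = sorted_list_of_set (S - {js ! (t - 1)})"
      if t: "t \<in> {1..m + 1}" for t
    proof -
      have "take (t - 1) js @ drop t js = remove1 (js ! (t - 1)) js"
        using remove1_split_nth[of js "t - 1"] t js by auto
      also have "\<dots> = sorted_list_of_set (S - {js ! (t - 1)})"
        using S by (simp add: js_def sorted_list_of_set_remove)
      finally show ?thesis .
    qed
    have "\<exists>h \<in> lset m (cell m). F t - h \<in> plucker_ideal m" if t: "t \<in> {1..m + 1} - {t0}" for t
    proof -
      define a where "a = js ! (t - 1)"
      have "a \<in> set js" using t js by (auto simp: a_def)
      moreover have "a \<noteq> b"
      proof
        assume "a = b"
        then have "t - 1 = t0 - 1" using t t0 js nth_eq_iff_index_eq[of js "t - 1" "t0 - 1"] by (auto simp: a_def)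
        then show False using t t0 by auto
      qed
      ultimately have a: "a \<in> ?J" unfolding js(3) S_def by blast
      have p2: "psym (take (t - 1) js @ drop t js) \<in> lset m (cell m)"
      proof (rule lset_psym)
        let ?ys = "take (t - 1) js @ drop t js"
        show "length ?ys = m" using t js by auto
        have "set ?ys - ?J \<subseteq> {b}" using rest[of t] t S by (auto simp: S_def)
        then have "card (set ?ys - ?J) \<le> card {b}" by (intro card_mono) auto
        then show "sort ?ys \<in> cell m" by (simp add: cell_def)
      qed
      have "\<exists>h \<in> lset m (cell m). psym (ks @ [a]) - h \<in> plucker_ideal m"
      proof (cases "a \<in> set ks")
        case True
        then show ?thesis using pideal_zero by (intro bexI[of _ 0]) (auto simp: psym_def)
      next
        case False
        then have d: "distinct (ks @ [a])" using ks by simp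
        obtain e :: int where e: "psym (ks @ [a]) = of_int e * Lvar (sort (ks @ [a]))"
          using psym_sign[OF d] by metis
        have eq: "set (sort (ks @ [a])) = insert a (set xs - {b})" by (simp add: ks(4))
        have "set (sort (ks @ [a])) - ?J \<subseteq> set xs - ?J" unfolding eq using a by auto
        moreover have "b \<in> set xs - ?J" "b \<notin> set (sort (ks @ [a])) - ?J" unfolding eq using a b by auto
        ultimately have "set (sort (ks @ [a])) - ?J \<subset> set xs - ?J" by blast
        then have "card (set (sort (ks @ [a])) - ?J) < card (set xs - ?J)" by (intro psubset_card_mono) auto
        moreover have "sort (ks @ [a]) \<in> tuples m" using d ks by (intro sort_tuples) auto
        ultimately obtain h where h: "h \<in> lset m (cell m)" "Lvar (sort (ks @ [a])) - h \<in> plucker_ideal m"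
          using less.hyps by blast
        show ?thesis
        proof (intro bexI[of _ "of_int e * h"] lset_mult lset_of_int h)
          show "psym (ks @ [a]) - of_int e * h \<in> plucker_ideal m"
            using pideal_mult[OF h(2) lset_of_int[of e]] by (simp add: e right_diff_distrib)
        qed
      qed
      then obtain h where h: "h \<in> lset m (cell m)" "psym (ks @ [a]) - h \<in> plucker_ideal m" by blast
      let ?q = "psym (take (t - 1) js @ drop t js)"
      have q: "(- 1) ^ t * ?q \<in> lset m (cell m)" by (intro lset_mult neg_one_power_lset p2)
      show ?thesis
      proof (intro bexI[of _ "((- 1) ^ t * ?q) * h"] lset_mult[OF q h(1)])
        have "((- 1) ^ t * ?q) * (psym (ks @ [a]) - h) \<in> plucker_ideal m"
          by (rule pideal_mult[OF h(2)]) (use q lset_mono[of "cell m" UNIV m] in auto)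
        then show "F t - ((- 1) ^ t * ?q) * h \<in> plucker_ideal m"
          by (simp add: F_def a_def algebra_simps)
      qed
    qed
    then obtain h where h: "\<And>t. t \<in> {1..m + 1} - {t0} \<Longrightarrow> h t \<in> lset m (cell m)"
      "\<And>t. t \<in> {1..m + 1} - {t0} \<Longrightarrow> F t - h t \<in> plucker_ideal m" by metis
    define H where "H = (\<Sum>t \<in> {1..m + 1} - {t0}. h t)"
    have H: "H \<in> lset m (cell m)" unfolding H_def by (intro lset_sum h)
    have "(\<Sum>t = 1..m + 1. F t) - (\<Sum>t \<in> {1..m + 1} - {t0}. F t - h t) \<in> plucker_ideal m"
      by (intro pideal_diff rel pideal_sum h)
    also have "(\<Sum>t = 1..m + 1. F t) - (\<Sum>t \<in> {1..m + 1} - {t0}. F t - h t) = F t0 + H"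
    proof -
      have "(\<Sum>t = 1..m + 1. F t) = F t0 + (\<Sum>t \<in> {1..m + 1} - {t0}. F t)"
        using t0(1) by (intro sum.remove) auto
      then show ?thesis by (simp only: sum_subtractf H_def) simp
    qed
    finally have FH: "F t0 + H \<in> plucker_ideal m" .
    obtain e where e: "e = 1 \<or> e = - 1" "psym (ks @ [b]) = of_int e * Lvar xs"
    proof -
      have "distinct (ks @ [b])" using ks by simp
      moreover have "sort (ks @ [b]) = xs"
        using b xs by (intro properties_for_sort) (auto simp: ks_def)
      ultimately show ?thesis using psym_sign[of "ks @ [b]"] that by metis
    qed
    obtain e' where e': "e' = 1 \<or> e' = - 1" "psym (take (t0 - 1) js @ drop t0 js) = of_int e' * Lvar [1..int m]"
    proof -
      have eq: "take (t0 - 1) js @ drop t0 js = [1..int m]"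
      proof -
        have "S - {b} = ?J" using b by (auto simp: S_def)
        moreover have "sorted_list_of_set ?J = [1..int m]"
          using sorted_list_of_set.idem_if_sorted_distinct[of "[1..int m]"] by simp
        ultimately show ?thesis using rest[OF t0(1)] t0(2) by simp
      qed
      have "sort [1..int m] = [1..int m]" by (simp add: sorted_sort_id)
      then show ?thesis using psym_sign[of "[1..int m]"] that eq by (metis distinct_upto)
    qed
    define s :: laurent where "s = (- 1) ^ t0 * of_int e * of_int e'"
    have s: "s * s = 1" "s \<in> lset m V" for V
    proof -
      have s_int: "s = of_int ((- 1) ^ t0 * e * e')" by (simp add: s_def)
      show "s \<in> lset m V" unfolding s_int by (rule lset_of_int)
      have "((- 1) ^ t0 * e * e') * ((- 1) ^ t0 * e * e') = (1 :: int)"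
        using e(1) e'(1) by (auto simp flip: power_add)
      then show "s * s = 1" unfolding s_int by (metis of_int_1 of_int_mult)
    qed
    have Ft0: "F t0 = s * Lvar xs * Lvar [1..int m]"
      unfolding F_def t0(2) e(2) e'(2) s_def by (simp only: mult_ac)
    have inv: "Lvar_inv [1..int m] \<in> lset m V" if "[1..int m] \<in> V" for V
      using base_mem that by (intro lset_Lvar_inv)
    \<comment> \<open>The factor next to the wanted variable is invertible, since [1, m] is a
      consecutive tuple.\<close>
    have "(s * Lvar_inv [1..int m]) * (F t0 + H) \<in> plucker_ideal m"
      by (intro pideal_mult FH lset_mult s inv) auto
    also have "(s * Lvar_inv [1..int m]) * (F t0 + H)
        = (s * s) * Lvar xs * (Lvar [1..int m] * Lvar_inv [1..int m]) + s * Lvar_inv [1..int m] * H"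
      by (simp only: Ft0 algebra_simps)
    also have "\<dots> = Lvar xs - (- (s * Lvar_inv [1..int m] * H))"
      by (simp add: s)
    finally show ?thesis
      by (intro bexI[of _ "- (s * Lvar_inv [1..int m] * H)"] lset_uminus lset_mult s inv H base_mem)
  qed
qed

text \<open>The unit \<open>u\<close> clears the inverted variables; its representative \<open>w\<close> makes the induction pass through
  sums.\<close>

lemma cell_reduction_unit:
  assumes "f \<in> lset m UNIV"
  shows "\<exists>u u' w g. u \<in> lset m UNIV \<and> u' \<in> lset m UNIV \<and> u * u' = 1 \<and>
    w \<in> lset m (cell m) \<and> u - w \<in> plucker_ideal m \<and> g \<in> lset m (cell m) \<and> u * f - g \<in> plucker_ideal m"
    (is "?P f")
proof -
  note mem = lset_mono[of "cell m" UNIV m, THEN subsetD, OF subset_UNIV]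
  have comb: "?P (f1 + f2) \<and> ?P (f1 * f2)" if f1: "f1 \<in> lset m UNIV" and "?P f1" "?P f2" for f1 f2
  proof -
    obtain u1 u1' w1 g1 u2 u2' w2 g2 where
      u1: "u1 \<in> lset m UNIV" "u1' \<in> lset m UNIV" "u1 * u1' = 1" "w1 \<in> lset m (cell m)"
        "u1 - w1 \<in> plucker_ideal m" "g1 \<in> lset m (cell m)" "u1 * f1 - g1 \<in> plucker_ideal m" and
      u2: "u2 \<in> lset m UNIV" "u2' \<in> lset m UNIV" "u2 * u2' = 1" "w2 \<in> lset m (cell m)"
        "u2 - w2 \<in> plucker_ideal m" "g2 \<in> lset m (cell m)" "u2 * f2 - g2 \<in> plucker_ideal m"
      using \<open>?P f1\<close> \<open>?P f2\<close> by metis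
    have "(u1 * u2) * (u1' * u2') = (u1 * u1') * (u2 * u2')" by (simp only: mult_ac)
    then have un: "(u1 * u2) * (u1' * u2') = 1" by (simp add: u1(3) u2(3))
    have "u1 * (u2 - w2) + w2 * (u1 - w1) \<in> plucker_ideal m"
      by (intro pideal_add pideal_mult u1 u2 mem)
    then have w: "u1 * u2 - w1 * w2 \<in> plucker_ideal m" by (simp add: algebra_simps)
    \<comment> \<open>Over the common denominator \<open>u1 * u2\<close> each summand is multiplied
      by the other denominator, and the representatives w1, w2 keep this within the chart
      coordinates.\<close>
    have "u2 * (u1 * f1 - g1) + g1 * (u2 - w2) + u1 * (u2 * f2 - g2) + g2 * (u1 - w1) \<in> plucker_ideal m"
      by (intro pideal_add pideal_mult u1 u2 mem)
    then have a: "(u1 * u2) * (f1 + f2) - (w2 * g1 + w1 * g2) \<in> plucker_ideal m"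
      by (simp add: algebra_simps)
    have "(u1 * f1) * (u2 * f2 - g2) + g2 * (u1 * f1 - g1) \<in> plucker_ideal m"
      by (intro pideal_add pideal_mult lset_mult u1 u2 mem f1)
    then have p: "(u1 * u2) * (f1 * f2) - g1 * g2 \<in> plucker_ideal m" by (simp add: algebra_simps)
    have l: "u1 * u2 \<in> lset m UNIV" "u1' * u2' \<in> lset m UNIV" "w1 * w2 \<in> lset m (cell m)"
      "w2 * g1 + w1 * g2 \<in> lset m (cell m)" "g1 * g2 \<in> lset m (cell m)"
      by (intro lset_mult lset_add u1 u2)+
    from un w a p l show ?thesis by blast
  qed
  show ?thesis
    using assms
  proof (induction rule: lset_induct)
    case (const c)
    show ?case using pideal_zero
      by (intro exI[of _ 1] exI[of _ "single 0 c"]) auto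
  next
    case (var xs)
    then obtain g where "g \<in> lset m (cell m)" "Lvar xs - g \<in> plucker_ideal m"
      using cell_reduction by blast
    then show ?case using pideal_zero by (intro exI[of _ 1] exI[of _ g]) auto
  next
    case (inv xs)
    then obtain g where "g \<in> lset m (cell m)" "Lvar xs - g \<in> plucker_ideal m"
      using cell_reduction consec_tuples by blast
    \<comment> \<open>The variable clears its own inverse: u is \<open>Lvar xs\<close>, w is its
      reduction, and the product is 1.\<close>
    with inv show ?case using pideal_zero
      by (intro exI[of _ "Lvar xs"] exI[of _ "Lvar_inv xs"] exI[of _ g] exI[of _ 1])
        (auto intro: lset_Lvar lset_Lvar_inv consec_tuples)
  qed (simp_all only: comb)
qed

end

section \<open>Laurent polynomials vanishing on a torus\<close>

lemma monom_eval_mult: "monom_eval (\<lambda>x. z x * w x) \<mu> = monom_eval z \<mu> * monom_eval w \<mu>"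
  by (simp add: monom_eval_def power_int_mult_distrib prod.distrib)

lemma monom_eval_nz: "(\<And>x. z x \<noteq> 0) \<Longrightarrow> monom_eval z \<mu> \<noteq> 0"
  by (simp add: monom_eval_def)

lemma monom_eval_separates:
  assumes "\<mu> \<noteq> \<nu>"
  obtains w where "\<And>x. w x \<noteq> 0" "monom_eval w \<mu> \<noteq> monom_eval w \<nu>"
proof -
  obtain x where x: "lookup \<mu> x \<noteq> lookup \<nu> x"
    using assms by (meson poly_mapping_eqI)
  \<comment> \<open>The number 2 has infinite multiplicative order, so it separates different
    exponents of x.\<close>
  define w :: "int list \<Rightarrow> complex" where "w y = (if y = x then 2 else 1)" for y
  have ev: "monom_eval w \<rho> = 2 powi lookup \<rho> x" for \<rho>
  proof -
    have "monom_eval w \<rho> = (\<Prod>y\<in>insert x (keys \<rho>). w y powi lookup \<rho> y)"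
      by (rule monom_eval_superset) auto
    also have "\<dots> = (\<Prod>y\<in>insert x (keys \<rho>). if y = x then 2 powi lookup \<rho> x else 1)"
      by (intro prod.cong) (auto simp: w_def)
    also have "\<dots> = 2 powi lookup \<rho> x" by (subst prod.delta) auto
    finally show ?thesis .
  qed
  have inj: "a = b" if "(2 :: complex) powi a = 2 powi b" for a b :: int
  proof -
    have "norm ((2 :: complex) powi a) = norm ((2 :: complex) powi b)" using that by simp
    then have "(2 :: real) powi a = 2 powi b" by (simp add: norm_power_int)
    moreover have "(2 :: real) powi a < 2 powi b" if "a < b" for a b
      using that by (intro power_int_strict_increasing) auto
    ultimately show ?thesis by (metis linorder_neqE order_less_irrefl)
  qed
  show ?thesis
    by (rule that[of w]) (use x inj in \<open>auto simp: ev w_def\<close>)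
qed

text \<open>Dedekind's argument: a relation is compared with its translate by a point that separates two
  monomials.\<close>

lemma monom_eval_independent:
  assumes "finite S" "\<And>z. (\<And>x. z x \<noteq> 0) \<Longrightarrow> (\<Sum>\<mu>\<in>S. c \<mu> * monom_eval z \<mu>) = 0" "\<mu> \<in> S"
  shows "c \<mu> = 0"
  using assms
proof (induction S arbitrary: c \<mu> rule: finite_induct)
  case (insert \<nu> S)
  have S: "c \<mu> = 0" if "\<mu> \<in> S" for \<mu>
  proof -
    have "\<mu> \<noteq> \<nu>" using that insert.hyps by auto
    then obtain w where w: "\<And>x. w x \<noteq> 0" "monom_eval w \<mu> \<noteq> monom_eval w \<nu>"
      using monom_eval_separates by blast
    have "(\<Sum>\<mu>\<in>S. (c \<mu> * (monom_eval w \<mu> - monom_eval w \<nu>)) * monom_eval z \<mu>) = 0"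
      if z: "\<And>x. z x \<noteq> 0" for z
    proof -
      \<comment> \<open>The translated relation minus the original one times the value of the
        monomial \<nu> at w: the term of \<nu> cancels.\<close>
      have "(\<Sum>\<mu>\<in>insert \<nu> S. c \<mu> * monom_eval (\<lambda>x. z x * w x) \<mu>)
          - monom_eval w \<nu> * (\<Sum>\<mu>\<in>insert \<nu> S. c \<mu> * monom_eval z \<mu>) = 0"
        by (subst insert.prems(1), use z w in simp, subst insert.prems(1), use z in simp, simp)
      then show ?thesis
        using insert.hyps by (simp add: monom_eval_mult sum_distrib_left sum_subtractf algebra_simps)
    qed
    then have "c \<mu> * (monom_eval w \<mu> - monom_eval w \<nu>) = 0"
      using insert.IH[of "\<lambda>\<mu>. c \<mu> * (monom_eval w \<mu> - monom_eval w \<nu>)" \<mu>] that by blast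
    with w show ?thesis by simp
  qed
  have "(\<Sum>\<mu>\<in>insert \<nu> S. c \<mu> * monom_eval (\<lambda>_. 1) \<mu>) = 0"
    by (rule insert.prems) simp
  then have "c \<nu> * monom_eval (\<lambda>_. 1) \<nu> = 0" using insert.hyps S by simp
  then have "c \<nu> = 0" by (simp add: monom_eval_nz)
  with S insert.prems(2) show ?case by auto
qed auto

lemma leval_torus_zero:
  assumes "\<And>z. (\<And>x. z x \<noteq> 0) \<Longrightarrow> leval z f = 0"
  shows "f = 0"
proof (rule poly_mapping_eqI)
  fix \<mu>
  have "lookup f \<mu> = 0" if "\<mu> \<in> keys f"
    using monom_eval_independent[of "keys f" "lookup f" \<mu>] assms that
    by (simp add: leval_def)
  then show "lookup f \<mu> = lookup 0 \<mu>" by (auto simp: in_keys_iff)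
qed

section \<open>Points with prescribed coordinates and density\<close>

text \<open>By counting, a tuple with a single index b outside [1, m] misses exactly one index
  inside; up to order it is [1, m] with one entry replaced.\<close>

lemma cell_tuple_cases:
  assumes m: "m \<ge> 1" and xs: "xs \<in> tuples m" "xs \<in> cell m"
  obtains "xs = [1..int m]"
  | k b where "k < m" "b \<notin> {1..int m}" "distinct ([1..int m][k := b])" "sort ([1..int m][k := b]) = xs"
proof -
  let ?J = "{1..int m}"
  have l: "length xs = m" "sorted_wrt (<) xs" "distinct xs" "sorted xs" "card (set xs) = m"
    using xs by (auto simp: tuples_def strict_sorted_iff distinct_card)
  show ?thesis
  proof (cases "set xs - ?J = {}")
    case True
    then have "set xs \<subseteq> ?J" by auto
    then have "set xs = ?J" using l by (intro card_subset_eq) auto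
    then have "xs = [1..int m]"
      using l sorted_distinct_set_unique[of xs "[1..int m]"] by simp
    then show ?thesis by (rule that(1))
  next
    case False
    then have "card (set xs - ?J) = 1" using xs(2) m by (auto simp: cell_def card_gt_0_iff le_Suc_eq)
    then obtain b where b: "set xs - ?J = {b}" by (auto simp: card_1_singleton_iff)
    have "card (?J - set xs) = 1"
    proof -
      have "card (?J - set xs) + card (?J \<inter> set xs) = m"
        by (subst card_Un_disjoint[symmetric]) (auto simp: Un_Diff_Int Diff_Int_distrib2 intro: arg_cong[where f = card])
      moreover have "card (set xs - ?J) + card (?J \<inter> set xs) = m"
        using l(5) by (subst card_Un_disjoint[symmetric]) (auto simp: Un_Diff_Int Int_commute)
      ultimately show ?thesis using b by simp
    qed
    then obtain a where a: "?J - set xs = {a}" by (auto simp: card_1_singleton_iff)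
    define k where "k = nat (a - 1)"
    have aJ: "a \<in> ?J" using a by auto
    have k: "k < m" "[1..int m] ! k = a" using aJ by (auto simp: k_def nth_upto)
    have bJ: "b \<notin> ?J" using b by auto
    let ?ys = "[1..int m][k := b]"
    have d: "distinct ?ys" using bJ by (intro distinct_list_update) auto
    have "set ?ys = insert b (?J - {a})"
      using set_update_distinct[of "[1..int m]" k b] k by simp
    also have "\<dots> = set xs" using a b by auto
    finally have "sort ?ys = xs"
      using l d by (intro sorted_distinct_set_unique) auto
    then show ?thesis using that(2)[OF k(1) bJ d] by simp
  qed
qed

text \<open>The first m vectors are a scaled standard basis with the prescribed determinant. By
  Cramer's rule, replacing the k-th of them by another vector multiplies the determinant by the k-th
  coordinate of that vector. So every further vector can be read off from the m minors in which its
  index is the only one outside.\<close>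

lemma exists_point:
  assumes m: "m \<ge> 1" and z: "\<And>x. z x \<noteq> 0"
  shows "\<exists>v. (\<forall>k. v k \<in> carrier_vec m) \<and> (\<forall>xs \<in> tuples m \<inter> cell m. Delta m xs v = z xs)"
proof -
  let ?j = "[1..int m]"
  define u :: "int \<Rightarrow> complex vec" where
    "u k = (if k = 1 then z ?j \<cdot>\<^sub>v unit_vec m 0 else unit_vec m (nat (k - 1)))" for k
  define B where "B = mat_of_cols m (map u ?j)"
  have B: "B \<in> carrier_mat m m" by (auto simp: B_def)
  have "map u ?j = [] @ (z ?j \<cdot>\<^sub>v unit_vec m 0) # map u [2..int m]"
    using m by (simp add: upto_rec1[of 1] u_def)
  then have "det B = z ?j * cdet m ([] @ unit_vec m 0 # map u [2..int m])"
    unfolding B_def using m by (simp only:) (rule cdet_smult, auto)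
  also have "mat_of_cols m ([] @ unit_vec m 0 # map u [2..int m]) = 1\<^sub>m m"
    using m by (intro eq_matI) (auto simp: mat_of_cols_index nth_Cons' nth_upto u_def of_nat_diff)
  finally have detB: "det B = z ?j" by simp
  \<comment> \<open>The sorting sign is the same for all configurations, so it can be fixed before
    v, whose construction uses it.\<close>
  define sg where "sg ys = (SOME e :: int. (e = 1 \<or> e = - 1) \<and> (\<forall>v. Delta m ys v = of_int e * Delta m (sort ys) v))" for ys
  have sg: "(sg ys = 1 \<or> sg ys = - 1) \<and> (\<forall>v. Delta m ys v = of_int (sg ys) * Delta m (sort ys) v)"
    if "distinct ys" "length ys = m" for ys
    unfolding sg_def by (rule someI_ex) (use psym_Delta_sign[OF that] in metis)
  define y :: "int \<Rightarrow> complex vec" where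
    "y b = vec m (\<lambda>k. z (sort (?j[k := b])) * of_int (sg (?j[k := b])) / z ?j)" for b
  define v where "v b = (if b \<in> {1..int m} then u b else B *\<^sub>v y b)" for b
  have vC: "v k \<in> carrier_vec m" for k
    using B by (auto simp: v_def u_def y_def)
  have vj: "map v ?j = map u ?j" by (simp add: v_def)
  show ?thesis
  proof (intro exI[of _ v] conjI allI ballI vC)
    fix xs assume "xs \<in> tuples m \<inter> cell m"
    then have xs: "xs \<in> tuples m" "xs \<in> cell m" by auto
    show "Delta m xs v = z xs"
      using m xs
    proof (cases rule: cell_tuple_cases)
      case 1
      then show ?thesis using detB by (simp add: Delta_def vj B_def)
    next
      case (2 k b)
      let ?ys = "?j[k := b]"
      have "mat_of_cols m (map v ?ys) = replace_col B (B *\<^sub>v y b) k"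
        using 2 B by (intro eq_matI)
          (auto simp: replace_col_def map_update vj mat_of_cols_index B_def nth_list_update v_def)
      then have "Delta m ?ys v = y b $ k * z ?j"
        using cramer_lemma_mat[OF B _ 2(1), of "y b"] by (simp add: Delta_def detB y_def)
      also have "\<dots> = z xs * of_int (sg ?ys)" using 2 z by (simp add: y_def)
      finally have "of_int (sg ?ys) * Delta m xs v = z xs * of_int (sg ?ys)"
        using sg[of ?ys] 2 by auto
      then show ?thesis using sg[of ?ys] 2 by auto
    qed
  qed
qed

section \<open>Density of nondegenerate points\<close>

definition moment :: "nat \<Rightarrow> int \<Rightarrow> complex vec" where
  "moment m k = vec m (\<lambda>j. of_int k ^ j)"

text \<open>A vanishing Vandermonde determinant would give a nonzero polynomial of degree less than
  m with m distinct roots. The moment curve is thus one point that meets all the open conditions at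
  once.\<close>

lemma moment_nz:
  assumes "length xs = m" "distinct xs"
  shows "Delta m xs (moment m) \<noteq> 0"
proof
  let ?M = "mat_of_cols m (map (moment m) xs)"
  assume "Delta m xs (moment m) = 0"
  moreover have M: "?M \<in> carrier_mat m m" using assms by auto
  ultimately have "det (?M\<^sup>T) = 0" by (simp add: Delta_def det_transpose[OF M])
  then obtain c where c: "c \<in> carrier_vec m" "c \<noteq> 0\<^sub>v m" "?M\<^sup>T *\<^sub>v c = 0\<^sub>v m"
    using det_0_iff_vec_prod_zero_field[of "?M\<^sup>T" m] M by auto
  define p where "p = (\<Sum>j<m. monom (c $ j) j)"
  have coeff: "coeff p j = (if j < m then c $ j else 0)" for j
    by (simp add: p_def coeff_sum)
  obtain j where "j < m" "c $ j \<noteq> 0" using c(1,2) by (metis eq_vecI carrier_vecD index_zero_vec)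
  then have p0: "p \<noteq> 0" using coeff[of j] by auto
  have deg: "degree p \<le> m - 1" by (rule degree_le) (auto simp: coeff)
  have "poly p (of_int x) = 0" if x: "x \<in> set xs" for x
  proof -
    obtain i where i: "i < m" "xs ! i = x" using x assms(1) by (auto simp: in_set_conv_nth)
    have "0 = (?M\<^sup>T *\<^sub>v c) $ i" using c(3) i by simp
    also have "\<dots> = (\<Sum>j<m. of_int x ^ j * c $ j)"
      using i assms c(1) M
      by (auto simp: scalar_prod_def moment_def mat_of_cols_index lessThan_atLeast0 intro!: sum.cong)
    also have "\<dots> = poly p (of_int x)" by (simp add: p_def poly_sum poly_monom mult.commute)
    finally show ?thesis by simp
  qed
  then have "(of_int :: int \<Rightarrow> complex) ` set xs \<subseteq> {x. poly p x = 0}" by auto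
  then have "card ((of_int :: int \<Rightarrow> complex) ` set xs) \<le> card {x. poly p x = 0}"
    using poly_roots_finite[OF p0] by (intro card_mono)
  also have "\<dots> \<le> degree p" by (rule card_poly_roots_bound[OF p0])
  finally have "m \<le> degree p"
    using assms by (simp add: card_image inj_on_def distinct_card)
  with deg have "m = 0" by simp
  then show False using \<open>j < m\<close> by simp
qed

definition pencil :: "nat \<Rightarrow> (int \<Rightarrow> complex vec) \<Rightarrow> complex \<Rightarrow> int \<Rightarrow> complex vec" where
  "pencil m v s k = vec m (\<lambda>j. (1 - s) * v k $ j + s * moment m k $ j)"

lemma pencil_poly:
  assumes "length xs = m"
  obtains p where "\<And>s. poly p s = Delta m xs (pencil m v s)"
proof -
  \<comment> \<open>The determinant is taken over the polynomial ring, and evaluation at s is a ring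
    homomorphism that commutes with it.\<close>
  define M where "M = mat m m (\<lambda>(i, j). [: v (xs ! j) $ i, moment m (xs ! j) $ i - v (xs ! j) $ i :])"
  have "poly (det M) s = Delta m xs (pencil m v s)" for s
  proof -
    interpret comm_ring_hom "\<lambda>p :: complex poly. poly p s" by unfold_locales simp_all
    have "map_mat (\<lambda>p. poly p s) M = mat_of_cols m (map (pencil m v s) xs)"
      using assms by (intro eq_matI) (auto simp: M_def mat_of_cols_index pencil_def algebra_simps)
    then show ?thesis using hom_det[of M] by (simp add: Delta_def)
  qed
  then show ?thesis by (rule that)
qed

text \<open>On the line from \<open>v\<close> to the moment curve the conditions fail for countably many parameters only,
  so that \<open>v\<close> is a limit of points where \<open>f\<close> vanishes.\<close>

lemma density:
  assumes v: "\<And>k. v k \<in> carrier_vec m" and W: "countable W" "\<And>w. w \<in> W \<Longrightarrow> length w = m \<and> distinct w"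
    and f: "\<And>\<mu> xs. \<mu> \<in> keys f \<Longrightarrow> xs \<in> keys \<mu> \<Longrightarrow>
      length xs = m \<and> (lookup \<mu> xs \<ge> 0 \<or> Delta m xs v \<noteq> 0)"
    and vanish: "\<And>v'. (\<And>k. v' k \<in> carrier_vec m) \<Longrightarrow> (\<And>w. w \<in> W \<Longrightarrow> Delta m w v' \<noteq> 0) \<Longrightarrow> dval m v' f = 0"
  shows "dval m v f = 0"
proof -
  define P where "P xs = (SOME p. \<forall>s. poly p s = Delta m xs (pencil m v s))" for xs
  have P: "poly (P xs) s = Delta m xs (pencil m v s)" if "length xs = m" for xs s
  proof -
    have "\<exists>p. \<forall>s. poly p s = Delta m xs (pencil m v s)" using pencil_poly[OF that] by metis
    from someI_ex[OF this] show ?thesis by (simp add: P_def)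
  qed
  have p0: "pencil m v 0 = v" by (intro ext eq_vecI) (auto simp: pencil_def carrier_vecD[OF v])
  have p1: "pencil m v 1 = moment m" by (intro ext eq_vecI) (auto simp: pencil_def moment_def)
  \<comment> \<open>With infinitely many conditions the bad parameters may be infinite in number.
    Each condition excludes the roots of one polynomial that is nonzero at 1, and countably many
    finite sets do not fill an interval.\<close>
  define bad where "bad = (\<Union>w\<in>W. {s. poly (P w) s = 0})"
  have cbad: "countable bad"
    unfolding bad_def
  proof (intro countable_UN W countable_finite poly_roots_finite)
    fix w assume "w \<in> W"
    then have "poly (P w) 1 \<noteq> 0" using W(2) by (simp add: P p1 moment_nz)
    then show "P w \<noteq> 0" by auto
  qed
  have cnt: "countable ((of_real :: real \<Rightarrow> complex) -` bad)"
  proof -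
    from cbad have "countable ((of_real :: real \<Rightarrow> complex) ` (of_real -` bad))"
      by (rule countable_subset[rotated]) auto
    then show ?thesis by (rule countable_image_inj_on) (simp add: inj_on_def)
  qed
  have "\<exists>s. 0 < s \<and> s < inverse (real (Suc n)) \<and> complex_of_real s \<notin> bad" for n
  proof (rule ccontr)
    assume "\<not> ?thesis"
    then have "{0<..<inverse (real (Suc n))} \<subseteq> (of_real :: real \<Rightarrow> complex) -` bad" by auto
    then have "countable {0<..<inverse (real (Suc n))}" using cnt by (rule countable_subset)
    moreover have "0 < inverse (real (Suc n))" by simp
    ultimately show False using uncountable_open_interval by blast
  qed
  then obtain s where s: "\<And>n. 0 < s n" "\<And>n. s n < inverse (real (Suc n))" "\<And>n. complex_of_real (s n) \<notin> bad"
    by metis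
  have "s \<longlonglongrightarrow> 0"
    by (rule tendsto_sandwich[OF _ _ tendsto_const LIMSEQ_inverse_real_of_nat])
      (use s in \<open>auto intro!: always_eventually less_imp_le\<close>)
  then have s0: "(\<lambda>n. complex_of_real (s n)) \<longlonglongrightarrow> 0"
    using tendsto_of_real[of s 0 sequentially] by simp
  have van: "dval m (pencil m v (of_real (s n))) f = 0" for n
  proof (rule vanish)
    fix w assume w: "w \<in> W"
    then have "poly (P w) (of_real (s n)) \<noteq> 0" using s(3)[of n] by (auto simp: bad_def)
    then show "Delta m w (pencil m v (of_real (s n))) \<noteq> 0" using W(2)[OF w] P by simp
  qed (simp add: pencil_def)
  have lim: "(\<lambda>n. Delta m xs (pencil m v (of_real (s n)))) \<longlonglongrightarrow> Delta m xs v" if "length xs = m" for xs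
  proof -
    have "(\<lambda>n. poly (P xs) (of_real (s n))) \<longlonglongrightarrow> poly (P xs) 0"
      using isCont_tendsto_compose[OF poly_isCont s0] .
    then show ?thesis by (simp add: P[OF that] p0)
  qed
  have "(\<lambda>n. dval m (pencil m v (of_real (s n))) f) \<longlonglongrightarrow> dval m v f"
    unfolding leval_def monom_eval_def
  proof (intro tendsto_sum tendsto_mult tendsto_const tendsto_prod)
    fix \<mu> xs assume k: "\<mu> \<in> keys f" "xs \<in> keys \<mu>"
    note l = lim[OF conjunct1[OF f[OF k]]]
    show "(\<lambda>n. Delta m xs (pencil m v (of_real (s n))) powi lookup \<mu> xs)
        \<longlonglongrightarrow> Delta m xs v powi lookup \<mu> xs"
    \<comment> \<open>A negative power is continuous only where its base is nonzero, and the
      hypothesis on f provides this at v.\<close>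
    proof (cases "lookup \<mu> xs \<ge> 0")
      case True
      then show ?thesis using tendsto_power[OF l] by (simp add: power_int_nonneg_exp)
    next
      case False
      then show ?thesis using f[OF k] by (intro tendsto_power_int l) auto
    qed
  qed
  then show ?thesis by (simp add: van LIMSEQ_const_iff)
qed

text \<open>A Nullstellensatz for the Pluecker ideal. Up to a unit, f is represented by some g in
  the chart coordinates, among which there are no relations; so g is zero as a Laurent polynomial
  and not only modulo the ideal, and dividing by the unit puts f into the ideal.\<close>

theorem plucker_ideal_eq:
  assumes m: "m \<ge> 1" and f: "f \<in> lset m UNIV" and van: "\<And>v. v \<in> conf m \<Longrightarrow> dval m v f = 0"
  shows "f \<in> plucker_ideal m"
proof -
  obtain u u' w g where u: "u \<in> lset m UNIV" "u' \<in> lset m UNIV" "u * u' = 1"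
    and g: "g \<in> lset m (cell m)" "u * f - g \<in> plucker_ideal m"
    using cell_reduction_unit[OF m f] by metis
  have gU: "g \<in> lset m UNIV" using g(1) lset_mono[of "cell m" UNIV m] by auto
  have g0: "dval m v g = 0" if "v \<in> conf m" for v
    using dval_plucker_ideal[OF m that g(2)] van[OF that] dval_mult[OF that u(1) f] by (simp add: leval_diff)
  have keys: "xs \<in> tuples m \<inter> cell m" if "\<mu> \<in> keys g" "xs \<in> keys \<mu>" for \<mu> xs
    using g(1) that by (auto simp: lset_def good_monom_def)
  have "g = 0"
  proof (rule leval_torus_zero)
    fix z :: "int list \<Rightarrow> complex" assume z: "\<And>x. z x \<noteq> 0"
    \<comment> \<open>This point has the prescribed chart coordinates, but its remaining consecutive
      minors may vanish, so it need not lie in \<open>conf m\<close>; density closes the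
      gap.\<close>
    obtain v where v: "\<forall>k. v k \<in> carrier_vec m" "\<forall>xs \<in> tuples m \<inter> cell m. Delta m xs v = z xs"
      using exists_point[OF m, of z, OF z] by auto
    have "dval m v g = 0"
    proof (rule density[of v m "consec m"])
      have "consec m = range (\<lambda>a. [a..a + int m - 1])" by (auto simp: consec_def)
      then show "countable (consec m)" by simp
      show "length xs = m \<and> (lookup \<mu> xs \<ge> 0 \<or> Delta m xs v \<noteq> 0)"
        if "\<mu> \<in> keys g" "xs \<in> keys \<mu>" for \<mu> xs
        using keys[OF that] v z by (auto simp: tuples_def)
      show "dval m v' g = 0" if "\<And>k. v' k \<in> carrier_vec m" "\<And>w. w \<in> consec m \<Longrightarrow> Delta m w v' \<noteq> 0" for v'
        by (rule g0) (use that in \<open>auto simp: conf_def consec_def\<close>)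
    qed (use v in \<open>auto simp: consec_def\<close>)
    moreover have "dval m v g = leval z g"
      unfolding leval_def monom_eval_def using keys v by (intro sum.cong prod.cong refl arg_cong2[where f = "(*)"]) auto
    ultimately show "leval z g = 0" by simp
  qed
  with g have "u * f \<in> plucker_ideal m" by simp
  then have *: "u' * (u * f) \<in> plucker_ideal m" by (rule pideal_mult[OF m _ u(2)])
  have "u' * (u * f) = (u * u') * f" by (simp only: mult_ac)
  also have "\<dots> = f" by (simp only: u(3) mult_1)
  finally show ?thesis using * by (simp only:)
qed

section \<open>Quotients and generated subalgebras\<close>

text \<open>\<open>quot_alg\<close> rebuilds the quotient ring as a record with scalars, so the ring
  axioms are carried over field by field.\<close>

lemma cring_cong:
  fixes R :: "('a, 'b) ring_scheme" and S :: "('a, 'c) ring_scheme"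
  assumes "cring S" "carrier R = carrier S" "monoid.mult R = monoid.mult S"
    "monoid.one R = monoid.one S" "ring.zero R = ring.zero S" "ring.add R = ring.add S"
  shows "cring R"
proof -
  interpret S: cring S by fact
  show ?thesis
  proof (rule cringI)
    show "abelian_group R"
      by (rule abelian_groupI) (auto simp: assms(2-) S.a_ac intro: bexI[of _ "\<ominus>\<^bsub>S\<^esub> _"] S.l_neg)
    show "comm_monoid R"
      by (rule comm_monoidI) (auto simp: assms(2-) S.m_ac)
  qed (auto simp: assms(2-) S.l_distr)
qed

text \<open>Scalars act through the multiples of the unit. In this form the structure passes to
  quotients, and compatibility with scalars becomes compatibility with products.\<close>

definition calg :: "(complex, 'a) module \<Rightarrow> bool" where
  "calg A \<longleftrightarrow> cring A \<and> (\<forall>c. c \<odot>\<^bsub>A\<^esub> \<one>\<^bsub>A\<^esub> \<in> carrier A \<and>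
    (\<forall>x \<in> carrier A. c \<odot>\<^bsub>A\<^esub> x = (c \<odot>\<^bsub>A\<^esub> \<one>\<^bsub>A\<^esub>) \<otimes>\<^bsub>A\<^esub> x))"

lemma calg_cring: "calg A \<Longrightarrow> cring A" by (simp add: calg_def)

lemma calg_ring: "calg A \<Longrightarrow> ring A" by (simp add: calg_def cring.axioms)

lemma calg_one_smult: "calg A \<Longrightarrow> c \<odot>\<^bsub>A\<^esub> \<one>\<^bsub>A\<^esub> \<in> carrier A" by (simp add: calg_def)

lemma calg_smult:
  "calg A \<Longrightarrow> x \<in> carrier A \<Longrightarrow> c \<odot>\<^bsub>A\<^esub> x = (c \<odot>\<^bsub>A\<^esub> \<one>\<^bsub>A\<^esub>) \<otimes>\<^bsub>A\<^esub> x"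
  unfolding calg_def by blast

lemma calg_smult_closed: "calg A \<Longrightarrow> x \<in> carrier A \<Longrightarrow> c \<odot>\<^bsub>A\<^esub> x \<in> carrier A"
  using calg_one_smult[of A c] calg_smult[of A x c] monoid.m_closed[OF ring.is_monoid[OF calg_ring]] by metis

lemma calg_laurent: "calg (laurent_alg m)"
  unfolding calg_def by (auto simp: laurent_cring carrier_laurent)

lemma quot_alg_simps [simp]:
  "carrier (quot_alg A I) = carrier (A Quot I)" "monoid.mult (quot_alg A I) = monoid.mult (A Quot I)"
  "monoid.one (quot_alg A I) = monoid.one (A Quot I)" "ring.zero (quot_alg A I) = ring.zero (A Quot I)"
  "ring.add (quot_alg A I) = ring.add (A Quot I)"
  by (simp_all add: quot_alg_def)

lemma quot_alg_hom:
  assumes "calg A" "ideal I A"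
  shows "(+>\<^bsub>A\<^esub>) I \<in> Ring.ring_hom A (quot_alg A I)"
  using ideal.rcos_ring_hom[OF assms(2)] by (simp add: Ring.ring_hom_def)

lemma quot_alg_cring:
  assumes "calg A" "ideal I A" shows "cring (quot_alg A I)"
  by (rule cring_cong[OF ideal.quotient_is_cring[OF assms(2) calg_cring[OF assms(1)]]]) simp_all

lemma quot_alg_carrier: "carrier (quot_alg A I) = (+>\<^bsub>A\<^esub>) I ` carrier A"
  by (auto simp: FactRing_def A_RCOSETS_def')

text \<open>All members y of the coset give the same coset of the scalar multiple, because c acts as
  multiplication by a ring element. The union in \<open>quot_alg\<close> is therefore over a
  constant family, indexed by a nonempty set.\<close>

lemma quot_alg_smult:
  assumes "calg A" "ideal I A" "x \<in> carrier A"
  shows "c \<odot>\<^bsub>quot_alg A I\<^esub> (I +>\<^bsub>A\<^esub> x) = I +>\<^bsub>A\<^esub> (c \<odot>\<^bsub>A\<^esub> x)"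
proof -
  interpret I: ideal I A by fact
  have hom: "(+>\<^bsub>A\<^esub>) I \<in> Ring.ring_hom A (A Quot I)" by (rule I.rcos_ring_hom)
  have eq: "I +>\<^bsub>A\<^esub> (c \<odot>\<^bsub>A\<^esub> y) = I +>\<^bsub>A\<^esub> (c \<odot>\<^bsub>A\<^esub> x)" if y: "y \<in> I +>\<^bsub>A\<^esub> x" for y
  proof -
    have yA: "y \<in> carrier A" using I.a_elemrcos_carrier assms(3) y by blast
    have "I +>\<^bsub>A\<^esub> x = I +>\<^bsub>A\<^esub> y" using I.a_repr_independence[OF y assms(3) I.a_subgroup] .
    then show ?thesis
      unfolding calg_smult[OF assms(1) yA] calg_smult[OF assms(1,3)]
        ring_hom_mult[OF hom calg_one_smult[OF assms(1)] yA]
        ring_hom_mult[OF hom calg_one_smult[OF assms(1)] assms(3)] by (simp only:)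
  qed
  have ne: "I +>\<^bsub>A\<^esub> x \<noteq> {}" using I.a_rcos_self assms(3) by blast
  have "c \<odot>\<^bsub>quot_alg A I\<^esub> (I +>\<^bsub>A\<^esub> x) = (\<Union>y \<in> I +>\<^bsub>A\<^esub> x. I +>\<^bsub>A\<^esub> (c \<odot>\<^bsub>A\<^esub> y))"
    by (simp add: quot_alg_def)
  also have "\<dots> = (\<Union>y \<in> I +>\<^bsub>A\<^esub> x. I +>\<^bsub>A\<^esub> (c \<odot>\<^bsub>A\<^esub> x))"
    by (rule SUP_cong[OF refl eq])
  also have "\<dots> = I +>\<^bsub>A\<^esub> (c \<odot>\<^bsub>A\<^esub> x)" using ne by (simp only: UN_constant if_False)
  finally show ?thesis .
qed

lemma quot_alg_calg:
  assumes "calg A" "ideal I A" shows "calg (quot_alg A I)"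
proof -
  interpret I: ideal I A by fact
  have hom: "(+>\<^bsub>A\<^esub>) I \<in> Ring.ring_hom A (quot_alg A I)" by (rule quot_alg_hom[OF assms])
  have one: "c \<odot>\<^bsub>quot_alg A I\<^esub> \<one>\<^bsub>quot_alg A I\<^esub> = I +>\<^bsub>A\<^esub> (c \<odot>\<^bsub>A\<^esub> \<one>\<^bsub>A\<^esub>)" for c
    using quot_alg_smult[OF assms I.one_closed] ring_hom_one[OF hom] by metis
  show ?thesis
    unfolding calg_def
  proof (intro conjI allI ballI quot_alg_cring assms)
    fix c
    show "c \<odot>\<^bsub>quot_alg A I\<^esub> \<one>\<^bsub>quot_alg A I\<^esub> \<in> carrier (quot_alg A I)"
      unfolding one by (rule ring_hom_closed[OF hom calg_one_smult[OF assms(1)]])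
    fix X assume "X \<in> carrier (quot_alg A I)"
    then obtain x where x: "x \<in> carrier A" "X = I +>\<^bsub>A\<^esub> x" unfolding quot_alg_carrier by auto
    show "c \<odot>\<^bsub>quot_alg A I\<^esub> X = (c \<odot>\<^bsub>quot_alg A I\<^esub> \<one>\<^bsub>quot_alg A I\<^esub>) \<otimes>\<^bsub>quot_alg A I\<^esub> X"
      unfolding one x(2) quot_alg_smult[OF assms x(1)] calg_smult[OF assms(1) x(1)]
      by (rule ring_hom_mult[OF hom calg_one_smult[OF assms(1)] x(1)])
  qed
qed

section \<open>Generated subalgebras as images, and uniqueness of homomorphisms\<close>

lemma hom_image_generate_ring:
  assumes "ring R" "ring S" "h \<in> Ring.ring_hom R S" "H \<subseteq> carrier R"
  shows "h ` generate_ring R H = generate_ring S (h ` H)"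
proof -
  interpret ring_hom_ring R S h using assms(1-3) by (rule ring_hom_ringI2)
  have car: "x \<in> carrier R" if "x \<in> generate_ring R H" for x
    using R.generate_ring_in_carrier[OF assms(4) that] .
  show ?thesis
  proof
    have "h x \<in> generate_ring S (h ` H)" if "x \<in> generate_ring R H" for x
      using that by induction (auto simp: car intro: generate_ring.intros)
    then show "h ` generate_ring R H \<subseteq> generate_ring S (h ` H)" by auto
    have "y \<in> h ` generate_ring R H" if "y \<in> generate_ring S (h ` H)" for y
      using that
    proof induction
      case one
      show ?case using generate_ring.one[of R H] hom_one by (metis imageI)
    next
      case (incl y)
      then show ?case by (auto intro: generate_ring.incl)
    next
      case (a_inv y)
      then obtain x where "x \<in> generate_ring R H" "y = h x" by auto
      then show ?case by (intro image_eqI[of _ _ "\<ominus>\<^bsub>R\<^esub> x"]) (auto simp: car intro: generate_ring.a_inv)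
    next
      case (eng_add y1 y2)
      then obtain x1 x2 where "x1 \<in> generate_ring R H" "y1 = h x1" "x2 \<in> generate_ring R H" "y2 = h x2" by auto
      then show ?case by (intro image_eqI[of _ _ "x1 \<oplus>\<^bsub>R\<^esub> x2"]) (auto simp: car intro: generate_ring.eng_add)
    next
      case (eng_mult y1 y2)
      then obtain x1 x2 where "x1 \<in> generate_ring R H" "y1 = h x1" "x2 \<in> generate_ring R H" "y2 = h x2" by auto
      then show ?case by (intro image_eqI[of _ _ "x1 \<otimes>\<^bsub>R\<^esub> x2"]) (auto simp: car intro: generate_ring.eng_mult)
    qed
    then show "generate_ring S (h ` H) \<subseteq> h ` generate_ring R H" by auto
  qed
qed

definition lgens :: "nat \<Rightarrow> int list set \<Rightarrow> laurent set" where
  "lgens m V = Lvar ` (tuples m \<inter> V) \<union> Lvar_inv ` (consec m \<inter> V) \<union> range (single 0)"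

lemma lset_generate: "lset m V = generate_ring (laurent_alg m) (lgens m V)"
proof
  show "lset m V \<subseteq> generate_ring (laurent_alg m) (lgens m V)"
  proof
    fix f assume "f \<in> lset m V"
    then show "f \<in> generate_ring (laurent_alg m) (lgens m V)"
    proof (induction rule: lset_induct)
      case (add f g)
      then show ?case using generate_ring.eng_add[of f "laurent_alg m" "lgens m V" g] by simp
    next
      case (mult f g)
      then show ?case using generate_ring.eng_mult[of f "laurent_alg m" "lgens m V" g] by simp
    qed (auto intro!: generate_ring.incl simp: lgens_def)
  qed
  have "f \<in> lset m V" if "f \<in> generate_ring (laurent_alg m) (lgens m V)" for f
    using that
  proof induction
    case (a_inv f)
    then have "f \<in> lset m UNIV" using lset_mono[of V UNIV m] by auto
    with a_inv show ?case by (simp add: laurent_uminus lset_uminus)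
  qed (auto simp: lgens_def intro: lset_Lvar lset_Lvar_inv lset_add lset_mult)
  then show "generate_ring (laurent_alg m) (lgens m V) \<subseteq> lset m V" by auto
qed

text \<open>Both \<open>G_on\<close> and \<open>coord_diamond\<close> are defined by generators. As
  images of the same ring \<open>lset m V\<close> they can be compared on representatives.\<close>

lemma gen_subalg_image:
  assumes "ring S" "h \<in> Ring.ring_hom (laurent_alg m) S"
    and c: "\<And>c. h (single 0 c) = c \<odot>\<^bsub>S\<^esub> \<one>\<^bsub>S\<^esub>"
    and H: "H = (\<lambda>xs. h (Lvar xs)) ` (tuples m \<inter> V) \<union> (\<lambda>xs. h (Lvar_inv xs)) ` (consec m \<inter> V)"
  shows "carrier (gen_subalg S H) = h ` lset m V"
proof -
  have "{c \<odot>\<^bsub>S\<^esub> \<one>\<^bsub>S\<^esub> | c. True} = range (\<lambda>c. h (single 0 c))"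
    by (auto simp: c)
  then have "H \<union> {c \<odot>\<^bsub>S\<^esub> \<one>\<^bsub>S\<^esub> | c. True} = h ` lgens m V"
    by (simp only: H lgens_def image_Un image_image)
  moreover have "lgens m V \<subseteq> carrier (laurent_alg m)"
    by (auto simp: lgens_def carrier_laurent intro: lset_Lvar lset_Lvar_inv)
  ultimately show ?thesis
    using hom_image_generate_ring[OF laurent_ring assms(1,2)] by (simp add: gen_subalg_def lset_generate)
qed

text \<open>This settles the uniqueness half of the descriptions \<open>sh\<close> and
  \<open>to_coord\<close>, which prescribe values on the variables: the values on the inverted
  variables follow, as inverses in a monoid are unique.\<close>

lemma lset_hom_unique:
  assumes "Group.monoid B"
    and h: "\<And>f g. f \<in> lset m V \<Longrightarrow> g \<in> lset m V \<Longrightarrow> h (f + g) = h f \<oplus>\<^bsub>B\<^esub> h g"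
      "\<And>f g. f \<in> lset m V \<Longrightarrow> g \<in> lset m V \<Longrightarrow> h (f * g) = h f \<otimes>\<^bsub>B\<^esub> h g"
      "h 1 = \<one>\<^bsub>B\<^esub>" "\<And>f. f \<in> lset m V \<Longrightarrow> h f \<in> carrier B"
    and k: "\<And>f g. f \<in> lset m V \<Longrightarrow> g \<in> lset m V \<Longrightarrow> k (f + g) = k f \<oplus>\<^bsub>B\<^esub> k g"
      "\<And>f g. f \<in> lset m V \<Longrightarrow> g \<in> lset m V \<Longrightarrow> k (f * g) = k f \<otimes>\<^bsub>B\<^esub> k g"
      "k 1 = \<one>\<^bsub>B\<^esub>" "\<And>f. f \<in> lset m V \<Longrightarrow> k f \<in> carrier B"
    and c: "\<And>c. h (single 0 c) = k (single 0 c)"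
    and v: "\<And>xs. xs \<in> tuples m \<Longrightarrow> xs \<in> V \<Longrightarrow> h (Lvar xs) = k (Lvar xs)"
    and f: "f \<in> lset m V"
  shows "h f = k f"
  using f
proof (induction rule: lset_induct)
  case (inv xs)
  interpret B: Group.monoid B by fact
  have l: "Lvar xs \<in> lset m V" "Lvar_inv xs \<in> lset m V" "xs \<in> tuples m"
    using inv by (auto intro: lset_Lvar lset_Lvar_inv consec_tuples)
  have "h (Lvar_inv xs) \<otimes>\<^bsub>B\<^esub> h (Lvar xs) = \<one>\<^bsub>B\<^esub>"
    using h(2)[OF l(2,1)] h(3) by (simp add: mult.commute)
  moreover have "h (Lvar xs) \<otimes>\<^bsub>B\<^esub> k (Lvar_inv xs) = \<one>\<^bsub>B\<^esub>"
    using k(2)[OF l(1,2)] k(3) v[OF l(3) inv(2)] by simp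
  ultimately show ?case
    using B.inv_unique[of "h (Lvar_inv xs)" "h (Lvar xs)" "k (Lvar_inv xs)"] h(4) k(4) l by simp
qed (auto simp: c v h k)

section \<open>The algebra of functions on configurations\<close>

abbreviation cls :: "nat \<Rightarrow> laurent \<Rightarrow> laurent set" where
  "cls m f \<equiv> plucker_ideal m +>\<^bsub>laurent_alg m\<^esub> f"

definition invars :: "int set \<Rightarrow> int list set" where
  "invars J = {xs. set xs \<subseteq> J}"

lemma invars_mono: "J \<subseteq> J' \<Longrightarrow> lset m (invars J) \<subseteq> lset m (invars J')"
  by (rule lset_mono) (auto simp: invars_def)

lemma lset_UNIV: "f \<in> lset m V \<Longrightarrow> f \<in> lset m UNIV"
  using lset_mono[of V UNIV m] by auto

text \<open>A map of configurations acts on \<open>G m\<close> by precomposition as soon as it turns Laurent polynomials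
  in the Pluecker coordinates into such.\<close>

definition liftable ::
  "nat \<Rightarrow> ((int \<Rightarrow> complex vec) \<Rightarrow> int \<Rightarrow> complex vec) \<Rightarrow> int list set \<Rightarrow> int list set \<Rightarrow> bool" where
  "liftable m K V W \<longleftrightarrow> (\<forall>f \<in> lset m V. \<exists>g \<in> lset m W. \<forall>v \<in> conf m. dval m v g = dval m (K v) f)"

text \<open>The representative f of X and the representative g of its image are chosen together. For
  K that preserves \<open>conf m\<close>, the resulting class depends on neither choice, since
  classes are separated by their values on \<open>conf m\<close>.\<close>

definition pull ::
  "nat \<Rightarrow> ((int \<Rightarrow> complex vec) \<Rightarrow> int \<Rightarrow> complex vec) \<Rightarrow> laurent set \<Rightarrow> laurent set" where
  "pull m K X = cls m (SOME g. g \<in> lset m UNIV \<and>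
    (\<exists>f \<in> lset m UNIV. cls m f = X \<and> (\<forall>v \<in> conf m. dval m v g = dval m (K v) f)))"

definition alg_pullback :: "nat \<Rightarrow> ((int \<Rightarrow> complex vec) \<Rightarrow> int \<Rightarrow> complex vec) \<Rightarrow> bool" where
  "alg_pullback m K \<longleftrightarrow> (\<forall>v \<in> conf m. K v \<in> conf m) \<and> liftable m K UNIV UNIV"

context
  fixes m :: nat
  assumes m: "m \<ge> 1"
begin

lemma cls_hom: "cls m \<in> Ring.ring_hom (laurent_alg m) (G m)"
  unfolding G_def by (rule quot_alg_hom[OF calg_laurent plucker_ideal_ideal[OF m]])

lemma G_calg: "calg (G m)"
  unfolding G_def by (rule quot_alg_calg[OF calg_laurent plucker_ideal_ideal[OF m]])

lemma G_carrier: "carrier (G m) = cls m ` lset m UNIV"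
  unfolding G_def quot_alg_carrier carrier_laurent ..

lemma cls_smult: "f \<in> lset m UNIV \<Longrightarrow> c \<odot>\<^bsub>G m\<^esub> cls m f = cls m (single 0 c * f)"
  unfolding G_def
  using quot_alg_smult[OF calg_laurent plucker_ideal_ideal[OF m], of f c] by (simp add: carrier_laurent)

lemma cls_closed: "f \<in> lset m UNIV \<Longrightarrow> cls m f \<in> carrier (G m)"
  by (simp add: G_carrier)

lemma cls_add: "f \<in> lset m UNIV \<Longrightarrow> g \<in> lset m UNIV \<Longrightarrow> cls m f \<oplus>\<^bsub>G m\<^esub> cls m g = cls m (f + g)"
  using ring_hom_add[OF cls_hom, of f g] by (simp add: carrier_laurent)

lemma cls_mult: "f \<in> lset m UNIV \<Longrightarrow> g \<in> lset m UNIV \<Longrightarrow> cls m f \<otimes>\<^bsub>G m\<^esub> cls m g = cls m (f * g)"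
  using ring_hom_mult[OF cls_hom, of f g] by (simp add: carrier_laurent)

lemma cls_one: "\<one>\<^bsub>G m\<^esub> = cls m 1"
  using ring_hom_one[OF cls_hom] by simp

lemma cls_const: "cls m (single 0 c) = c \<odot>\<^bsub>G m\<^esub> \<one>\<^bsub>G m\<^esub>"
  using cls_smult[of 1 c] by (simp add: cls_one)

text \<open>The Pluecker ideal is the vanishing ideal, by both inclusions. From here on
  \<open>G m\<close> is a ring of functions on \<open>conf m\<close>, and identities in it are
  checked pointwise.\<close>

lemma cls_eq_iff:
  assumes "f \<in> lset m UNIV" "g \<in> lset m UNIV"
  shows "cls m f = cls m g \<longleftrightarrow> (\<forall>v \<in> conf m. dval m v f = dval m v g)"
proof -
  interpret cring "laurent_alg m" by (rule laurent_cring)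
  have "cls m f = cls m g \<longleftrightarrow> f \<ominus>\<^bsub>laurent_alg m\<^esub> g \<in> plucker_ideal m"
    using quotient_eq_iff_same_a_r_cos[OF plucker_ideal_ideal[OF m]] assms by (simp add: carrier_laurent)
  also have "f \<ominus>\<^bsub>laurent_alg m\<^esub> g = f - g"
    using assms by (simp add: a_minus_def laurent_uminus)
  also have "f - g \<in> plucker_ideal m \<longleftrightarrow> (\<forall>v \<in> conf m. dval m v f = dval m v g)"
    using dval_plucker_ideal[OF m, of _ "f - g"] plucker_ideal_eq[OF m lset_diff[OF assms]]
    by (auto simp: leval_diff)
  finally show ?thesis .
qed

lemma cls_var: "cls m (Lvar xs) = Gvar m xs" "cls m (Lvar_inv xs) = Gvar_inv m xs"
  by (simp_all add: Gvar_def Gvar_inv_def)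

lemma G_on_carrier: "carrier (G_on m J) = cls m ` lset m (invars J)"
  unfolding G_on_def
  by (rule gen_subalg_image[OF calg_ring[OF G_calg] cls_hom cls_const])
    (auto simp: cls_var invars_def image_def)

text \<open>Evaluation is multiplicative at points of \<open>conf m\<close>, where K stays, so the
  elements with a lift are closed under sums and products.\<close>

lemma liftableI:
  assumes K: "\<And>v. v \<in> conf m \<Longrightarrow> K v \<in> conf m"
    and var: "\<And>xs. xs \<in> tuples m \<Longrightarrow> xs \<in> V \<Longrightarrow> \<exists>g \<in> lset m W. \<forall>v \<in> conf m. dval m v g = Delta m xs (K v)"
    and inv: "\<And>xs. xs \<in> consec m \<Longrightarrow> xs \<in> V \<Longrightarrow> \<exists>g \<in> lset m W. \<forall>v \<in> conf m. dval m v g = inverse (Delta m xs (K v))"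
  shows "liftable m K V W"
  unfolding liftable_def
proof
  fix f assume "f \<in> lset m V"
  then show "\<exists>g \<in> lset m W. \<forall>v \<in> conf m. dval m v g = dval m (K v) f"
  proof (induction rule: lset_induct)
    case (const c)
    show ?case by (intro bexI[of _ "single 0 c"]) auto
  next
    case (add f f')
    then obtain g g' where "g \<in> lset m W" "\<forall>v \<in> conf m. dval m v g = dval m (K v) f"
      "g' \<in> lset m W" "\<forall>v \<in> conf m. dval m v g' = dval m (K v) f'" by blast
    then show ?case by (intro bexI[of _ "g + g'"]) (auto simp: leval_add lset_add)
  next
    case (mult f f')
    then obtain g g' where "g \<in> lset m W" "\<forall>v \<in> conf m. dval m v g = dval m (K v) f"
      "g' \<in> lset m W" "\<forall>v \<in> conf m. dval m v g' = dval m (K v) f'" by blast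
    with mult.hyps show ?case
      by (intro bexI[of _ "g * g'"]) (auto simp: dval_mult[of _ m _ W] dval_mult[of _ m _ V] K lset_mult)
  qed (use var inv in auto)
qed

lemma pull_cls:
  assumes K: "\<And>v. v \<in> conf m \<Longrightarrow> K v \<in> conf m" and f: "f \<in> lset m UNIV" and g: "g \<in> lset m UNIV"
    and fg: "\<And>v. v \<in> conf m \<Longrightarrow> dval m v g = dval m (K v) f"
  shows "pull m K (cls m f) = cls m g"
proof -
  let ?P = "\<lambda>g. g \<in> lset m UNIV \<and>
    (\<exists>f' \<in> lset m UNIV. cls m f' = cls m f \<and> (\<forall>v \<in> conf m. dval m v g = dval m (K v) f'))"
  have "?P g" using f g fg by blast
  then have "?P (SOME g. ?P g)" by (rule someI)
  then obtain f' where g': "(SOME g. ?P g) \<in> lset m UNIV" and f': "f' \<in> lset m UNIV" "cls m f' = cls m f"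
    "\<forall>v \<in> conf m. dval m v (SOME g. ?P g) = dval m (K v) f'" by blast
  have "cls m (SOME g. ?P g) = cls m g"
    using f' f g fg K cls_eq_iff[OF f'(1) f] by (subst cls_eq_iff[OF g' g]) auto
  then show ?thesis by (simp add: pull_def)
qed

lemma pullE:
  assumes "alg_pullback m K" "X \<in> carrier (G m)"
  obtains f g where "f \<in> lset m UNIV" "X = cls m f" "g \<in> lset m UNIV" "pull m K X = cls m g"
    "\<forall>v \<in> conf m. dval m v g = dval m (K v) f"
proof -
  obtain f where f: "f \<in> lset m UNIV" "X = cls m f" using assms(2) G_carrier by auto
  obtain g where g: "g \<in> lset m UNIV" "\<forall>v \<in> conf m. dval m v g = dval m (K v) f"
    using assms(1) f unfolding alg_pullback_def liftable_def by blast
  then have "pull m K X = cls m g" using assms(1) f pull_cls by (auto simp: alg_pullback_def)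
  with f g show ?thesis by (intro that) auto
qed

lemma pull_alg_hom:
  assumes K: "alg_pullback m K"
  shows "pull m K \<in> alg_hom (G m) (G m)"
proof -
  have Kc: "\<And>v. v \<in> conf m \<Longrightarrow> K v \<in> conf m" using K by (simp add: alg_pullback_def)
  have "pull m K \<in> Ring.ring_hom (G m) (G m)"
  proof (rule ring_hom_memI)
    fix X assume "X \<in> carrier (G m)"
    with K show "pull m K X \<in> carrier (G m)" by (rule pullE) (simp add: cls_closed)
  next
    fix X Y assume XY: "X \<in> carrier (G m)" "Y \<in> carrier (G m)"
    obtain f g where fg: "f \<in> lset m UNIV" "X = cls m f" "g \<in> lset m UNIV" "pull m K X = cls m g"
      "\<forall>v \<in> conf m. dval m v g = dval m (K v) f" using K XY(1) by (rule pullE)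
    obtain f' g' where fg': "f' \<in> lset m UNIV" "Y = cls m f'" "g' \<in> lset m UNIV" "pull m K Y = cls m g'"
      "\<forall>v \<in> conf m. dval m v g' = dval m (K v) f'" using K XY(2) by (rule pullE)
    have "pull m K (cls m (f * f')) = cls m (g * g')"
      by (rule pull_cls) (use fg fg' Kc in \<open>auto intro: lset_mult simp: dval_mult[of _ m _ UNIV]\<close>)
    then show "pull m K (X \<otimes>\<^bsub>G m\<^esub> Y) = pull m K X \<otimes>\<^bsub>G m\<^esub> pull m K Y"
      using fg fg' by (simp add: cls_mult)
    have "pull m K (cls m (f + f')) = cls m (g + g')"
      by (rule pull_cls) (use fg fg' Kc in \<open>auto intro: lset_add simp: leval_add\<close>)
    then show "pull m K (X \<oplus>\<^bsub>G m\<^esub> Y) = pull m K X \<oplus>\<^bsub>G m\<^esub> pull m K Y"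
      using fg fg' by (simp add: cls_add)
  next
    show "pull m K \<one>\<^bsub>G m\<^esub> = \<one>\<^bsub>G m\<^esub>"
      unfolding cls_one by (rule pull_cls) (use Kc in auto)
  qed
  moreover have "pull m K (c \<odot>\<^bsub>G m\<^esub> X) = c \<odot>\<^bsub>G m\<^esub> pull m K X" if X: "X \<in> carrier (G m)" for c X
  proof -
    obtain f g where fg: "f \<in> lset m UNIV" "X = cls m f" "g \<in> lset m UNIV" "pull m K X = cls m g"
      "\<forall>v \<in> conf m. dval m v g = dval m (K v) f" using K X by (rule pullE)
    have "pull m K (cls m (single 0 c * f)) = cls m (single 0 c * g)"
      by (rule pull_cls) (use fg Kc in \<open>auto intro: lset_mult simp: dval_mult[of _ m _ UNIV]\<close>)
    then show ?thesis using fg by (simp add: cls_smult)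
  qed
  ultimately show ?thesis by (simp add: alg_hom_def)
qed

text \<open>Precomposition is contravariant, hence the reversed order. Reversing the words in a
  braid or commutation relation gives the same relation again.\<close>

lemma pull_pull:
  assumes "alg_pullback m K" "alg_pullback m L" "X \<in> carrier (G m)"
  shows "pull m K (pull m L X) = pull m (\<lambda>v. L (K v)) X"
proof -
  have c: "\<And>v. v \<in> conf m \<Longrightarrow> K v \<in> conf m" "\<And>v. v \<in> conf m \<Longrightarrow> L v \<in> conf m"
    using assms(1,2) by (auto simp: alg_pullback_def)
  obtain f g where fg: "f \<in> lset m UNIV" "X = cls m f" "g \<in> lset m UNIV" "pull m L X = cls m g"
    "\<forall>v \<in> conf m. dval m v g = dval m (L v) f" using assms(2,3) by (rule pullE)
  obtain h where h: "h \<in> lset m UNIV" "\<forall>v \<in> conf m. dval m v h = dval m (K v) g"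
    using assms(1) fg(3) unfolding alg_pullback_def liftable_def by blast
  have "pull m K (cls m g) = cls m h" by (rule pull_cls) (use c fg h in auto)
  moreover have "pull m (\<lambda>v. L (K v)) (cls m f) = cls m h" by (rule pull_cls) (use c fg h in auto)
  ultimately show ?thesis using fg by simp
qed

lemma alg_pullback_comp:
  assumes "alg_pullback m K" "alg_pullback m L"
  shows "alg_pullback m (\<lambda>v. L (K v))"
  using assms unfolding alg_pullback_def liftable_def by (metis)

lemma pull_cong:
  assumes "alg_pullback m K" "\<And>v. v \<in> conf m \<Longrightarrow> K v = L v" "X \<in> carrier (G m)"
  shows "pull m K X = pull m L X"
proof -
  obtain f g where fg: "f \<in> lset m UNIV" "X = cls m f" "g \<in> lset m UNIV" "pull m K X = cls m g"
    "\<forall>v \<in> conf m. dval m v g = dval m (K v) f" using assms(1,3) by (rule pullE)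
  have "pull m L (cls m f) = cls m g"
  proof (rule pull_cls)
    fix v assume "v \<in> conf m"
    then show "L v \<in> conf m" "dval m v g = dval m (L v) f"
      using assms(1,2) fg(5) by (auto simp: alg_pullback_def)
  qed (use fg in auto)
  with fg show ?thesis by simp
qed

lemma pull_restrict:
  assumes "alg_pullback m K" "liftable m K (invars J) (invars J')" "X \<in> carrier (G_on m J)"
  shows "pull m K X \<in> carrier (G_on m J')"
proof -
  obtain f where f: "f \<in> lset m (invars J)" "X = cls m f" using assms(3) G_on_carrier by auto
  obtain g where g: "g \<in> lset m (invars J')" "\<forall>v \<in> conf m. dval m v g = dval m (K v) f"
    using assms(2) f unfolding liftable_def by blast
  have "pull m K (cls m f) = cls m g"
    by (rule pull_cls) (use assms(1) f g in \<open>auto simp: alg_pullback_def intro: lset_UNIV\<close>)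
  then show ?thesis using f g by (simp add: G_on_carrier)
qed

end

section \<open>Maps induced on the quotient\<close>

lemma gen_subalg_simps [simp]:
  "monoid.mult (gen_subalg A S) = monoid.mult A" "monoid.one (gen_subalg A S) = monoid.one A"
  "ring.zero (gen_subalg A S) = ring.zero A" "ring.add (gen_subalg A S) = ring.add A"
  "module.smult (gen_subalg A S) = module.smult A"
  by (simp_all add: gen_subalg_def)

definition shift :: "int \<Rightarrow> (int \<Rightarrow> complex vec) \<Rightarrow> int \<Rightarrow> complex vec" where
  "shift t v k = v (k + t)"

lemma map_upto_add: "map (\<lambda>k. k + t) [a..b] = [a + t..b + t :: int]"
proof (induction a b rule: upto.induct)
  case (1 a b)
  then show ?case by (cases "a \<le> b") (auto simp: upto_rec1 algebra_simps)
qed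

lemma Delta_shift: "Delta m xs (shift t v) = Delta m (map (\<lambda>k. k + t) xs) v"
  by (simp add: Delta_def shift_def[abs_def] comp_def)

lemma consec_shift: "xs \<in> consec m \<Longrightarrow> map (\<lambda>k. k + t) xs \<in> consec m"
proof -
  assume "xs \<in> consec m"
  then obtain a where "xs = [a..a + int m - 1]" by (auto simp: consec_def)
  then have "map (\<lambda>k. k + t) xs = [(a + t)..(a + t) + int m - 1]"
    by (simp add: map_upto_add algebra_simps)
  then show ?thesis unfolding consec_def by blast
qed

lemma tuples_shift: "xs \<in> tuples m \<Longrightarrow> map (\<lambda>k. k + t) xs \<in> tuples m"
  by (auto simp: tuples_def sorted_wrt_map)

definition induced :: "nat \<Rightarrow> (laurent set \<Rightarrow> laurent set) \<Rightarrow> laurent set set \<Rightarrow> laurent set set" where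
  "induced m \<phi> Z = bar_proj m (\<phi> (SOME x. x \<in> carrier (G m) \<and> bar_proj m x = Z))"

text \<open>The second condition puts the images of the generators P - 1 of
  \<open>bar_ideal m\<close> back into that ideal, so that the map descends to the quotient.\<close>

definition bar_compatible :: "nat \<Rightarrow> (laurent set \<Rightarrow> laurent set) \<Rightarrow> bool" where
  "bar_compatible m \<phi> \<longleftrightarrow> \<phi> \<in> alg_hom (G m) (G m) \<and>
    (\<forall>xs \<in> consec m. bar_proj m (\<phi> (Gvar m xs)) = \<one>\<^bsub>Gbar m\<^esub>)"

context
  fixes m :: nat
  assumes m: "m \<ge> 1"
begin

interpretation G: cring "G m" by (rule calg_cring[OF G_calg[OF m]])

lemma Gvar_closed: "xs \<in> tuples m \<Longrightarrow> Gvar m xs \<in> carrier (G m)"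
  using cls_closed[OF m, of "Lvar xs"] by (simp add: cls_var[OF m] lset_Lvar)

lemma bar_ideal_ideal: "ideal (bar_ideal m) (G m)"
  unfolding bar_ideal_def
  by (rule G.genideal_ideal) (auto intro!: G.minus_closed Gvar_closed consec_tuples)

interpretation B: ideal "bar_ideal m" "G m" by (rule bar_ideal_ideal)

lemma bar_proj_hom: "bar_proj m \<in> Ring.ring_hom (G m) (Gbar m)"
proof -
  have "bar_proj m = (+>\<^bsub>G m\<^esub>) (bar_ideal m)" by (simp add: fun_eq_iff bar_proj_def)
  then show ?thesis
    unfolding Gbar_def using quot_alg_hom[OF G_calg[OF m] bar_ideal_ideal] by simp
qed

lemma Gbar_calg: "calg (Gbar m)"
  unfolding Gbar_def by (rule quot_alg_calg[OF G_calg[OF m] bar_ideal_ideal])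

lemma Gbar_carrier: "carrier (Gbar m) = bar_proj m ` carrier (G m)"
  unfolding Gbar_def quot_alg_carrier by (simp add: bar_proj_def)

lemma bar_proj_smult:
  "x \<in> carrier (G m) \<Longrightarrow> c \<odot>\<^bsub>Gbar m\<^esub> bar_proj m x = bar_proj m (c \<odot>\<^bsub>G m\<^esub> x)"
  unfolding Gbar_def bar_proj_def by (rule quot_alg_smult[OF G_calg[OF m] bar_ideal_ideal])

lemmas bar_proj_mult = ring_hom_mult[OF bar_proj_hom]
lemmas bar_proj_add = ring_hom_add[OF bar_proj_hom]
lemmas bar_proj_one = ring_hom_one[OF bar_proj_hom]
lemmas bar_proj_closed = ring_hom_closed[OF bar_proj_hom]

lemma bar_proj_eq_iff:
  assumes "x \<in> carrier (G m)" "y \<in> carrier (G m)"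
  shows "bar_proj m x = bar_proj m y \<longleftrightarrow> x \<ominus>\<^bsub>G m\<^esub> y \<in> bar_ideal m"
  unfolding bar_proj_def using G.quotient_eq_iff_same_a_r_cos[OF bar_ideal_ideal assms] by simp

lemma bar_proj_consec:
  assumes "xs \<in> consec m" shows "bar_proj m (Gvar m xs) = \<one>\<^bsub>Gbar m\<^esub>"
proof -
  have "Gvar m xs \<ominus>\<^bsub>G m\<^esub> \<one>\<^bsub>G m\<^esub> \<in> bar_ideal m"
    unfolding bar_ideal_def
    by (rule subsetD[OF G.genideal_self])
      (use assms in \<open>auto intro!: G.minus_closed Gvar_closed consec_tuples\<close>)
  then have "bar_proj m (Gvar m xs) = bar_proj m \<one>\<^bsub>G m\<^esub>"
    using Gvar_closed[OF consec_tuples[OF assms]] by (subst bar_proj_eq_iff) auto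
  then show ?thesis by (simp add: bar_proj_one)
qed

lemma bar_cls_mult:
  assumes "f \<in> lset m UNIV" "g \<in> lset m UNIV"
  shows "bar_proj m (cls m (f * g)) = bar_proj m (cls m f) \<otimes>\<^bsub>Gbar m\<^esub> bar_proj m (cls m g)"
  using bar_proj_mult[of "cls m f" "cls m g"] cls_mult[OF m assms] cls_closed[OF m] assms by simp

lemma bar_proj_consec_inv:
  assumes "xs \<in> consec m" shows "bar_proj m (cls m (Lvar_inv xs)) = \<one>\<^bsub>Gbar m\<^esub>"
proof -
  interpret Gb: cring "Gbar m" by (rule calg_cring[OF Gbar_calg])
  have l: "Lvar xs \<in> lset m UNIV" "Lvar_inv xs \<in> lset m UNIV"
    using assms by (auto intro: lset_Lvar lset_Lvar_inv consec_tuples)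
  have "bar_proj m (cls m (Lvar xs * Lvar_inv xs)) = \<one>\<^bsub>Gbar m\<^esub>"
    using bar_proj_one by (simp add: cls_one[OF m])
  moreover have "bar_proj m (cls m (Lvar xs)) = \<one>\<^bsub>Gbar m\<^esub>"
    using bar_proj_consec[OF assms] by (simp add: cls_var[OF m])
  moreover have "bar_proj m (cls m (Lvar_inv xs)) \<in> carrier (Gbar m)"
    by (intro bar_proj_closed cls_closed[OF m] l)
  ultimately show ?thesis using bar_cls_mult[OF l] by simp
qed

lemma induced_bar:
  assumes \<phi>: "bar_compatible m \<phi>" and x: "x \<in> carrier (G m)"
  shows "induced m \<phi> (bar_proj m x) = bar_proj m (\<phi> x)"
proof -
  have hom: "\<phi> \<in> Ring.ring_hom (G m) (G m)" using \<phi> by (simp add: bar_compatible_def alg_hom_def)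
  interpret H: ring_hom_ring "G m" "G m" \<phi>
    by (rule ring_hom_ringI2[OF G.ring_axioms G.ring_axioms hom])
  \<comment> \<open>The preimage of an ideal under a homomorphism is an ideal, and this one contains
    the generators by compatibility.\<close>
  have "bar_ideal m \<subseteq> {r \<in> carrier (G m). \<phi> r \<in> bar_ideal m}"
  proof -
    have "{Gvar m xs \<ominus>\<^bsub>G m\<^esub> \<one>\<^bsub>G m\<^esub> | xs. xs \<in> consec m} \<subseteq> {r \<in> carrier (G m). \<phi> r \<in> bar_ideal m}"
    proof clarify
      fix xs assume xs: "xs \<in> consec m"
      then have c: "Gvar m xs \<in> carrier (G m)" by (intro Gvar_closed consec_tuples)
      have "\<phi> (Gvar m xs \<ominus>\<^bsub>G m\<^esub> \<one>\<^bsub>G m\<^esub>) = \<phi> (Gvar m xs) \<ominus>\<^bsub>G m\<^esub> \<one>\<^bsub>G m\<^esub>"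
        using c by (simp add: a_minus_def)
      moreover have "bar_proj m (\<phi> (Gvar m xs)) = bar_proj m \<one>\<^bsub>G m\<^esub>"
        using \<phi> xs by (simp add: bar_compatible_def bar_proj_one)
      ultimately show "Gvar m xs \<ominus>\<^bsub>G m\<^esub> \<one>\<^bsub>G m\<^esub> \<in> carrier (G m) \<and> \<phi> (Gvar m xs \<ominus>\<^bsub>G m\<^esub> \<one>\<^bsub>G m\<^esub>) \<in> bar_ideal m"
        using c bar_proj_eq_iff[of "\<phi> (Gvar m xs)" "\<one>\<^bsub>G m\<^esub>"] by simp
    qed
    then show ?thesis
      unfolding bar_ideal_def[of m]
      by (intro G.genideal_minimal H.ideal_vimage) (simp_all add: bar_ideal_def[symmetric] bar_ideal_ideal)
  qed
  moreover define y where "y = (SOME y. y \<in> carrier (G m) \<and> bar_proj m y = bar_proj m x)"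
  have y: "y \<in> carrier (G m) \<and> bar_proj m y = bar_proj m x"
    unfolding y_def by (rule someI[of _ x]) (use x in simp)
  ultimately have "\<phi> (y \<ominus>\<^bsub>G m\<^esub> x) \<in> bar_ideal m" using bar_proj_eq_iff[of y x] x by auto
  then have "\<phi> y \<ominus>\<^bsub>G m\<^esub> \<phi> x \<in> bar_ideal m" using x y by (simp add: a_minus_def)
  then have "bar_proj m (\<phi> y) = bar_proj m (\<phi> x)" using x y by (subst bar_proj_eq_iff) auto
  then show ?thesis by (simp add: induced_def y_def)
qed

lemma induced_alg_hom:
  assumes \<phi>: "bar_compatible m \<phi>"
  shows "induced m \<phi> \<in> alg_hom (Gbar m) (Gbar m)"
proof -
  have hom: "\<phi> \<in> Ring.ring_hom (G m) (G m)" and sm: "\<And>c x. x \<in> carrier (G m) \<Longrightarrow> \<phi> (c \<odot>\<^bsub>G m\<^esub> x) = c \<odot>\<^bsub>G m\<^esub> \<phi> x"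
    using \<phi> by (auto simp: bar_compatible_def alg_hom_def)
  note cl = ring_hom_closed[OF hom]
  have "induced m \<phi> \<in> Ring.ring_hom (Gbar m) (Gbar m)"
  proof (rule ring_hom_memI)
    fix X Y assume "X \<in> carrier (Gbar m)" "Y \<in> carrier (Gbar m)"
    then obtain x y where [simp]: "x \<in> carrier (G m)" "X = bar_proj m x" "y \<in> carrier (G m)" "Y = bar_proj m y"
      unfolding Gbar_carrier by auto
    show "induced m \<phi> (X \<otimes>\<^bsub>Gbar m\<^esub> Y) = induced m \<phi> X \<otimes>\<^bsub>Gbar m\<^esub> induced m \<phi> Y"
      by (simp add: bar_proj_mult[symmetric] induced_bar[OF \<phi>] cl ring_hom_mult[OF hom])
    show "induced m \<phi> (X \<oplus>\<^bsub>Gbar m\<^esub> Y) = induced m \<phi> X \<oplus>\<^bsub>Gbar m\<^esub> induced m \<phi> Y"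
      by (simp add: bar_proj_add[symmetric] induced_bar[OF \<phi>] cl ring_hom_add[OF hom])
  next
    fix X assume "X \<in> carrier (Gbar m)"
    then show "induced m \<phi> X \<in> carrier (Gbar m)"
      unfolding Gbar_carrier by (auto simp: induced_bar[OF \<phi>] cl)
  next
    show "induced m \<phi> \<one>\<^bsub>Gbar m\<^esub> = \<one>\<^bsub>Gbar m\<^esub>"
      by (simp add: bar_proj_one[symmetric] induced_bar[OF \<phi>] ring_hom_one[OF hom])
  qed
  moreover have "induced m \<phi> (c \<odot>\<^bsub>Gbar m\<^esub> X) = c \<odot>\<^bsub>Gbar m\<^esub> induced m \<phi> X" if X: "X \<in> carrier (Gbar m)" for c X
  proof -
    obtain x where "x \<in> carrier (G m)" "X = bar_proj m x" using X unfolding Gbar_carrier by auto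
    then show ?thesis
      by (simp add: bar_proj_smult induced_bar[OF \<phi>] cl sm calg_smult_closed[OF G_calg[OF m]])
  qed
  ultimately show ?thesis by (simp add: alg_hom_def)
qed

section \<open>The shift automorphism\<close>

lemma shift_conf: "v \<in> conf m \<Longrightarrow> shift t v \<in> conf m"
  using conf_consec_nz[of v m] consec_shift
  by (auto simp: conf_def Delta_shift shift_def consec_def) metis

lemma shift_pullback: "alg_pullback m (shift t)"
proof -
  have "liftable m (shift t) UNIV UNIV"
  proof (rule liftableI[OF m shift_conf])
    fix xs assume "xs \<in> tuples m"
    then show "\<exists>g \<in> lset m UNIV. \<forall>v \<in> conf m. dval m v g = Delta m xs (shift t v)"
      by (intro bexI[of _ "Lvar (map (\<lambda>k. k + t) xs)"]) (auto simp: Delta_shift intro: lset_Lvar tuples_shift)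
  next
    fix xs assume "xs \<in> consec m"
    then show "\<exists>g \<in> lset m UNIV. \<forall>v \<in> conf m. dval m v g = inverse (Delta m xs (shift t v))"
      by (intro bexI[of _ "Lvar_inv (map (\<lambda>k. k + t) xs)"]) (auto simp: Delta_shift intro: lset_Lvar_inv consec_shift)
  qed
  then show ?thesis using shift_conf by (simp add: alg_pullback_def)
qed

lemma pull_shift_var:
  assumes "xs \<in> tuples m"
  shows "pull m (shift t) (Gvar m xs) = Gvar m (map (\<lambda>k. k + t) xs)"
  unfolding cls_var[OF m, symmetric]
  by (rule pull_cls[OF m shift_conf]) (use assms in \<open>auto simp: Delta_shift intro: lset_Lvar tuples_shift\<close>)

lemma shift_compatible: "bar_compatible m (pull m (shift t))"
  unfolding bar_compatible_def
  using pull_alg_hom[OF m shift_pullback] pull_shift_var consec_tuples bar_proj_consec consec_shift by auto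

lemma pull_shift_shift:
  assumes "x \<in> carrier (G m)" "s + t = 0"
  shows "pull m (shift s) (pull m (shift t) x) = x"
proof -
  have "pull m (shift s) (pull m (shift t) x) = pull m (\<lambda>v. shift t (shift s v)) x"
    by (rule pull_pull[OF m shift_pullback shift_pullback assms(1)])
  also have "(\<lambda>v. shift t (shift s v)) = (\<lambda>v. v)"
    using assms(2) by (simp add: shift_def fun_eq_iff add.assoc add.commute[of t s])
  also have "pull m (\<lambda>v. v) x = x"
  proof -
    obtain f where f: "f \<in> lset m UNIV" "x = cls m f" using assms(1) G_carrier[OF m] by auto
    have "pull m (\<lambda>v. v) (cls m f) = cls m f" by (rule pull_cls[OF m]) (use f in auto)
    with f show ?thesis by simp
  qed
  finally show ?thesis .
qed

text \<open>The map induced by the shift satisfies the description of \<open>sh\<close>: the shift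
  by -t induces its inverse, and the values on the variables leave no other choice.\<close>

lemma sh_eq:
  assumes x: "x \<in> carrier (G m)"
  shows "sh m t (bar_proj m x) = bar_proj m (pull m (shift t) x)"
proof -
  let ?B = "Gbar m"
  define \<phi> where "\<phi> s = induced m (pull m (shift s))" for s
  have ph: "\<phi> s (bar_proj m y) = bar_proj m (pull m (shift s) y)" if "y \<in> carrier (G m)" for s y
    unfolding \<phi>_def by (rule induced_bar[OF shift_compatible that])
  have hom: "\<phi> s \<in> alg_hom ?B ?B" for s
    unfolding \<phi>_def by (rule induced_alg_hom[OF shift_compatible])
  have pc: "pull m (shift s) y \<in> carrier (G m)" if "y \<in> carrier (G m)" for s y
    using pull_alg_hom[OF m shift_pullback] that by (auto simp: alg_hom_def dest: ring_hom_closed)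
  have inv: "\<phi> s (\<phi> r z) = z" if "z \<in> carrier ?B" "s + r = 0" for s r z
    using that unfolding Gbar_carrier by (auto simp: ph pc pull_shift_shift)
  have bij: "bij_betw (\<phi> t) (carrier ?B) (carrier ?B)"
  proof (rule bij_betw_byWitness[of _ "\<phi> (- t)"])
    show "\<phi> t ` carrier ?B \<subseteq> carrier ?B" "\<phi> (- t) ` carrier ?B \<subseteq> carrier ?B"
      using hom by (auto simp: alg_hom_def dest: ring_hom_closed)
  qed (auto simp: inv)
  \<comment> \<open>The description asks for an extensional map, so \<open>induced\<close> has to be
    cut off outside the carrier.\<close>
  define \<psi> where "\<psi> = restrict (\<phi> t) (carrier ?B)"
  interpret Gb: cring ?B by (rule calg_cring[OF Gbar_calg])
  have "sh m t = \<psi>"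
    unfolding sh_def
  proof (rule the_equality, intro conjI ballI)
    have "\<psi> \<in> alg_hom ?B ?B"
      using hom[of t] calg_smult_closed[OF Gbar_calg]
      unfolding alg_hom_def Ring.ring_hom_def by (auto simp: \<psi>_def)
    moreover have "bij_betw \<psi> (carrier ?B) (carrier ?B)"
      using bij unfolding \<psi>_def by (simp add: bij_betw_restrict_eq)
    ultimately show "\<psi> \<in> alg_iso ?B ?B" by (simp add: alg_iso_def)
    show "\<psi> \<in> extensional (carrier ?B)" by (simp add: \<psi>_def)
    show "\<psi> (bar_proj m (Gvar m xs)) = bar_proj m (Gvar m (map (\<lambda>k. k + t) xs))" if "xs \<in> tuples m" for xs
      using that by (simp add: \<psi>_def bar_proj_closed Gvar_closed ph pull_shift_var)
  next
    fix \<chi> assume \<chi>: "\<chi> \<in> alg_iso ?B ?B \<and> \<chi> \<in> extensional (carrier ?B) \<and>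
      (\<forall>xs \<in> tuples m. \<chi> (bar_proj m (Gvar m xs)) = bar_proj m (Gvar m (map (\<lambda>k. k + t) xs)))"
    then have ch: "\<chi> \<in> Ring.ring_hom ?B ?B" "\<And>c x. x \<in> carrier ?B \<Longrightarrow> \<chi> (c \<odot>\<^bsub>?B\<^esub> x) = c \<odot>\<^bsub>?B\<^esub> \<chi> x"
      by (auto simp: alg_iso_def alg_hom_def)
    have th: "\<phi> t \<in> Ring.ring_hom ?B ?B" "\<And>c x. x \<in> carrier ?B \<Longrightarrow> \<phi> t (c \<odot>\<^bsub>?B\<^esub> x) = c \<odot>\<^bsub>?B\<^esub> \<phi> t x"
      using hom[of t] by (auto simp: alg_hom_def)
    have bp: "bar_proj m (cls m f) \<in> carrier ?B" if "f \<in> lset m UNIV" for f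
      using that by (intro bar_proj_closed cls_closed[OF m])
    have badd: "bar_proj m (cls m (f + g)) = bar_proj m (cls m f) \<oplus>\<^bsub>?B\<^esub> bar_proj m (cls m g)"
      if "f \<in> lset m UNIV" "g \<in> lset m UNIV" for f g
      using bar_proj_add[of "cls m f" "cls m g"] cls_add[OF m that] cls_closed[OF m] that by simp
    have bone: "bar_proj m (cls m 1) = \<one>\<^bsub>?B\<^esub>" using bar_proj_one by (simp add: cls_one[OF m])
    have bc: "bar_proj m (cls m (single 0 c)) = c \<odot>\<^bsub>?B\<^esub> \<one>\<^bsub>?B\<^esub>" for c
      using bar_proj_smult[of "\<one>\<^bsub>G m\<^esub>" c] bar_proj_one by (simp add: cls_const[OF m])
    have eq: "\<chi> (bar_proj m (cls m f)) = \<phi> t (bar_proj m (cls m f))" if f: "f \<in> lset m UNIV" for f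
      by (rule lset_hom_unique[OF Gb.monoid_axioms, of m UNIV "\<lambda>f. \<chi> (bar_proj m (cls m f))" "\<lambda>f. \<phi> t (bar_proj m (cls m f))"])
        (use f \<chi> in \<open>auto simp: badd bar_cls_mult bone bc bp ch(2) th(2) ring_hom_add[OF ch(1)] ring_hom_add[OF th(1)]
          ring_hom_mult[OF ch(1)] ring_hom_mult[OF th(1)] ring_hom_one[OF ch(1)] ring_hom_one[OF th(1)]
          ring_hom_closed[OF ch(1)] ring_hom_closed[OF th(1)] cls_var[OF m] ph Gvar_closed pull_shift_var\<close>)
    show "\<chi> = \<psi>"
    proof (rule extensionalityI[of _ "carrier ?B"])
      fix z assume "z \<in> carrier ?B"
      then obtain f where "f \<in> lset m UNIV" "z = bar_proj m (cls m f)"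
        unfolding Gbar_carrier G_carrier[OF m] by auto
      then show "\<chi> z = \<psi> z" using eq bp by (simp add: \<psi>_def)
    qed (use \<chi> in \<open>auto simp: \<psi>_def\<close>)
  qed
  then show ?thesis using x by (simp add: \<psi>_def ph bar_proj_closed)
qed

end

section \<open>The Fraser map on the algebra\<close>

text \<open>The indices \<open>J'\<close> on which the image of a Pluecker coordinate with indices in \<open>J\<close> depends.\<close>

definition reaches :: "nat \<Rightarrow> nat \<Rightarrow> int set \<Rightarrow> int set \<Rightarrow> bool" where
  "reaches m i J J' \<longleftrightarrow> (\<forall>k \<in> J. {k..k + int m + 1} \<subseteq> J' \<and> (int m dvd k - int i - 1 \<longrightarrow> k - 1 \<in> J'))"

context
  fixes m i :: nat
  assumes m2: "m \<ge> 2" and i: "i \<in> {1..m - 1}"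
begin

lemma one_le_m: "m \<ge> 1" using m2 by simp

text \<open>Columns are expanded one at a time: \<open>ls\<close> holds original vectors,
  \<open>xs\<close> the positions still to be expanded. The second member of a pair is a combination
  of two original vectors, so linearity in that column leaves two determinants with one position
  less.\<close>

lemma fraser_columns:
  assumes J: "reaches m i J J'"
  shows "set xs \<subseteq> J \<Longrightarrow> set ls \<subseteq> J' \<Longrightarrow> length ls + length xs = m \<Longrightarrow>
    \<exists>g \<in> lset m (invars J'). \<forall>v \<in> conf m. dval m v g = cdet m (map v ls @ map (fraser_map m i v) xs)"
proof (induction xs arbitrary: ls)
  case Nil
  then have len: "length ls = m" by simp
  show ?case
    by (intro bexI[of _ "psym ls"] ballI lset_psym len)
      (use Nil leval_psym[OF len] in \<open>auto simp: Delta_def[of m ls] invars_def\<close>)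
next
  case (Cons x xs)
  then have x: "{x..x + int m + 1} \<subseteq> J'" "int m dvd x - int i - 1 \<longrightarrow> x - 1 \<in> J'"
    using J by (auto simp: reaches_def)
  have IH: "\<exists>g \<in> lset m (invars J'). \<forall>v \<in> conf m.
    dval m v g = cdet m (map v ls @ v l # map (fraser_map m i v) xs)" if "l \<in> J'" for l
    using Cons.IH[of "ls @ [l]"] Cons.prems that by simp
  consider "int m dvd x - int i" | "\<not> int m dvd x - int i" "int m dvd x - int i - 1"
    | "\<not> int m dvd x - int i" "\<not> int m dvd x - int i - 1" by blast
  then show ?case
  proof cases
    case 1
    have "x + 1 \<in> J'" using x m2 by auto
    from IH[OF this] show ?thesis by (simp add: fraser_map_first[OF 1])
  next
    case 3
    then have "fraser_map m i v x = v x" for v by (simp add: fraser_map_def)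
    moreover have "x \<in> J'" using x m2 by auto
    ultimately show ?thesis using IH[of x] by simp
  next
    case 2
    define a where "a = x - 1"
    have xa: "x = a + 1" by (simp add: a_def)
    have a: "int m dvd a - int i" using 2 by (simp add: a_def algebra_simps)
    have aJ: "a \<in> J'" "{a + 1..a + int m} \<subseteq> J'" using x 2 by (auto simp: a_def)
    obtain g1 where g1: "g1 \<in> lset m (invars J')"
      "\<forall>v \<in> conf m. dval m v g1 = cdet m (map v ls @ v x # map (fraser_map m i v) xs)"
    proof -
      have "x \<in> J'" using x(1) by auto
      from IH[OF this] show ?thesis using that by blast
    qed
    obtain g2 where g2: "g2 \<in> lset m (invars J')"
      "\<forall>v \<in> conf m. dval m v g2 = cdet m (map v ls @ v a # map (fraser_map m i v) xs)"
      using IH[of a] aJ(1) by auto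
    \<comment> \<open>The denominator of the coefficient is a consecutive minor, so its inverse is
      available in the ring.\<close>
    define c where "c = psym (a # [a + 2..a + int m]) * Lvar_inv [a + 1..a + int m]"
    have len: "length (a # [a + 2..a + int m]) = m" using m2 by simp
    have c1: "psym (a # [a + 2..a + int m]) \<in> lset m (invars J')"
    proof (rule lset_psym[OF len])
      have "set (a # [a + 2..a + int m]) \<subseteq> J'" using aJ by auto
      then show "sort (a # [a + 2..a + int m]) \<in> invars J'" by (simp only: invars_def mem_Collect_eq set_sort)
    qed
    have c2: "Lvar_inv [a + 1..a + int m] \<in> lset m (invars J')"
      by (rule lset_Lvar_inv) (use aJ in \<open>auto simp: invars_def consec_def intro: exI[of _ "a + 1"]\<close>)
    have c: "c \<in> lset m (invars J')" unfolding c_def by (rule lset_mult[OF c1 c2])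
    have cv: "dval m v c = fraser_coeff m v a" if "v \<in> conf m" for v
      unfolding c_def dval_mult[OF that c1 c2] leval_psym[OF len]
      by (simp add: fraser_coeff_def divide_inverse)
    show ?thesis
    proof (intro bexI[of _ "c * g1 - g2"] lset_diff lset_mult c g1(1) g2(1) ballI)
      fix v assume v: "v \<in> conf m"
      let ?ys = "map (fraser_map m i v) xs"
      have "cdet m (map v ls @ map (fraser_map m i v) (x # xs))
          = cdet m (map v ls @ (fraser_coeff m v a \<cdot>\<^sub>v v x - v a) # ?ys)"
        using fraser_map_second[OF a m2 xa] by simp
      also have "\<dots> = fraser_coeff m v a * cdet m (map v ls @ v x # ?ys) - cdet m (map v ls @ v a # ?ys)"
        by (rule cdet_lincomb) (use Cons.prems conf_carrier[OF v] in auto)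
      finally show "dval m v (c * g1 - g2) = cdet m (map v ls @ map (fraser_map m i v) (x # xs))"
        using v g1 g2 by (simp add: leval_diff dval_mult[OF v c g1(1)] cv)
    qed
  qed
qed

text \<open>Solved for the new minor, the exchange relation shows it to be a Laurent monomial in
  consecutive minors, hence a unit; this gives the lift of its inverse as well.\<close>

lemma fraser_window_value:
  assumes v: "v \<in> conf m" and b: "int m dvd b - int i - 1"
  shows "Delta m [b..b + int m - 1] (fraser_map m i v) =
    Delta m [b - 1..b + int m - 2] v * Delta m [b + 1..b + int m] v * inverse (Delta m [b..b + int m - 1] v)"
proof -
  have a: "int m dvd (b - 1) - int i" using b by (simp add: algebra_simps)
  have "Delta m [b..b + int m - 1] (fraser_map m i v) * Delta m [b..b + int m - 1] v
      = Delta m [b - 1..b + int m - 2] v * Delta m [b + 1..b + int m] v"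
    using fraser_window_special[OF m2 v a] by (simp add: algebra_simps)
  moreover have "Delta m [b..b + int m - 1] v \<noteq> 0" using conf_nz[OF v] by simp
  ultimately show ?thesis by (simp add: field_simps)
qed

lemma consec_windows:
  "[b..b + int m - 1] \<in> consec m" "[b - 1..b + int m - 2] \<in> consec m" "[b + 1..b + int m] \<in> consec m"
  unfolding consec_def
  by (auto intro: exI[of _ b] exI[of _ "b - 1"] exI[of _ "b + 1"])

lemma fraser_liftable:
  assumes J: "reaches m i J J'"
  shows "liftable m (fraser_map m i) (invars J) (invars J')"
proof (rule liftableI[OF one_le_m fraser_map_conf[OF m2]])
  fix xs assume "xs \<in> tuples m" "xs \<in> invars J"
  then have "set xs \<subseteq> J" "length ([] :: int list) + length xs = m" by (auto simp: tuples_def invars_def)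
  from fraser_columns[OF J this(1) _ this(2)]
  show "\<exists>g \<in> lset m (invars J'). \<forall>v \<in> conf m. dval m v g = Delta m xs (fraser_map m i v)"
    by (simp add: Delta_def[of m xs])
next
  fix xs assume xs: "xs \<in> consec m" "xs \<in> invars J"
  then obtain b where b: "xs = [b..b + int m - 1]" by (auto simp: consec_def)
  then have bJ: "b \<in> J" using xs m2 by (auto simp: invars_def)
  have Jb: "{b..b + int m + 1} \<subseteq> J'" using J bJ by (simp add: reaches_def)
  then have J': "set xs \<subseteq> J'" by (auto simp: b)
  show "\<exists>g \<in> lset m (invars J'). \<forall>v \<in> conf m. dval m v g = inverse (Delta m xs (fraser_map m i v))"
  proof (cases "int m dvd b - int i - 1")
    case False
    show ?thesis
    proof (intro bexI[of _ "Lvar_inv xs"] ballI)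
      show "Lvar_inv xs \<in> lset m (invars J')" using xs J' by (intro lset_Lvar_inv) (auto simp: invars_def)
      fix v assume "v \<in> conf m"
      from fraser_window[OF m2 conf_carrier[OF this] False]
      show "dval m v (Lvar_inv xs) = inverse (Delta m xs (fraser_map m i v))" by (simp add: b)
    qed
  next
    case True
    have s: "{b - 1..b + int m} \<subseteq> J'"
    proof
      fix k assume "k \<in> {b - 1..b + int m}"
      then have "k = b - 1 \<or> k \<in> {b..b + int m + 1}" by auto
      moreover have "b - 1 \<in> J'" using J bJ True by (simp add: reaches_def)
      ultimately show "k \<in> J'" using Jb by blast
    qed
    let ?l1 = "Lvar xs" and ?l2 = "Lvar_inv [b - 1..b + int m - 2]" and ?l3 = "Lvar_inv [b + 1..b + int m]"
    have l: "?l1 \<in> lset m (invars J')" "?l2 \<in> lset m (invars J')" "?l3 \<in> lset m (invars J')"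
      using s xs(1) by (auto intro!: lset_Lvar lset_Lvar_inv consec_windows consec_tuples simp: invars_def b)
    show ?thesis
    proof (intro bexI[of _ "?l1 * (?l2 * ?l3)"] ballI lset_mult l)
      fix v assume v: "v \<in> conf m"
      show "dval m v (?l1 * (?l2 * ?l3)) = inverse (Delta m xs (fraser_map m i v))"
        unfolding dval_mult[OF v l(1) lset_mult[OF l(2,3)]] dval_mult[OF v l(2,3)]
        using fraser_window_value[OF v True] by (simp add: b)
    qed
  qed
qed

lemma fraser_pullback: "alg_pullback m (fraser_map m i)"
proof -
  have "liftable m (fraser_map m i) (invars UNIV) (invars UNIV)"
    by (rule fraser_liftable) (simp add: reaches_def)
  moreover have "invars UNIV = UNIV" by (simp add: invars_def)
  ultimately show ?thesis using fraser_map_conf[OF m2] by (simp add: alg_pullback_def)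
qed

text \<open>A consecutive minor is either fixed or replaced by a Laurent monomial in consecutive
  minors, and in \<open>Gbar m\<close> all of these are 1.\<close>

lemma fraser_compatible: "bar_compatible m (pull m (fraser_map m i))"
  unfolding bar_compatible_def
proof (intro conjI ballI pull_alg_hom[OF one_le_m fraser_pullback])
  fix xs assume xs: "xs \<in> consec m"
  then obtain b where b: "xs = [b..b + int m - 1]" by (auto simp: consec_def)
  have xl: "Lvar xs \<in> lset m UNIV" using xs by (intro lset_Lvar consec_tuples) auto
  note pc = pull_cls[OF one_le_m fraser_map_conf[OF m2] xl]
  show "bar_proj m (pull m (fraser_map m i) (Gvar m xs)) = \<one>\<^bsub>Gbar m\<^esub>"
  proof (cases "int m dvd b - int i - 1")
    case False
    have "pull m (fraser_map m i) (cls m (Lvar xs)) = cls m (Lvar xs)"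
    proof (rule pc[OF _ xl])
      fix v assume "v \<in> conf m"
      from fraser_window[OF m2 conf_carrier[OF this] False]
      show "dval m v (Lvar xs) = dval m (fraser_map m i v) (Lvar xs)" by (simp add: b)
    qed
    then show ?thesis using bar_proj_consec[OF one_le_m xs] by (simp add: cls_var[OF one_le_m])
  next
    case True
    let ?l1 = "Lvar [b - 1..b + int m - 2]" and ?l2 = "Lvar [b + 1..b + int m]" and ?l3 = "Lvar_inv xs"
    have l: "?l1 \<in> lset m UNIV" "?l2 \<in> lset m UNIV" "?l3 \<in> lset m UNIV"
      using xs by (auto intro!: lset_Lvar lset_Lvar_inv consec_windows consec_tuples)
    have "pull m (fraser_map m i) (cls m (Lvar xs)) = cls m (?l1 * ?l2 * ?l3)"
    proof (rule pc[OF _ lset_mult[OF lset_mult[OF l(1,2)] l(3)]])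
      fix v assume v: "v \<in> conf m"
      show "dval m v (?l1 * ?l2 * ?l3) = dval m (fraser_map m i v) (Lvar xs)"
        unfolding dval_mult[OF v lset_mult[OF l(1,2)] l(3)] dval_mult[OF v l(1,2)]
        using fraser_window_value[OF v True] by (simp add: b)
    qed
    moreover have "bar_proj m (cls m (?l1 * ?l2 * ?l3)) = \<one>\<^bsub>Gbar m\<^esub>"
    proof -
      interpret Gb: cring "Gbar m" by (rule calg_cring[OF Gbar_calg[OF one_le_m]])
      show ?thesis
        using bar_proj_consec[OF one_le_m] bar_proj_consec_inv[OF one_le_m xs] consec_windows
        by (simp add: bar_cls_mult[OF one_le_m] lset_mult l cls_var[OF one_le_m])
    qed
    ultimately show ?thesis by (simp add: cls_var[OF one_le_m])
  qed
qed

end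

section \<open>Coordinate rings of Grassmannians\<close>

text \<open>The cyclic conditions of \<open>config\<close> become the window conditions of
  \<open>conf\<close>. No sign or twist enters at the seam, in agreement with the cyclic indices in
  \<open>kappa\<close>.\<close>

definition periodic :: "nat \<Rightarrow> (int \<Rightarrow> complex vec) \<Rightarrow> int \<Rightarrow> complex vec" where
  "periodic N v k = v (cyc N k)"

lemma cyc_range: "N > 0 \<Longrightarrow> cyc N k \<in> {1..int N}"
  by (simp add: cyc_def) (smt (verit) pos_mod_bound of_nat_0_less_iff)

lemma cyc_id: "k \<in> {1..int N} \<Longrightarrow> cyc N k = k"
  by (simp add: cyc_def)

lemma cyc_map_id: "set xs \<subseteq> {1..int N} \<Longrightarrow> map (cyc N) xs = xs"
  by (auto intro!: map_idI cyc_id)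

lemma cyc_dvd: "int N dvd k - cyc N k"
  using dvd_minus_mod[of "int N" "k - 1"] by (simp add: cyc_def algebra_simps)

lemma cyc_cong: "int N dvd k - l \<Longrightarrow> cyc N k = cyc N l"
  using mod_eq_dvd_iff[of "k - 1" "int N" "l - 1"] by (simp add: cyc_def)

lemma Delta_periodic: "Delta m xs (periodic N v) = Delta m (map (cyc N) xs) v"
  by (simp add: Delta_def periodic_def[abs_def] comp_def)

definition coord :: "nat \<Rightarrow> nat \<Rightarrow> laurent \<Rightarrow> (int \<Rightarrow> complex vec) \<Rightarrow> complex" where
  "coord m N f = (\<lambda>v \<in> config m N. dval m (periodic N v) f)"

lemma fun_alg_ring: "ring (fun_alg X)"
proof (rule ringI)
  show "abelian_group (fun_alg X)"
  proof (rule abelian_groupI)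
    fix f assume "f \<in> carrier (fun_alg X)"
    then show "\<exists>g \<in> carrier (fun_alg X). g \<oplus>\<^bsub>fun_alg X\<^esub> f = \<zero>\<^bsub>fun_alg X\<^esub>"
      by (intro bexI[of _ "\<lambda>x \<in> X. - f x"]) (auto simp: fun_alg_def fun_eq_iff)
  qed (auto simp: fun_alg_def fun_eq_iff PiE_def extensional_def algebra_simps)
  show "Group.monoid (fun_alg X)"
    by (rule monoidI) (auto simp: fun_alg_def fun_eq_iff PiE_def extensional_def algebra_simps)
qed (auto simp: fun_alg_def fun_eq_iff PiE_def extensional_def algebra_simps)

lemma leval_cong_lset:
  assumes "f \<in> lset m V" "\<And>xs. xs \<in> tuples m \<Longrightarrow> xs \<in> V \<Longrightarrow> z xs = w xs"
  shows "leval z f = leval w f"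
  unfolding leval_def monom_eval_def
proof (intro sum.cong refl arg_cong2[where f = "(*)"] prod.cong)
  fix \<mu> xs assume "\<mu> \<in> keys f" "xs \<in> keys \<mu>"
  then have "xs \<in> tuples m" "xs \<in> V" using assms(1) by (auto simp: lset_def good_monom_def)
  then show "z xs powi lookup \<mu> xs = w xs powi lookup \<mu> xs"
    using assms(2) by simp
qed

context
  fixes m N :: nat
  assumes m: "m \<ge> 1" and N: "N \<ge> m"
begin

lemma N_pos: "N > 0" using m N by simp

lemma periodic_conf:
  assumes "v \<in> config m N" shows "periodic N v \<in> conf m"
  using assms cyc_range[OF N_pos] by (auto simp: config_def conf_def Delta_periodic periodic_def)

lemma coord_add: "coord m N (f + g) = coord m N f \<oplus>\<^bsub>fun_alg (config m N)\<^esub> coord m N g"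
  by (auto simp: coord_def fun_alg_def leval_add)

lemma coord_mult:
  "f \<in> lset m UNIV \<Longrightarrow> g \<in> lset m UNIV \<Longrightarrow> coord m N (f * g) = coord m N f \<otimes>\<^bsub>fun_alg (config m N)\<^esub> coord m N g"
  by (auto simp: coord_def fun_alg_def dval_mult[OF periodic_conf, of _ _ UNIV])

lemma coord_one: "coord m N 1 = \<one>\<^bsub>fun_alg (config m N)\<^esub>"
  by (auto simp: coord_def fun_alg_def)

lemma coord_smult:
  "f \<in> lset m UNIV \<Longrightarrow> coord m N (single 0 c * f) = c \<odot>\<^bsub>fun_alg (config m N)\<^esub> coord m N f"
  by (auto simp: coord_def fun_alg_def dval_mult[OF periodic_conf, of _ _ UNIV])

lemma coord_hom: "coord m N \<in> Ring.ring_hom (laurent_alg m) (fun_alg (config m N))"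
proof (rule ring_hom_memI)
  show "coord m N f \<in> carrier (fun_alg (config m N))" for f
    by (simp add: coord_def fun_alg_def)
qed (simp_all add: carrier_laurent coord_add coord_mult coord_one)

lemma coord_diamond_carrier: "carrier (coord_diamond m N) = coord m N ` lset m (invars {1..int N})"
  unfolding coord_diamond_def
proof (rule gen_subalg_image[OF fun_alg_ring coord_hom])
  show "coord m N (single 0 c) = c \<odot>\<^bsub>fun_alg (config m N)\<^esub> \<one>\<^bsub>fun_alg (config m N)\<^esub>" for c
    using coord_smult[of 1 c] by (simp add: coord_one)
  have 1: "(\<lambda>v\<in>config m N. Delta m xs v) = coord m N (Lvar xs)"
    "(\<lambda>v\<in>config m N. inverse (Delta m xs v)) = coord m N (Lvar_inv xs)" if "set xs \<subseteq> {1..int N}" for xs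
    by (auto simp: coord_def Delta_periodic cyc_map_id[OF that])
  have 2: "{\<lambda>v\<in>config m N. Delta m xs v |xs. xs \<in> tuples m \<and> set xs \<subseteq> {1..int N}}
    = (\<lambda>xs. \<lambda>v\<in>config m N. Delta m xs v) ` (tuples m \<inter> invars {1..int N})"
    "{\<lambda>v\<in>config m N. inverse (Delta m xs v) |xs. xs \<in> consec m \<and> set xs \<subseteq> {1..int N}}
    = (\<lambda>xs. \<lambda>v\<in>config m N. inverse (Delta m xs v)) ` (consec m \<inter> invars {1..int N})"
    by (auto simp: invars_def)
  show "{\<lambda>v\<in>config m N. Delta m xs v |xs. xs \<in> tuples m \<and> set xs \<subseteq> {1..int N}} \<union>
    {\<lambda>v\<in>config m N. inverse (Delta m xs v) |xs. xs \<in> consec m \<and> set xs \<subseteq> {1..int N}} =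
    (\<lambda>xs. coord m N (Lvar xs)) ` (tuples m \<inter> invars {1..int N}) \<union>
    (\<lambda>xs. coord m N (Lvar_inv xs)) ` (consec m \<inter> invars {1..int N})"
    unfolding 2 by (intro arg_cong2[where f = "(\<union>)"] image_cong refl 1) (auto simp: invars_def)
qed

lemma coord_diamond_subset: "carrier (coord_diamond m N) \<subseteq> carrier (coord_circ m N)"
proof -
  interpret F: ring "fun_alg (config m N)" by (rule fun_alg_ring)
  have one: "c \<odot>\<^bsub>fun_alg (config m N)\<^esub> \<one>\<^bsub>fun_alg (config m N)\<^esub> \<in> carrier (fun_alg (config m N))" for c
    by (simp add: fun_alg_def)
  have "\<exists>ys. (\<lambda>v\<in>config m N. inverse (Delta m xs v)) =
      (\<lambda>v\<in>config m N. inverse (Delta m (map (cyc N) ys) v)) \<and> ys \<in> consec m"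
    if "xs \<in> consec m" "set xs \<subseteq> {1..int N}" for xs
    using that by (intro exI[of _ xs]) (simp add: cyc_map_id)
  moreover have "(\<lambda>v\<in>config m N. h v) \<in> carrier (fun_alg (config m N))" for h
    by (simp add: fun_alg_def)
  ultimately show ?thesis
    unfolding coord_diamond_def coord_circ_def gen_subalg_def
    by (simp, intro F.mono_generate_ring) (use one in blast)+
qed

text \<open>The restriction of a point of \<open>conf m\<close> to [1, N] may fail the cyclic
  conditions across the seam. Since f and g invert only minors with windows inside [1, N], which are
  nonzero on \<open>conf m\<close>, density with the cyclic windows as conditions closes this
  gap.\<close>

lemma coord_inj:
  assumes f: "f \<in> lset m (invars {1..int N})" and g: "g \<in> lset m (invars {1..int N})"
    and eq: "coord m N f = coord m N g"
  shows "cls m f = cls m g"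
proof -
  define h where "h = f - g"
  have h: "h \<in> lset m (invars {1..int N})" unfolding h_def by (rule lset_diff[OF f g])
  have keys: "xs \<in> tuples m \<inter> invars {1..int N} \<and> (xs \<notin> consec m \<longrightarrow> lookup \<mu> xs \<ge> 0)"
    if "\<mu> \<in> keys h" "xs \<in> keys \<mu>" for \<mu> xs
    using h that by (auto simp: lset_def good_monom_def)
  define W where "W = range (\<lambda>a. map (cyc N) [a..a + int m - 1])"
  have "dval m v h = 0" if v: "v \<in> conf m" for v
  proof (rule density[of v m W])
    show "countable W" by (simp add: W_def)
    show "length w = m \<and> distinct w" if "w \<in> W" for w
    proof -
      obtain a where w: "w = map (cyc N) [a..a + int m - 1]" using \<open>w \<in> W\<close> by (auto simp: W_def)
      \<comment> \<open>As N is at least m, a window does not overlap itself modulo N; a repeated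
        index would make its minor vanish identically.\<close>
      have "inj_on (cyc N) (set [a..a + int m - 1])"
      proof (rule inj_onI)
        fix k l assume kl: "k \<in> set [a..a + int m - 1]" "l \<in> set [a..a + int m - 1]" "cyc N k = cyc N l"
        then have "int N dvd (k - cyc N k) - (l - cyc N l)" by (intro dvd_diff cyc_dvd)
        then have "int N dvd k - l" using kl by simp
        moreover have "\<bar>k - l\<bar> < int N" using kl(1,2) N by auto
        ultimately show "k = l" using not_dvd_small[of "k - l" N] by auto
      qed
      then show ?thesis by (simp add: w distinct_map)
    qed
    show "length xs = m \<and> (lookup \<mu> xs \<ge> 0 \<or> Delta m xs v \<noteq> 0)"
      if "\<mu> \<in> keys h" "xs \<in> keys \<mu>" for \<mu> xs
      using keys[OF that] conf_consec_nz[OF v] by (auto simp: tuples_def)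
    fix v' :: "int \<Rightarrow> complex vec"
    assume v': "\<And>k. v' k \<in> carrier_vec m" "\<And>w. w \<in> W \<Longrightarrow> Delta m w v' \<noteq> 0"
    \<comment> \<open>Only the vectors in [1, N] matter for h, so v' may be replaced by the periodic
      extension of its restriction.\<close>
    define u where "u = restrict v' {1..int N}"
    have up: "periodic N u k = v' (cyc N k)" for k
      using cyc_range[OF N_pos, of k] by (simp add: periodic_def u_def)
    have Du: "Delta m (map (cyc N) xs) u = Delta m (map (cyc N) xs) v'" for xs
      using cyc_range[OF N_pos] by (simp add: Delta_def u_def comp_def)
    have uc: "u \<in> config m N"
      using v' by (auto simp: config_def Du W_def) (auto simp: u_def)
    have "dval m v' h = dval m (periodic N u) h"
    proof (rule leval_cong_lset[OF h])
      fix xs assume "xs \<in> invars {1..int N}"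
      then have e: "map (cyc N) xs = xs" by (intro cyc_map_id) (simp add: invars_def)
      show "Delta m xs v' = Delta m xs (periodic N u)"
        using Du[of xs] by (simp add: Delta_periodic e)
    qed
    also have "\<dots> = 0"
      using fun_cong[OF eq, of u] uc by (simp add: coord_def h_def leval_diff)
    finally show "dval m v' h = 0" .
  qed (use conf_carrier[OF v] in auto)
  then show ?thesis
    using lset_UNIV[OF f] lset_UNIV[OF g] by (auto simp: cls_eq_iff[OF m] h_def leval_diff)
qed

lemma coord_cls_eq:
  assumes "f \<in> lset m UNIV" "g \<in> lset m UNIV" "cls m f = cls m g"
  shows "coord m N f = coord m N g"
  using assms periodic_conf by (auto simp: coord_def cls_eq_iff[OF m])

text \<open>The map in the description of \<open>to_coord\<close> evaluates any representative on
  periodic extensions. Injectivity is \<open>coord_inj\<close>, surjectivity holds because both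
  sides are images of the same ring, and uniqueness follows from the values on the
  variables.\<close>

lemma to_coord_props:
  shows to_coord_cls: "f \<in> lset m (invars {1..int N}) \<Longrightarrow> to_coord m N (cls m f) = coord m N f"
    and to_coord_bij: "bij_betw (to_coord m N) (carrier (Gfin m N)) (carrier (coord_diamond m N))"
proof -
  let ?V = "invars {1..int N}" and ?F = "fun_alg (config m N)"
  interpret F: ring ?F by (rule fun_alg_ring)
  have Gc: "carrier (Gfin m N) = cls m ` lset m ?V" unfolding Gfin_def by (rule G_on_carrier[OF m])
  have Gops: "monoid.mult (Gfin m N) = monoid.mult (G m)" "ring.add (Gfin m N) = ring.add (G m)"
    "monoid.one (Gfin m N) = monoid.one (G m)" "module.smult (Gfin m N) = module.smult (G m)"
    by (simp_all add: Gfin_def G_on_def)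
  have Cops: "monoid.mult (coord_diamond m N) = monoid.mult ?F" "ring.add (coord_diamond m N) = ring.add ?F"
    "monoid.one (coord_diamond m N) = monoid.one ?F" "module.smult (coord_diamond m N) = module.smult ?F"
    by (simp_all add: coord_diamond_def)
  note U = lset_UNIV
  define \<phi> where "\<phi> = (\<lambda>X \<in> carrier (Gfin m N). coord m N (SOME f. f \<in> lset m ?V \<and> cls m f = X))"
  have \<phi>: "\<phi> (cls m f) = coord m N f" if f: "f \<in> lset m ?V" for f
  proof -
    define g where "g = (SOME g. g \<in> lset m ?V \<and> cls m g = cls m f)"
    have "g \<in> lset m ?V \<and> cls m g = cls m f"
      unfolding g_def by (rule someI[of "\<lambda>g. g \<in> lset m ?V \<and> cls m g = cls m f"]) (use f in simp)
    then have "coord m N g = coord m N f" using f U by (intro coord_cls_eq) auto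
    then show ?thesis using f by (simp add: \<phi>_def Gc g_def)
  qed
  have bij: "bij_betw \<phi> (carrier (Gfin m N)) (carrier (coord_diamond m N))"
    unfolding bij_betw_def
  proof
    show "inj_on \<phi> (carrier (Gfin m N))"
    proof (rule inj_onI)
      fix X Y assume XY: "X \<in> carrier (Gfin m N)" "Y \<in> carrier (Gfin m N)" "\<phi> X = \<phi> Y"
      obtain f where f: "f \<in> lset m ?V" "X = cls m f" using XY(1) by (auto simp: Gc)
      obtain g where g: "g \<in> lset m ?V" "Y = cls m g" using XY(2) by (auto simp: Gc)
      have "coord m N f = coord m N g" using XY(3) by (simp add: f g \<phi>)
      then show "X = Y" using coord_inj[OF f(1) g(1)] f(2) g(2) by blast
    qed
    show "\<phi> ` carrier (Gfin m N) = carrier (coord_diamond m N)"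
      unfolding Gc coord_diamond_carrier image_image by (rule image_cong) (simp_all add: \<phi>)
  qed
  have "to_coord m N = \<phi>"
    unfolding to_coord_def
  proof (rule the_equality, intro conjI ballI impI)
    have "\<phi> \<in> Ring.ring_hom (Gfin m N) (coord_diamond m N)"
      by (rule ring_hom_memI)
        (auto simp: Gc Gops Cops coord_diamond_carrier \<phi> cls_mult[OF m] cls_add[OF m] cls_one[OF m] U
          lset_mult lset_add coord_add coord_mult coord_one)
    moreover have "\<phi> (c \<odot>\<^bsub>Gfin m N\<^esub> X) = c \<odot>\<^bsub>coord_diamond m N\<^esub> \<phi> X" if X: "X \<in> carrier (Gfin m N)" for c X
    proof -
      obtain f where f: "f \<in> lset m ?V" "X = cls m f" using X by (auto simp: Gc)
      have "\<phi> (cls m (single 0 c * f)) = coord m N (single 0 c * f)"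
        by (intro \<phi> lset_mult lset_const f)
      with f show ?thesis by (simp add: Gops Cops cls_smult[OF m U] \<phi> coord_smult[OF U])
    qed
    ultimately show "\<phi> \<in> alg_iso (Gfin m N) (coord_diamond m N)"
      using bij by (simp add: alg_iso_def alg_hom_def)
    show "\<phi> \<in> extensional (carrier (Gfin m N))" by (simp add: \<phi>_def)
    fix xs assume xs: "xs \<in> tuples m" "set xs \<subseteq> {1..int N}"
    then have "\<phi> (cls m (Lvar xs)) = coord m N (Lvar xs)" by (intro \<phi> lset_Lvar) (auto simp: invars_def)
    also have "\<dots> = (\<lambda>v\<in>config m N. Delta m xs v)"
      by (auto simp: coord_def Delta_periodic cyc_map_id[OF xs(2)])
    finally show "\<phi> (Gvar m xs) = (\<lambda>v\<in>config m N. Delta m xs v)" by (simp add: cls_var[OF m])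
  next
    fix \<psi> assume \<psi>: "\<psi> \<in> alg_iso (Gfin m N) (coord_diamond m N) \<and> \<psi> \<in> extensional (carrier (Gfin m N)) \<and>
      (\<forall>xs \<in> tuples m. set xs \<subseteq> {1..int N} \<longrightarrow> \<psi> (Gvar m xs) = (\<lambda>v\<in>config m N. Delta m xs v))"
    then have ps: "\<psi> \<in> Ring.ring_hom (Gfin m N) (coord_diamond m N)"
      "\<And>c x. x \<in> carrier (Gfin m N) \<Longrightarrow> \<psi> (c \<odot>\<^bsub>G m\<^esub> x) = c \<odot>\<^bsub>?F\<^esub> \<psi> x"
      by (auto simp: alg_iso_def alg_hom_def Gops Cops)
    have pc: "\<psi> (cls m f) \<in> carrier ?F" if "f \<in> lset m ?V" for f
    proof -
      have "\<psi> (cls m f) \<in> carrier (coord_diamond m N)" using ring_hom_closed[OF ps(1)] that by (simp add: Gc)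
      then show ?thesis using ring_hom_closed[OF coord_hom] U by (auto simp: coord_diamond_carrier carrier_laurent)
    qed
    have p1: "\<psi> (cls m 1) = \<one>\<^bsub>?F\<^esub>" using ring_hom_one[OF ps(1)] by (simp add: Gops Cops cls_one[OF m])
    have eq: "\<psi> (cls m f) = coord m N f" if f: "f \<in> lset m ?V" for f
    proof (rule lset_hom_unique[OF F.is_monoid, of m ?V "\<lambda>f. \<psi> (cls m f)" "coord m N"])
      fix f g assume fg: "f \<in> lset m ?V" "g \<in> lset m ?V"
      show "\<psi> (cls m (f + g)) = \<psi> (cls m f) \<oplus>\<^bsub>?F\<^esub> \<psi> (cls m g)"
        using ring_hom_add[OF ps(1), of "cls m f" "cls m g"] fg by (simp add: Gc Gops Cops cls_add[OF m] U)
      show "\<psi> (cls m (f * g)) = \<psi> (cls m f) \<otimes>\<^bsub>?F\<^esub> \<psi> (cls m g)"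
        using ring_hom_mult[OF ps(1), of "cls m f" "cls m g"] fg by (simp add: Gc Gops Cops cls_mult[OF m] U)
    next
      fix c
      have "\<psi> (cls m (single 0 c)) = c \<odot>\<^bsub>?F\<^esub> \<psi> (cls m 1)"
        using ps(2)[of "cls m 1" c] cls_smult[OF m, of 1 c] by (simp add: Gc)
      also have "\<dots> = coord m N (single 0 c)" using coord_smult[of 1 c] by (simp add: p1 coord_one)
      finally show "\<psi> (cls m (single 0 c)) = coord m N (single 0 c)" .
    next
      fix xs assume xs: "xs \<in> tuples m" "xs \<in> ?V"
      then have s: "set xs \<subseteq> {1..int N}" by (simp add: invars_def)
      have "\<psi> (Gvar m xs) = (\<lambda>v\<in>config m N. Delta m xs v)" using \<psi> xs s by blast
      then show "\<psi> (cls m (Lvar xs)) = coord m N (Lvar xs)"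
        by (auto simp: cls_var[OF m] coord_def Delta_periodic cyc_map_id[OF s])
    qed (use f pc p1 coord_add coord_mult coord_one U ring_hom_closed[OF coord_hom] in \<open>auto simp: carrier_laurent\<close>)
    show "\<psi> = \<phi>"
    proof (rule extensionalityI)
      show "\<psi> \<in> extensional (carrier (Gfin m N))" using \<psi> by blast
      show "\<phi> \<in> extensional (carrier (Gfin m N))" by (simp add: \<phi>_def)
      fix X assume "X \<in> carrier (Gfin m N)"
      then show "\<psi> X = \<phi> X" unfolding Gc by (auto simp: eq \<phi>)
    qed
  qed
  then show "f \<in> lset m ?V \<Longrightarrow> to_coord m N (cls m f) = coord m N f"
    "bij_betw (to_coord m N) (carrier (Gfin m N)) (carrier (coord_diamond m N))"
    using \<phi> bij by auto
qed

lemma from_coord_coord: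
  assumes "f \<in> lset m (invars {1..int N})" shows "from_coord m N (coord m N f) = cls m f"
proof -
  have "cls m f \<in> carrier (Gfin m N)" using assms by (simp add: Gfin_def G_on_carrier[OF m])
  then have "inv_into (carrier (Gfin m N)) (to_coord m N) (to_coord m N (cls m f)) = cls m f"
    using to_coord_bij by (intro inv_into_f_f) (auto simp: bij_betw_def)
  then show ?thesis by (simp add: from_coord_def to_coord_cls[OF assms])
qed

text \<open>As m divides N, reduction modulo N respects the residues modulo m that mark the
  pairs.\<close>

lemma periodic_kappa:
  assumes mN: "m dvd N" and i: "i \<in> {1..m - 1}"
  shows "periodic N (kappa m N i v) = fraser_map m i (periodic N v)"
proof
  fix k
  define l where "l = cyc N k"
  have lr: "l \<in> {1..int N}" unfolding l_def by (rule cyc_range[OF N_pos])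
  have Nkl: "int N dvd k - l" unfolding l_def by (rule cyc_dvd)
  then have mkl: "int m dvd k - l" using mN by (meson dvd_trans int_dvd_int_iff)
  have res: "int m dvd l - int j \<longleftrightarrow> int m dvd k - int j" for j
  proof -
    have "k - int j = (k - l) + (l - int j)" by simp
    then show ?thesis using mkl dvd_add_right_iff by metis
  qed
  have sh: "cyc N (l + e) = cyc N (k + e)" for e
    by (rule cyc_cong[symmetric]) (use Nkl in simp)
  have idN: "int m dvd int N" using mN by simp
  have im: "0 < i" "i < m" using i m by auto
  show "periodic N (kappa m N i v) k = fraser_map m i (periodic N v) k"
  proof (cases "int m dvd l - int i")
    case True
    \<comment> \<open>No pair straddles the seam, since N as a first member would force m to divide
      i. This is why \<open>kappa\<close> can read the next vector without reducing its
      index.\<close>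
    have "l \<noteq> int N"
    proof
      assume "l = int N"
      then have "int N - (l - int i) = int i" by simp
      moreover have "int m dvd int N - (l - int i)" using idN True by (rule dvd_diff)
      ultimately have "int m dvd int i" by (simp only:)
      then show False using im not_dvd_small[of "int i" m] by simp
    qed
    then have "cyc N (k + 1) = l + 1" using sh[of 1] lr cyc_id[of "l + 1" N] by simp
    then show ?thesis using True lr res[of i] by (simp add: periodic_def kappa_def fraser_map_def l_def[symmetric])
  next
    case False
    show ?thesis
    proof (cases "int m dvd l - int i - 1")
      case True
      have res1: "int m dvd k - int i - 1" using True res[of "i + 1"] by (simp add: algebra_simps)
      \<comment> \<open>The windows at l and at k differ by a multiple of N, which
        \<open>cyc N\<close> removes.\<close>
      have mapc: "map (cyc N) [l - 1 + e..l - 1 + e'] = map (cyc N) [k - 1 + e..k - 1 + e']" for e e'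
      proof -
        have "[k - 1 + e..k - 1 + e'] = map (\<lambda>x. x + (k - l)) [l - 1 + e..l - 1 + e']"
          using map_upto_add[of "k - l" "l - 1 + e" "l - 1 + e'"] by (simp add: algebra_simps)
        then have "map (cyc N) [k - 1 + e..k - 1 + e'] = map (\<lambda>x. cyc N (x + (k - l))) [l - 1 + e..l - 1 + e']"
          by (simp add: comp_def)
        moreover have "cyc N (x + (k - l)) = cyc N x" for x
          by (rule cyc_cong) (use Nkl in simp)
        ultimately show ?thesis by simp
      qed
      have "fraser_vec m N v (l - 1) = fraser_coeff m (periodic N v) (k - 1) \<cdot>\<^sub>v periodic N v k - periodic N v (k - 1)"
      proof -
        have up: "(l - 1 + 1) # [l - 1 + 2..l - 1 + int m] = [l - 1 + 1..l - 1 + int m]"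
          using m upto_rec1[of "l - 1 + 1" "l - 1 + int m"] by (simp add: algebra_simps)
        have c0: "cyc N (l - 1) = cyc N (k - 1)" using sh[of "- 1"] by simp
        have "map (cyc N) ((l - 1) # [l - 1 + 2..l - 1 + int m]) = map (cyc N) ((k - 1) # [k - 1 + 2..k - 1 + int m])"
          using mapc[of 2 "int m"] c0 by simp
        moreover have "map (cyc N) ((l - 1 + 1) # [l - 1 + 2..l - 1 + int m]) = map (cyc N) [k - 1 + 1..k - 1 + int m]"
          unfolding up by (rule mapc)
        ultimately show ?thesis
          unfolding fraser_vec_def fraser_coeff_def Delta_periodic periodic_def
          using c0 sh[of 0] by simp
      qed
      then show ?thesis using False True res[of i] res1 lr
        by (simp add: periodic_def kappa_def fraser_map_def l_def[symmetric])
    next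
      case F: False
      have "\<not> int m dvd k - int i - 1" using F res[of "i + 1"] by (simp add: algebra_simps)
      then show ?thesis using False F res[of i] lr
        by (simp add: periodic_def kappa_def fraser_map_def l_def[symmetric])
    qed
  qed
qed

lemma kappa_config:
  assumes "m \<ge> 2" "m dvd N" "i \<in> {1..m - 1}" "v \<in> config m N"
  shows "kappa m N i v \<in> config m N"
proof -
  have c: "periodic N (kappa m N i v) \<in> conf m"
    using fraser_map_conf[OF assms(1) periodic_conf[OF assms(4)]] periodic_kappa[OF assms(2,3)] by simp
  have "kappa m N i v k \<in> carrier_vec m" if "k \<in> {1..int N}" for k
    using conf_carrier[OF c, of k] by (simp add: periodic_def cyc_id[OF that])
  moreover have "kappa m N i v k = undefined" if "k \<notin> {1..int N}" for k
    using that unfolding kappa_def by (rule restrict_apply[THEN trans, OF if_not_P])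
  ultimately show ?thesis
    using c by (auto simp: config_def conf_def Delta_periodic PiE_def extensional_def)
qed

end


section \<open>The braid group action\<close>

text \<open>A Laurent polynomial has finitely many variables, hence bounded indices; the bound n is
  what the threshold for N in (c) is built from.\<close>

lemma lset_bounded:
  assumes "f \<in> lset m (invars {1..})"
  shows "\<exists>n. f \<in> lset m (invars {1..int n})"
proof -
  have bound: "\<exists>n. xs \<in> invars {1..int n}" if xs: "xs \<in> invars {1..}" for xs
  proof -
    define n where "n = nat (Max (set xs))"
    have "x \<le> int n" if "x \<in> set xs" for x
    proof -
      have "x \<le> Max (set xs)" using that by simp
      then show ?thesis unfolding n_def by linarith
    qed
    with xs have "xs \<in> invars {1..int n}" by (auto simp: invars_def)
    then show ?thesis ..
  qed
  have max: "f \<in> lset m (invars {1..int (max a b)})"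
    if "f \<in> lset m (invars {1..int a}) \<or> f \<in> lset m (invars {1..int b})" for f a b
    using that invars_mono[of "{1..int a}" "{1..int (max a b)}" m]
      invars_mono[of "{1..int b}" "{1..int (max a b)}" m] by auto
  show ?thesis
    using assms
  proof (induction rule: lset_induct)
    case (const c)
    show ?case by simp
  next
    case (var xs)
    then show ?case using bound by (blast intro: lset_Lvar)
  next
    case (inv xs)
    then show ?case using bound by (blast intro: lset_Lvar_inv)
  next
    case (add f g)
    then show ?case using max by (blast intro: lset_add)
  next
    case (mult f g)
    then show ?case using max by (blast intro: lset_mult)
  qed
qed

text \<open>No index leaves the positive half-line, as the second position \<open>t m + i + 1\<close> of a pair is
  positive only if the first one is.\<close>

lemma reaches_positive:
  assumes i: "i \<in> {1..m - 1}" and k: "k \<ge> 1" and d: "int m dvd k - int i - 1"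
  shows "k - 1 \<ge> 1"
proof (rule ccontr)
  assume "\<not> ?thesis"
  with k have "k = 1" by simp
  with d have "int m dvd int i" by simp
  moreover have "0 < i" "i < m" using i by auto
  ultimately show False using not_dvd_small[of "int i" m] by simp
qed

text \<open>The pairs recur with period m, so a shift by m permutes them and carries the windows of
  each coefficient along.\<close>

lemma fraser_shift_commute:
  "fraser_map m i (shift (int m) v) = shift (int m) (fraser_map m i v)"
proof
  fix k
  have d: "int m dvd k + int m - c \<longleftrightarrow> int m dvd k - c" for c
    using dvd_add_right_iff[of "int m" "int m" "k - c"] by (simp add: algebra_simps)
  have up: "map (\<lambda>l. l + int m) (a # [b..c]) = (a + int m) # [b + int m..c + int m]" for a b c
    by (simp add: map_upto_add)
  have "fraser_coeff m (shift (int m) v) (k - 1) = fraser_coeff m v (k + int m - 1)"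
    unfolding fraser_coeff_def Delta_shift up map_upto_add by (simp add: algebra_simps)
  then show "fraser_map m i (shift (int m) v) k = shift (int m) (fraser_map m i v) k"
    using d[of "int i"] d[of "int i + 1"]
    by (simp add: fraser_map_def shift_def algebra_simps)
qed

theorem proposition4p6:
  fixes m :: nat
  assumes "m \<ge> 2"
  shows "\<exists>\<sigma> :: nat \<Rightarrow> laurent set set \<Rightarrow> laurent set set.
    (\<forall>i \<in> {1..m - 1}. \<sigma> i \<in> alg_hom (Gbar_plus m) (Gbar_plus m)) \<and>
    (\<forall>i \<in> {1..m - 2}. \<forall>y \<in> carrier (Gbar_plus m).
       \<sigma> i (\<sigma> (i + 1) (\<sigma> i y)) = \<sigma> (i + 1) (\<sigma> i (\<sigma> (i + 1) y))) \<and>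
    (\<forall>i \<in> {1..m - 1}. \<forall>j \<in> {1..m - 1}. \<bar>int i - int j\<bar> > 1 \<longrightarrow>
       (\<forall>y \<in> carrier (Gbar_plus m). \<sigma> i (\<sigma> j y) = \<sigma> j (\<sigma> i y))) \<and>
    (\<forall>i \<in> {1..m - 1}. \<forall>y \<in> carrier (Gbar_plus m).
       \<sigma> i (sh m (int m) y) = sh m (int m) (\<sigma> i y)) \<and>
    (\<forall>i \<in> {1..m - 1}. \<forall>x \<in> carrier (Gplus m). \<exists>N > 0. \<forall>N' \<ge> N. m dvd N' \<longrightarrow>
       x \<in> carrier (Gfin m N') \<and>
       fraser m N' i (to_coord m N' x) \<in> carrier (coord_diamond m N') \<and>
       \<sigma> i (bar_proj m x) = bar_proj m (from_coord m N' (fraser m N' i (to_coord m N' x))))"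
proof -
  have m: "m \<ge> 1" using assms by simp
  define K where "K = fraser_map m"
  define \<tau> where "\<tau> i = pull m (K i)" for i
  define \<sigma> where "\<sigma> i = induced m (\<tau> i)" for i
  have pb: "alg_pullback m (K i)" if "i \<in> {1..m - 1}" for i
    unfolding K_def by (rule fraser_pullback[OF assms that])
  have compat: "bar_compatible m (\<tau> i)" if "i \<in> {1..m - 1}" for i
    unfolding \<tau>_def K_def by (rule fraser_compatible[OF assms that])
  have \<sigma>: "\<sigma> i (bar_proj m x) = bar_proj m (\<tau> i x)" if "i \<in> {1..m - 1}" "x \<in> carrier (G m)" for i x
    unfolding \<sigma>_def by (rule induced_bar[OF m compat[OF that(1)] that(2)])
  have \<tau>c: "\<tau> i x \<in> carrier (G m)" if "i \<in> {1..m - 1}" "x \<in> carrier (G m)" for i x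
    using pull_alg_hom[OF m pb[OF that(1)]] that(2) by (auto simp: \<tau>_def alg_hom_def dest: ring_hom_closed)
  have lift: "liftable m (K i) (invars J) (invars J')"
    if "i \<in> {1..m - 1}" "reaches m i J J'" for i J J'
    unfolding K_def by (rule fraser_liftable[OF assms that])
  have Gp: "carrier (Gplus m) = cls m ` lset m (invars {1..})"
    unfolding Gplus_def by (rule G_on_carrier[OF m])
  have GpG: "x \<in> carrier (G m)" if "x \<in> carrier (Gplus m)" for x
    using that by (auto simp: Gp intro!: cls_closed[OF m] lset_UNIV)
  have \<tau>p: "\<tau> i x \<in> carrier (Gplus m)" if "i \<in> {1..m - 1}" "x \<in> carrier (Gplus m)" for i x
  proof -
    have "reaches m i {1..} {1..}"
      using reaches_positive[OF that(1)] by (auto simp: reaches_def)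
    then show ?thesis
      using that pull_restrict[OF m pb lift] unfolding \<tau>_def Gplus_def by blast
  qed
  have Gb: "carrier (Gbar_plus m) = bar_proj m ` carrier (Gplus m)"
    by (simp add: Gbar_plus_def)
  have hom: "\<sigma> i \<in> alg_hom (Gbar_plus m) (Gbar_plus m)" if i: "i \<in> {1..m - 1}" for i
  proof -
    have "\<sigma> i \<in> alg_hom (Gbar m) (Gbar m)"
      unfolding \<sigma>_def by (rule induced_alg_hom[OF m compat[OF i]])
    moreover have "carrier (Gbar_plus m) \<subseteq> carrier (Gbar m)"
      unfolding Gb Gbar_carrier[OF m] using GpG by auto
    moreover have "\<sigma> i y \<in> carrier (Gbar_plus m)" if "y \<in> carrier (Gbar_plus m)" for y
      using that i by (auto simp: Gb \<sigma> GpG \<tau>p)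
    moreover have "monoid.mult (Gbar_plus m) = monoid.mult (Gbar m)" "ring.add (Gbar_plus m) = ring.add (Gbar m)"
      "monoid.one (Gbar_plus m) = monoid.one (Gbar m)" "module.smult (Gbar_plus m) = module.smult (Gbar m)"
      by (simp_all add: Gbar_plus_def)
    ultimately show ?thesis
      unfolding alg_hom_def Ring.ring_hom_def by (auto simp: subset_iff)
  qed
  have two: "\<tau> i (\<tau> j x) = pull m (\<lambda>v. K j (K i v)) x"
    if "i \<in> {1..m - 1}" "j \<in> {1..m - 1}" "x \<in> carrier (G m)" for i j x
    unfolding \<tau>_def by (rule pull_pull[OF m pb pb]) (use that in auto)
  have three: "\<tau> k (\<tau> i (\<tau> j x)) = pull m (\<lambda>v. K j (K i (K k v))) x"
    if "i \<in> {1..m - 1}" "j \<in> {1..m - 1}" "k \<in> {1..m - 1}" "x \<in> carrier (G m)" for i j k x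
    unfolding two[OF that(1,2,4)] unfolding \<tau>_def
    by (rule pull_pull[OF m pb alg_pullback_comp[OF m pb pb]]) (use that in auto)
  show ?thesis
  proof (intro exI[of _ \<sigma>] conjI ballI impI)
    fix i y assume i: "i \<in> {1..m - 2}" and "y \<in> carrier (Gbar_plus m)"
    then obtain x where x: "x \<in> carrier (G m)" "y = bar_proj m x" using GpG by (auto simp: Gb)
    have i': "i \<in> {1..m - 1}" "i + 1 \<in> {1..m - 1}" using i by auto
    have "\<tau> i (\<tau> (i + 1) (\<tau> i x)) = \<tau> (i + 1) (\<tau> i (\<tau> (i + 1) x))"
      unfolding three[OF i'(2,1,1) x(1)] three[OF i'(1,2,2) x(1)]
    proof (rule pull_cong[OF m _ _ x(1)])
      show "alg_pullback m (\<lambda>v. K i (K (i + 1) (K i v)))"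
        by (rule alg_pullback_comp[OF m pb[OF i'(1)] alg_pullback_comp[OF m pb[OF i'(2)] pb[OF i'(1)]]])
      show "K i (K (i + 1) (K i v)) = K (i + 1) (K i (K (i + 1) v))" if "v \<in> conf m" for v
        unfolding K_def by (rule fraser_map_braid[OF i that])
    qed
    then show "\<sigma> i (\<sigma> (i + 1) (\<sigma> i y)) = \<sigma> (i + 1) (\<sigma> i (\<sigma> (i + 1) y))"
      using i' x by (simp add: \<sigma> \<tau>c)
  next
    fix i j y assume i: "i \<in> {1..m - 1}" and j: "j \<in> {1..m - 1}" and ij: "\<bar>int i - int j\<bar> > 1"
      and "y \<in> carrier (Gbar_plus m)"
    then obtain x where x: "x \<in> carrier (G m)" "y = bar_proj m x" using GpG by (auto simp: Gb)
    have "\<tau> i (\<tau> j x) = \<tau> j (\<tau> i x)"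
      unfolding two[OF i j x(1)] two[OF j i x(1)]
    proof (rule pull_cong[OF m alg_pullback_comp[OF m pb[OF i] pb[OF j]] _ x(1)])
      fix v assume "v \<in> conf m"
      from fraser_map_commute[OF assms i j ij conf_carrier[OF this]]
      show "K j (K i v) = K i (K j v)" by (simp add: K_def)
    qed
    then show "\<sigma> i (\<sigma> j y) = \<sigma> j (\<sigma> i y)" using i j x by (simp add: \<sigma> \<tau>c)
  next
    fix i y assume i: "i \<in> {1..m - 1}" and "y \<in> carrier (Gbar_plus m)"
    then obtain x where x: "x \<in> carrier (G m)" "y = bar_proj m x" using GpG by (auto simp: Gb)
    let ?S = "shift (int m)"
    have sc: "pull m ?S x \<in> carrier (G m)"
      using pull_alg_hom[OF m shift_pullback[OF m]] x(1) by (auto simp: alg_hom_def dest: ring_hom_closed)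
    have "\<tau> i (pull m ?S x) = pull m ?S (\<tau> i x)"
      unfolding \<tau>_def pull_pull[OF m pb[OF i] shift_pullback[OF m] x(1)]
        pull_pull[OF m shift_pullback[OF m] pb[OF i] x(1)]
      by (simp add: K_def fraser_shift_commute)
    then show "\<sigma> i (sh m (int m) y) = sh m (int m) (\<sigma> i y)"
      using i x sc by (simp add: sh_eq[OF m] \<sigma> \<tau>c)
  next
    fix i x assume i: "i \<in> {1..m - 1}" and "x \<in> carrier (Gplus m)"
    then obtain f where f: "f \<in> lset m (invars {1..})" "x = cls m f" by (auto simp: Gp)
    obtain n where n: "f \<in> lset m (invars {1..int n})" using lset_bounded[OF f(1)] by blast
    have "x \<in> carrier (Gfin m N') \<and>
       fraser m N' i (to_coord m N' x) \<in> carrier (coord_diamond m N') \<and>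
       \<sigma> i (bar_proj m x) = bar_proj m (from_coord m N' (fraser m N' i (to_coord m N' x)))"
      if N': "N' \<ge> n + m + 1" "m dvd N'" for N'
    proof -
      have NN: "N' \<ge> m" using N' by simp
      \<comment> \<open>An index up to n depends on indices up to n + m + 1 only, so that no vector
        from beyond the seam enters the image; this is the origin of the threshold.\<close>
      have "reaches m i {1..int n} {1..int N'}"
        using reaches_positive[OF i] N'(1) by (auto simp: reaches_def)
      then obtain g where g: "g \<in> lset m (invars {1..int N'})" "\<And>v. v \<in> conf m \<Longrightarrow> dval m v g = dval m (K i v) f"
        using lift[OF i] n unfolding liftable_def by blast
      have fN: "f \<in> lset m (invars {1..int N'})"
        using n invars_mono[of "{1..int n}" "{1..int N'}" m] N'(1) by auto
      have \<tau>g: "\<tau> i x = cls m g"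
        unfolding f(2) \<tau>_def
        by (rule pull_cls[OF m _ lset_UNIV[OF fN] lset_UNIV[OF g(1)] g(2)])
          (use pb[OF i] in \<open>auto simp: alg_pullback_def\<close>)
      have dia: "coord m N' h \<in> carrier (coord_diamond m N')" if "h \<in> lset m (invars {1..int N'})" for h
        using that by (simp add: coord_diamond_carrier[OF m NN])
      have fr: "fraser m N' i (to_coord m N' x) = coord m N' g"
      proof -
        have "coord m N' f \<in> carrier (coord_circ m N')"
          using dia[OF fN] coord_diamond_subset[OF m NN] by blast
        \<comment> \<open>Periodic extension turns \<open>kappa\<close> into the map on sequences,
          along which g is the pullback of f.\<close>
        moreover have "coord m N' f (kappa m N' i v) = coord m N' g v" if "v \<in> config m N'" for v
          using that kappa_config[OF m NN assms N'(2) i that] periodic_conf[OF m NN that]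
          by (simp add: coord_def periodic_kappa[OF m NN N'(2) i] g(2) K_def)
        ultimately show ?thesis
          unfolding f(2) to_coord_cls[OF m NN fN] fraser_def by (auto simp: coord_def)
      qed
      have "x \<in> carrier (Gfin m N')"
        using fN by (simp add: f(2) Gfin_def G_on_carrier[OF m])
      moreover have "from_coord m N' (coord m N' g) = cls m g" by (rule from_coord_coord[OF m NN g(1)])
      moreover have "\<sigma> i (bar_proj m x) = bar_proj m (\<tau> i x)"
        by (rule \<sigma>[OF i]) (simp add: f(2) cls_closed[OF m lset_UNIV[OF fN]])
      ultimately show ?thesis by (simp add: fr \<tau>g dia[OF g(1)])
    qed
    then show "\<exists>N>0. \<forall>N'\<ge>N. m dvd N' \<longrightarrow>
       x \<in> carrier (Gfin m N') \<and>
       fraser m N' i (to_coord m N' x) \<in> carrier (coord_diamond m N') \<and>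
       \<sigma> i (bar_proj m x) = bar_proj m (from_coord m N' (fraser m N' i (to_coord m N' x)))"
      by (intro exI[of _ "n + m + 1"]) auto
  qed (use hom in auto)
qed

end
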